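(* For every $\alpha>0$ and $k\in\mathbb N$, the following holds for every $d\in[k-1]$ and $\ell\in\{2,\dots,k-1\}$. Let $H$ be an $n$-vertex $k$-uniform hypergraph such that $\delta_d(H)\ge\left(\delta^{\mathrm{CON}}_{k,\ell,d}+\alpha\right)\binom{n-d}{k-d}$. If $(k-\ell)\mid n$ and $p=\omega(1/n^{k-\ell})$, then asymptotically almost surely the random subhypergraph $H_p$ contains a Hamilton $\ell$-cycle.
   Context: For a $k$-uniform hypergraph $H$ and $d\in[k-1]$, $\delta_d(H)$ is the minimum, over all sets $D$ of $d$ vertices of $H$, of the number of edges of $H$ containing $D$. "$H$ contains a copy of $F$" means $H$ has a subgraph isomorphic to $F$. $H_p$ is the random hypergraph on $V(H)$ obtained by keeping each edge of $H$ independently with probability $p$. "Asymptotically almost surely" means with probability tending to $1$ as $n\to\infty$; $p=\omega(1/n^{k-\ell})$ means $p(n)\,n^{k-\ell}\to\infty$. For $0\le\ell<k$ and $n$ divisible by $k-\ell$, a Hamilton $\ell$-cycle of an $n$-vertex $k$-uniform hypergraph is a copy of the hypergraph $C_{n,k,\ell}$ with vertex set $[n]$ and edges $\{(k-\ell)(i-1)+1,\dots,(k-\ell)(i-1)+k\}$, $i\in[n/(k-\ell)]$, with addition modulo $n$. A $k$-uniform $\ell$-path with $s$ edges is the hypergraph on linearly ordered vertex set $[s(k-\ell)+\ell]$ with edges $\{(k-\ell)(i-1)+1,\dots,(k-\ell)(i-1)+k\}$, $i\in[s]$. Let $\mathcal P_{\ell,k}$ be the family of all $k$-uniform $\ell$-paths.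 Hamilton connectivity threshold. $\delta^{\mathrm{CON}}_{k,\ell,d}$ is the smallest real $\delta$ such that for all $\alpha>0$ and all sufficiently large $n$: for any $F\in\mathcal P_{\ell,k}$ with $|V(F)|=n$, any $n$-vertex $k$-uniform hypergraph $H$ with $\delta_d(H)\ge(\delta+\alpha)\binom{n-d}{k-d}$, and any disjoint $S,T\subseteq V(H)$ with $|S|=|T|=\ell$, $H$ contains a copy of $F$ in which the set of first $\ell$ vertices of $F$ is embedded onto $S$ and the set of last $\ell$ vertices of $F$ is embedded onto $T$. *)

theory Defs
  imports "HOL-Probability.Probability"
begin

record 'a hypergraph =
  verts :: "'a set"
  edges :: "'a set set"

definition uniform_hypergraph :: "nat \<Rightarrow> 'a hypergraph \<Rightarrow> bool" where
  "uniform_hypergraph k H \<longleftrightarrow>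
     finite (verts H) \<and> (\<forall>e\<in>edges H. e \<subseteq> verts H \<and> card e = k)"

definition min_degree :: "nat \<Rightarrow> 'a hypergraph \<Rightarrow> nat" where
  "min_degree d H =
     Min ((\<lambda>D. card {e \<in> edges H. D \<subseteq> e}) ` {D. D \<subseteq> verts H \<and> card D = d})"

definition subhypergraph :: "'a hypergraph \<Rightarrow> 'a hypergraph \<Rightarrow> bool" where
  "subhypergraph G H \<longleftrightarrow> verts G \<subseteq> verts H \<and> edges G \<subseteq> edges H"

definition hypergraph_iso :: "('a \<Rightarrow> 'b) \<Rightarrow> 'a hypergraph \<Rightarrow> 'b hypergraph \<Rightarrow> bool" where
  "hypergraph_iso f F G \<longleftrightarrow>
     bij_betw f (verts F) (verts G) \<and> edges G = (\<lambda>e. f ` e) ` edges F"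

definition contains_copy :: "'a hypergraph \<Rightarrow> 'b hypergraph \<Rightarrow> bool" where
  "contains_copy H F \<longleftrightarrow> (\<exists>G f. subhypergraph G H \<and> hypergraph_iso f F G)"

definition ell_path :: "nat \<Rightarrow> nat \<Rightarrow> nat \<Rightarrow> nat hypergraph" where
  "ell_path k l s =
     \<lparr>verts = {1..s * (k - l) + l},
      edges = (\<lambda>i. {(k - l) * (i - 1) + 1..(k - l) * (i - 1) + k}) ` {1..s}\<rparr>"

definition ell_paths :: "nat \<Rightarrow> nat \<Rightarrow> nat hypergraph set" where
  "ell_paths k l = range (ell_path k l)"

text \<open>The map \<open>x \<mapsto> (x - 1) mod n + 1\<close> is reduction modulo \<open>n\<close> with representatives \<open>1, \<dots>, n\<close>.\<close>

definition ell_cycle :: "nat \<Rightarrow> nat \<Rightarrow> nat \<Rightarrow> nat hypergraph" where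
  "ell_cycle n k l =
     \<lparr>verts = {1..n},
      edges = (\<lambda>i. (\<lambda>x. (x - 1) mod n + 1) ` {(k - l) * (i - 1) + 1..(k - l) * (i - 1) + k})
                ` {1..n div (k - l)}\<rparr>"

definition has_Hamilton_ell_cycle :: "nat \<Rightarrow> nat \<Rightarrow> 'a hypergraph \<Rightarrow> bool" where
  "has_Hamilton_ell_cycle k l H \<longleftrightarrow> contains_copy H (ell_cycle (card (verts H)) k l)"

text \<open>
  Every finite hypergraph is isomorphic to one with natural numbers as vertices, so the
  threshold only quantifies over the latter. A path \<open>F\<close> in \<open>ell_paths k l\<close> with \<open>n\<close> vertices
  has vertex set \<open>{1..n}\<close> in its natural order, which gives its first and last \<open>l\<close> vertices.
\<close>

definition Hamilton_connected_above :: "nat \<Rightarrow> nat \<Rightarrow> nat \<Rightarrow> real \<Rightarrow> bool" where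
  "Hamilton_connected_above k l d c \<longleftrightarrow>
     (\<forall>\<^sub>F n in sequentially.
        \<forall>F\<in>ell_paths k l. \<forall>(H :: nat hypergraph) S T.
          card (verts F) = n \<longrightarrow>
          uniform_hypergraph k H \<longrightarrow> card (verts H) = n \<longrightarrow>
          real (min_degree d H) \<ge> c * real ((n - d) choose (k - d)) \<longrightarrow>
          S \<subseteq> verts H \<longrightarrow> T \<subseteq> verts H \<longrightarrow> S \<inter> T = {} \<longrightarrow> card S = l \<longrightarrow> card T = l \<longrightarrow>
          (\<exists>G f. subhypergraph G H \<and> hypergraph_iso f F G \<and>
                 f ` {1..l} = S \<and> f ` {n - l + 1..n} = T))"

definition delta_CON :: "nat \<Rightarrow> nat \<Rightarrow> nat \<Rightarrow> real" where
  "delta_CON k l d = (LEAST \<delta>. \<forall>\<alpha>>0. Hamilton_connected_above k l d (\<delta> + \<alpha>))"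

lemma Hca_mono:
  assumes "Hamilton_connected_above k l d x" "x \<le> y"
  shows "Hamilton_connected_above k l d y"
proof -
  have *: "x * real m \<le> r" if "y * real m \<le> r" for m r
    using mult_right_mono[OF assms(2), of "real m"] that by linarith
  show ?thesis using assms(1) unfolding Hamilton_connected_above_def
    by (rule eventually_mono) (simp add: *)
qed

lemma min_degree_le:
  assumes "uniform_hypergraph k H" "card (verts H) = n" "d \<le> n" "d \<le> k"
  shows "min_degree d H \<le> (n - d) choose (k - d)"
proof -
  have fin: "finite (verts H)" using assms by (simp add: uniform_hypergraph_def)
  obtain D where D: "D \<subseteq> verts H" "card D = d"
    using assms obtain_subset_with_card_n by metis
  have fD: "finite D" using D fin finite_subset by blast
  have "min_degree d H \<le> card {e \<in> edges H. D \<subseteq> e}"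
    unfolding min_degree_def
  proof (rule Min_le)
    show "finite ((\<lambda>D. card {e \<in> edges H. D \<subseteq> e}) ` {D. D \<subseteq> verts H \<and> card D = d})"
      using fin by simp
  qed (use D in auto)
  also have "\<dots> \<le> card {B. B \<subseteq> verts H - D \<and> card B = k - d}"
  proof (rule card_inj_on_le[where f = "\<lambda>e. e - D"])
    show "inj_on (\<lambda>e. e - D) {e \<in> edges H. D \<subseteq> e}" by (auto simp: inj_on_def)
    show "(\<lambda>e. e - D) ` {e \<in> edges H. D \<subseteq> e} \<subseteq> {B. B \<subseteq> verts H - D \<and> card B = k - d}"
      using assms(1) D fD by (auto simp: uniform_hypergraph_def card_Diff_subset)
  qed (use fin in auto)
  also have "\<dots> = (n - d) choose (k - d)"
    using fin fD D assms by (simp add: n_subsets card_Diff_subset)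
  finally show ?thesis .
qed

lemma Hca_gt1:
  assumes "1 < x" "d < k" shows "Hamilton_connected_above k l d x"
  unfolding Hamilton_connected_above_def
  using eventually_ge_at_top[of k]
proof eventually_elim
  case (elim n)
  have "\<not> x * real ((n - d) choose (k - d)) \<le> real (min_degree d H)"
    if "uniform_hypergraph k H" "card (verts H) = n" for H :: "nat hypergraph"
  proof -
    have "0 < (n - d) choose (k - d)" using elim assms by (simp add: zero_less_binomial_iff)
    moreover have "min_degree d H \<le> (n - d) choose (k - d)"
      by (rule min_degree_le[OF that]) (use elim assms in auto)
    ultimately have "0 < real ((n - d) choose (k - d))"
      and "real (min_degree d H) \<le> 1 * real ((n - d) choose (k - d))" by auto
    then show ?thesis using mult_strict_right_mono[OF assms(1)] by (metis leD le_less_trans)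
  qed
  then show ?case by blast
qed

lemma Hca_nonpos:
  assumes "x \<le> 0" "l < k" shows "\<not> Hamilton_connected_above k l d x"
proof
  assume "Hamilton_connected_above k l d x"
  then obtain N where N: "\<forall>n\<ge>N.
        \<forall>F\<in>ell_paths k l. \<forall>(H :: nat hypergraph) S T.
          card (verts F) = n \<longrightarrow>
          uniform_hypergraph k H \<longrightarrow> card (verts H) = n \<longrightarrow>
          real (min_degree d H) \<ge> x * real ((n - d) choose (k - d)) \<longrightarrow>
          S \<subseteq> verts H \<longrightarrow> T \<subseteq> verts H \<longrightarrow> S \<inter> T = {} \<longrightarrow> card S = l \<longrightarrow> card T = l \<longrightarrow>
          (\<exists>G f. subhypergraph G H \<and> hypergraph_iso f F G \<and>
                 f ` {1..l} = S \<and> f ` {n - l + 1..n} = T)"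
    unfolding Hamilton_connected_above_def eventually_sequentially by (rule exE)
  define s where "s = N + l + 1"
  define n where "n = s * (k - l) + l"
  have "s * 1 \<le> s * (k - l)" using assms by (intro mult_le_mono) auto
  then have n: "N \<le> n" "2 * l \<le> n" by (auto simp: n_def s_def)
  define H :: "nat hypergraph" where "H = \<lparr>verts = {1..n}, edges = {}\<rparr>"
  have "x * real ((n - d) choose (k - d)) \<le> 0"
    using assms by (simp add: mult_nonpos_nonneg)
  then have deg: "x * real ((n - d) choose (k - d)) \<le> real (min_degree d H)"
    by linarith
  have "\<exists>G f. subhypergraph G H \<and> hypergraph_iso f (ell_path k l s) G \<and>
                 f ` {1..l} = {1..l} \<and> f ` {n - l + 1..n} = {l+1..2*l}"
    by (rule N[rule_format, OF n(1)]) (use n deg in \<open>auto simp: ell_paths_def ell_path_def n_def H_def uniform_hypergraph_def\<close>)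
  then show False
    by (auto simp: subhypergraph_def hypergraph_iso_def H_def ell_path_def s_def)
qed

text \<open>The smallest real in the definition of \<^const>\<open>delta_CON\<close> exists.\<close>

lemma delta_CON_is_least:
  assumes "d < k" "l < k"
  defines "A \<equiv> {\<delta>. \<forall>\<alpha>>0. Hamilton_connected_above k l d (\<delta> + \<alpha>)}"
  shows "delta_CON k l d \<in> A" "\<And>\<delta>. \<delta> \<in> A \<Longrightarrow> delta_CON k l d \<le> \<delta>" "0 \<le> delta_CON k l d" "delta_CON k l d \<le> 1"
proof -
  have one: "1 \<in> A" using Hca_gt1 assms by (auto simp: A_def)
  have nn: "0 \<le> \<delta>" if "\<delta> \<in> A" for \<delta>
  proof (rule ccontr)
    assume "\<not> 0 \<le> \<delta>"
    then have "Hamilton_connected_above k l d (\<delta> + (-\<delta>))" using that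
      unfolding A_def by (metis (mono_tags) mem_Collect_eq neg_0_less_iff_less not_le)
    then show False using Hca_nonpos[of 0 l k d] assms by simp
  qed
  then have bdd: "bdd_below A" by (auto simp: bdd_below_def)
  have low: "Inf A \<le> \<delta>" if "\<delta> \<in> A" for \<delta> using cInf_lower[OF that bdd] .
  have "Hamilton_connected_above k l d (Inf A + \<alpha>)" if "\<alpha> > 0" for \<alpha>
  proof -
    have "Inf A < Inf A + \<alpha>" using that by simp
    moreover have "A \<noteq> {}" using one by blast
    ultimately obtain \<delta> where "\<delta> \<in> A" "\<delta> < Inf A + \<alpha>" using cInf_less_iff[OF _ bdd] by blast
    moreover from this have "0 < Inf A + \<alpha> - \<delta>" by simp
    ultimately have "Hamilton_connected_above k l d (\<delta> + (Inf A + \<alpha> - \<delta>))"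
      unfolding A_def by blast
    then show ?thesis by simp
  qed
  then have inA: "Inf A \<in> A" by (auto simp: A_def)
  have "delta_CON k l d = Inf A" unfolding delta_CON_def
    by (rule Least_equality) (use inA low in \<open>auto simp: A_def\<close>)
  then show "delta_CON k l d \<in> A" "\<And>\<delta>. \<delta> \<in> A \<Longrightarrow> delta_CON k l d \<le> \<delta>" "0 \<le> delta_CON k l d" "delta_CON k l d \<le> 1"
    using inA low[of \<delta> for \<delta>] low[OF one] nn[OF inA] by simp_all
qed

definition random_subhypergraph :: "'a hypergraph \<Rightarrow> real \<Rightarrow> 'a hypergraph pmf" where
  "random_subhypergraph H p =
     map_pmf (\<lambda>X. \<lparr>verts = verts H, edges = {e \<in> edges H. X e}\<rparr>)
       (Pi_pmf (edges H) False (\<lambda>_. bernoulli_pmf p))"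

definition sequentially_multiples :: "nat \<Rightarrow> nat filter" where
  "sequentially_multiples m = inf sequentially (principal {n. m dvd n})"

end

theory Submission
  imports Defs "HOL-Real_Asymp.Real_Asymp"
begin

text \<open>
  Let \<open>g = k - l\<close>. If \<open>C\<close> is a random Hamilton \<open>l\<close>-cycle of \<open>H\<close> with law \<open>m\<close>, then
  \<open>X = (\<Sum>C. m C * of_bool (C \<subseteq> H\<^sub>p) / p ^ |C|)\<close> has mean \<open>1\<close> and second moment
  \<open>E (1 / p) ^ |C \<inter> C'|\<close> for independent copies \<open>C, C'\<close>. This tends to \<open>1\<close> as soon as \<open>m\<close> is spread, that is,
  as soon as the probability of any prescribed partial embedding is at most \<open>K ^ s\<close> times the
  probability under a uniform bijection, \<open>s\<close> being the number of prescribed vertices: a subgraph of a fixed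
  cycle with \<open>t\<close> edges and \<open>c\<close> components that does not wind around it has at least \<open>t g + c l\<close> vertices, and the factor
  \<open>n ^ (c (2 - l))\<close> coming from the positions of the components in \<open>C\<close> and \<open>C'\<close> is bounded because \<open>l \<ge> 2\<close>.
  No logarithmic factor is lost, so Chebyshev's inequality finishes the proof.

  A spread law is built by repeated halving. A Hamilton path between two ordered \<open>l\<close>-tuples is obtained
  by choosing uniformly at random a middle \<open>l\<close>-tuple and a partition of the remaining vertices into
  two halves, conditioned on the event that both halves inherit the minimum degree. As the failure
  probabilities and the losses in the degree are summable along the halvings, the constant \<open>K\<close> stays bounded.
  The recursion stops at bounded size, where Hamilton connectivity provides a path.
\<close>

section \<open>Concentration for uniform subsets\<close>

text \<open>The threshold only asserts that one path exists and gives no count, so the spread of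
  \<open>m\<close> has to come entirely from the uniform choices made before connectivity is
  invoked. Applied only to pieces of bounded size, an arbitrary path costs a constant factor for
  each prescribed vertex, which a spread bound tolerates. The price is that the degree condition
  must survive about log n halvings. The allowed error is therefore a function of the current size
  that grows geometrically as the pieces shrink, so that its sum is dominated by the smallest
  pieces, and these are chosen large enough in terms of \<alpha>.

  Two further obstacles shape the construction. Pieces are glued along ordered tuples, while
  connectivity speaks of unordered end sets. And connectivity needs disjoint ends, so a cycle cannot
  be obtained by joining a tuple to itself directly; one halving first separates the two
  ends.\<close>

lemma exp_le_add_exp_square: "exp x \<le> x + exp (x\<^sup>2)" for x :: real
proof -
  have sq: "1 + x\<^sup>2 \<le> exp (x\<^sup>2)" by (rule exp_ge_add_one_self)
  consider "x < -1" | "\<bar>x\<bar> \<le> 1" | "x > 1" by linarith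
  then show ?thesis
  proof cases
    case 1
    then have "exp x \<le> 1" by simp
    moreover have "0 \<le> x + x\<^sup>2"
      using 1 mult_nonpos_nonpos[of x "x + 1"] by (simp add: power2_eq_square algebra_simps)
    ultimately show ?thesis using sq by linarith
  next
    case 2
    have "exp x \<le> 1 + x + x\<^sup>2"
    proof (cases "x \<ge> 0")
      case True then show ?thesis using exp_bound[of x] 2 by simp
    next
      case False
      have "1 \<le> (1 + x + x\<^sup>2) * (1 - x)"
        using False mult_nonpos_nonneg[of x "x * x"] by (simp add: algebra_simps power2_eq_square)
      also have "\<dots> \<le> (1 + x + x\<^sup>2) * exp (- x)"
        using exp_ge_add_one_self[of "-x"] 2 by (intro mult_left_mono) (auto simp: add_nonneg_nonneg)
      finally show ?thesis by (simp add: exp_minus field_simps)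
    qed
    then show ?thesis using sq by linarith
  next
    case 3
    then have "x \<le> x\<^sup>2" by (simp add: power2_eq_square)
    then have "exp x \<le> exp (x\<^sup>2)" by simp
    then show ?thesis using 3 by linarith
  qed
qed

text \<open>A form of Hoeffding's lemma for two values, with constant 1 in place of 1/8. After
  centring at the mean \<open>m\<close>, the linear terms of
  \<open>exp u \<le> u + exp (c\<^sup>2)\<close> average to zero.\<close>

lemma two_point_exp_bound:
  fixes a b c q :: real
  assumes "0 \<le> q" "q \<le> 1" "\<bar>a - b\<bar> \<le> c"
  shows "q * exp a + (1 - q) * exp b \<le> exp (q * a + (1 - q) * b + c\<^sup>2)"
proof -
  define m where "m = q * a + (1 - q) * b"
  have am: "a - m = (1 - q) * (a - b)" and bm: "b - m = - q * (a - b)"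
    by (auto simp: m_def algebra_simps)
  have bnd: "exp u \<le> u + exp (c\<^sup>2)" if "\<bar>u\<bar> \<le> c" for u
  proof -
    have "u\<^sup>2 \<le> c\<^sup>2" using that by (metis abs_ge_zero power2_abs power_mono)
    then show ?thesis using exp_le_add_exp_square[of u] by (smt (verit) exp_le_cancel_iff)
  qed
  have "\<bar>a - m\<bar> \<le> 1 * c" unfolding am abs_mult using assms by (intro mult_mono) auto
  then have A: "q * exp (a - m) \<le> q * ((a - m) + exp (c\<^sup>2))"
    using bnd[of "a - m"] assms by (intro mult_left_mono) auto
  have "\<bar>b - m\<bar> \<le> 1 * c" unfolding bm abs_mult using assms by (intro mult_mono) auto
  then have B: "(1 - q) * exp (b - m) \<le> (1 - q) * ((b - m) + exp (c\<^sup>2))"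
    using bnd[of "b - m"] assms by (intro mult_left_mono) auto
  have "q * exp (a - m) + (1 - q) * exp (b - m) \<le> exp (c\<^sup>2)"
    using A B by (simp add: m_def algebra_simps)
  then have "exp m * (q * exp (a - m) + (1 - q) * exp (b - m)) \<le> exp m * exp (c\<^sup>2)"
    by (intro mult_left_mono) auto
  moreover have "exp m * exp (a - m) = exp a" "exp m * exp (b - m) = exp b"
    by (simp_all flip: exp_add)
  ultimately show ?thesis
    unfolding m_def[symmetric] exp_add by (simp add: ring_distribs mult.left_commute[of "exp m"])
qed

section \<open>Bounded differences for binomial random subsets\<close>

definition random_subset_expectation :: "real \<Rightarrow> 'a set \<Rightarrow> ('a set \<Rightarrow> real) \<Rightarrow> real" where
  "random_subset_expectation q U f =
     (\<Sum>X\<in>Pow U. q ^ card X * (1 - q) ^ card (U - X) * f X)"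

lemma random_subset_expectation_insert:
  assumes "finite U" "v \<notin> U"
  shows "random_subset_expectation q (insert v U) f =
    random_subset_expectation q U (\<lambda>X. q * f (insert v X) + (1 - q) * f X)"
proof -
  have "random_subset_expectation q (insert v U) f =
      (\<Sum>X\<in>Pow U. q ^ card X * (1 - q) ^ card (insert v U - X) * f X) +
      (\<Sum>X\<in>insert v ` Pow U. q ^ card X * (1 - q) ^ card (insert v U - X) * f X)"
    unfolding random_subset_expectation_def Pow_insert
    using assms by (intro sum.union_disjoint) auto
  also have "(\<Sum>X\<in>insert v ` Pow U. q ^ card X * (1 - q) ^ card (insert v U - X) * f X) =
      (\<Sum>X\<in>Pow U. q ^ card (insert v X) * (1 - q) ^ card (insert v U - insert v X) * f (insert v X))"
    using assms by (subst sum.reindex) (auto simp: inj_on_def)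
  also have "\<dots> = (\<Sum>X\<in>Pow U. q * q ^ card X * (1 - q) ^ card (U - X) * f (insert v X))"
  proof (rule sum.cong[OF refl])
    fix X assume X: "X \<in> Pow U"
    then have "finite X" "v \<notin> X" using assms finite_subset by auto
    moreover have "insert v U - insert v X = U - X" using assms X by auto
    ultimately show "q ^ card (insert v X) * (1 - q) ^ card (insert v U - insert v X) * f (insert v X)
      = q * q ^ card X * (1 - q) ^ card (U - X) * f (insert v X)" by simp
  qed
  also have "(\<Sum>X\<in>Pow U. q ^ card X * (1 - q) ^ card (insert v U - X) * f X) =
      (\<Sum>X\<in>Pow U. q ^ card X * ((1 - q) * (1 - q) ^ card (U - X)) * f X)"
  proof (rule sum.cong[OF refl])
    fix X assume X: "X \<in> Pow U"
    then have "insert v U - X = insert v (U - X)" using assms by auto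
    then show "q ^ card X * (1 - q) ^ card (insert v U - X) * f X
      = q ^ card X * ((1 - q) * (1 - q) ^ card (U - X)) * f X" using assms by simp
  qed
  finally show ?thesis
    unfolding random_subset_expectation_def sum.distrib[symmetric]
    by (simp add: algebra_simps)
qed

lemma random_subset_expectation_mono:
  assumes "0 \<le> q" "q \<le> 1" "\<And>X. X \<subseteq> U \<Longrightarrow> f X \<le> h X"
  shows "random_subset_expectation q U f \<le> random_subset_expectation q U h"
  unfolding random_subset_expectation_def
  using assms by (intro sum_mono mult_left_mono) auto

lemma random_subset_expectation_cmult:
  "random_subset_expectation q U (\<lambda>X. f X * c) = random_subset_expectation q U f * c"
  by (simp add: random_subset_expectation_def sum_distrib_right mult.assoc)

lemma random_subset_contains:
  assumes "finite U" "R \<subseteq> U"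
  shows "random_subset_expectation q U (\<lambda>X. if R \<subseteq> X then 1 else 0) = q ^ card R"
  using assms
proof (induction U arbitrary: R rule: finite_induct)
  case empty
  then show ?case by (simp add: random_subset_expectation_def)
next
  case (insert v U)
  show ?case
  proof (cases "v \<in> R")
    case True
    let ?R = "R - {v}"
    have "finite R" using insert.prems insert.hyps by (meson finite.insertI finite_subset)
    then have c: "card R = Suc (card ?R)"
      by (metis True card_Suc_Diff1)
    have "random_subset_expectation q (insert v U) (\<lambda>X. if R \<subseteq> X then 1 else 0)
      = random_subset_expectation q U (\<lambda>X. (if ?R \<subseteq> X then 1 else 0) * q)"
      unfolding random_subset_expectation_insert[OF insert.hyps(1,2)]
      unfolding random_subset_expectation_def
      using True insert.hyps by (intro sum.cong refl) auto
    also have "\<dots> = q ^ card ?R * q"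
      unfolding random_subset_expectation_cmult
      using insert.IH[of ?R] insert.prems True by (simp add: subset_insert_iff)
    finally show ?thesis using c by simp
  next
    case False
    have "random_subset_expectation q (insert v U) (\<lambda>X. if R \<subseteq> X then 1 else 0)
      = random_subset_expectation q U (\<lambda>X. if R \<subseteq> X then 1 else 0)"
      unfolding random_subset_expectation_insert[OF insert.hyps(1,2)]
      unfolding random_subset_expectation_def
      using False by (intro sum.cong refl) (auto simp: subset_insert)
    then show ?thesis using insert False by (simp add: subset_insert)
  qed
qed

text \<open>
  A lossy form of McDiarmid's inequality: peel off one element of \<open>U\<close> at a time.
\<close>

lemma bounded_differences:
  assumes "finite U" "0 \<le> q" "q \<le> 1"
    and "\<And>X v. X \<subseteq> U \<Longrightarrow> v \<in> U \<Longrightarrow> \<bar>f (insert v X) - f X\<bar> \<le> c"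
  shows "random_subset_expectation q U (\<lambda>X. exp (f X))
    \<le> exp (random_subset_expectation q U f + c\<^sup>2 * card U)"
  using assms
proof (induction U arbitrary: f rule: finite_induct)
  case empty
  then show ?case by (simp add: random_subset_expectation_def)
next
  case (insert v U)
  \<comment> \<open>\<open>?h\<close> averages over the presence of \<open>v\<close>. As a convex
    combination it keeps the constant \<open>c\<close>, so every element peeled off costs one factor
    \<open>exp (c\<^sup>2)\<close>.\<close>
  let ?h = "\<lambda>X. q * f (insert v X) + (1 - q) * f X"
  have "random_subset_expectation q (insert v U) (\<lambda>X. exp (f X))
    \<le> random_subset_expectation q U (\<lambda>X. exp (?h X) * exp (c\<^sup>2))"
    unfolding random_subset_expectation_insert[OF insert.hyps(1,2)]
  proof (rule random_subset_expectation_mono)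
    fix X assume "X \<subseteq> U"
    then have "\<bar>f (insert v X) - f X\<bar> \<le> c" using insert.prems by auto
    from two_point_exp_bound[OF insert.prems(1,2) this]
    show "q * exp (f (insert v X)) + (1 - q) * exp (f X) \<le> exp (?h X) * exp (c\<^sup>2)"
      by (simp add: exp_add)
  qed (use insert in auto)
  also have "\<dots> \<le> exp (random_subset_expectation q U ?h + c\<^sup>2 * card U) * exp (c\<^sup>2)"
    unfolding random_subset_expectation_cmult
  proof (intro mult_right_mono insert.IH)
    fix X u assume "X \<subseteq> U" "u \<in> U"
    then have "\<bar>f (insert u (insert v X)) - f (insert v X)\<bar> \<le> c" "\<bar>f (insert u X) - f X\<bar> \<le> c"
      using insert.prems(3)[of "insert v X" u] insert.prems(3)[of X u] by auto
    then have "q * \<bar>f (insert u (insert v X)) - f (insert v X)\<bar> + (1 - q) * \<bar>f (insert u X) - f X\<bar>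
       \<le> q * c + (1 - q) * c"
      using insert.prems by (intro add_mono mult_left_mono) auto
    moreover have "?h (insert u X) - ?h X =
        q * (f (insert u (insert v X)) - f (insert v X)) + (1 - q) * (f (insert u X) - f X)"
      by (simp add: algebra_simps insert_commute)
    then have "\<bar>?h (insert u X) - ?h X\<bar> \<le>
        q * \<bar>f (insert u (insert v X)) - f (insert v X)\<bar> + (1 - q) * \<bar>f (insert u X) - f X\<bar>"
      using insert.prems(1,2) by (metis abs_mult abs_of_nonneg abs_triangle_ineq diff_ge_0_iff_ge)
    ultimately show "\<bar>?h (insert u X) - ?h X\<bar> \<le> c" by (simp add: algebra_simps)
  qed (use insert in auto)
  also have "\<dots> = exp (random_subset_expectation q (insert v U) f + c\<^sup>2 * card (insert v U))"
    using insert.hyps by (simp add: random_subset_expectation_insert exp_add[symmetric] algebra_simps)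
  finally show ?case .
qed

text \<open>
  Conditioning a binomial random subset with density \<open>a / n\<close> on having size \<open>a\<close> costs a factor
  of at most \<open>n + 1\<close>, because \<open>a\<close> is the mode.
\<close>

lemma binomial_mode:
  assumes "a \<le> n"
  shows "real n ^ n \<le> (n + 1) * (real (n choose a) * real a ^ a * real (n - a) ^ (n - a))"
proof -
  \<comment> \<open>The terms in the expansion of \<open>(a + (n - a)) ^ n\<close>. For
    \<open>a < n\<close> the ratio of consecutive ones is
    \<open>(n - j) * a / (Suc j * (n - a))\<close>, at least 1 for \<open>j < a\<close> and at most
    1 for \<open>j \<ge> a\<close>.\<close>
  define t where "t j = (n choose j) * a ^ j * (n - a) ^ (n - j)" for j
  have rel: "Suc j * (n - a) * t (Suc j) = (n - j) * a * t j" if "j < n" for j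
  proof -
    have b: "Suc j * (n choose Suc j) = (n - j) * (n choose j)"
      by (simp only: binomial_absorb_comp binomial_absorption)
    have "n - j = Suc (n - Suc j)" using that by simp
    then have "(n - a) ^ (n - j) = (n - a) * (n - a) ^ (n - Suc j)" by simp
    moreover have "Suc j * (n - a) * t (Suc j) =
        (Suc j * (n choose Suc j)) * (a * a ^ j) * ((n - a) * (n - a) ^ (n - Suc j))"
      by (simp only: t_def power_Suc mult_ac)
    ultimately show ?thesis unfolding b by (simp only: t_def mult_ac)
  qed
  have t0: "t a \<ge> t j" if "j \<le> n" for j
  proof (cases "a = n")
    case True
    then show ?thesis using that by (cases "j = n") (auto simp: t_def power_0_left)
  next
    case False
    then have an: "a < n" using assms by simp
    have up: "t j \<le> t (Suc j)" if "j < a" for j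
    proof -
      have "Suc j * (n - a) \<le> (n - j) * a"
      proof -
        have "Suc j * (n - a) \<le> a * (n - a)" using that by (intro mult_right_mono) auto
        also have "\<dots> \<le> a * (n - j)" using that by (intro mult_left_mono) auto
        finally show ?thesis by (simp add: mult.commute)
      qed
      then have "Suc j * (n - a) * t j \<le> Suc j * (n - a) * t (Suc j)"
        using rel[of j] that an by (metis less_trans mult_le_mono1)
      then show ?thesis using an by simp
    qed
    have down: "t (Suc j) \<le> t j" if "a \<le> j" "j < n" for j
    proof -
      have "(n - j) * a \<le> Suc j * (n - a)"
      proof -
        have "(n - j) * a \<le> (n - a) * a" using that by (intro mult_right_mono) auto
        also have "\<dots> \<le> (n - a) * Suc j" using that by (intro mult_left_mono) auto
        finally show ?thesis by (simp add: mult.commute)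
      qed
      then have "Suc j * (n - a) * t (Suc j) \<le> Suc j * (n - a) * t j"
        using rel[of j] that by (metis mult_le_mono1)
      then show ?thesis using an by simp
    qed
    show ?thesis
    proof (cases "j \<le> a")
      case True
      then show ?thesis
      proof (induction rule: inc_induct)
        case (step i)
        then show ?case using up[of i] by simp
      qed simp
    next
      case False
      then have "a \<le> j" by simp
      then show ?thesis using \<open>j \<le> n\<close>
      proof (induction rule: dec_induct)
        case (step i)
        then show ?case using down[of i] by simp
      qed simp
    qed
  qed
  have "n ^ n = (a + (n - a)) ^ n" using assms by simp
  also have "\<dots> = (\<Sum>j\<le>n. t j)" unfolding binomial t_def by simp
  also have "\<dots> \<le> (\<Sum>j\<le>n. t a)" using t0 by (intro sum_mono) auto
  finally have "n ^ n \<le> (n + 1) * t a" by simp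
  then have "real (n ^ n) \<le> real ((n + 1) * t a)" by (simp only: of_nat_le_iff)
  then show ?thesis by (simp add: t_def algebra_simps)
qed

lemma card_subsets_containing_le:
  assumes "finite U" "v \<in> U"
  shows "card {R. R \<subseteq> U \<and> card R = r \<and> v \<in> R} \<le> card U ^ (r - 1)"
proof -
  have "card {R. R \<subseteq> U \<and> card R = r \<and> v \<in> R} \<le> card {R. R \<subseteq> U - {v} \<and> card R = r - 1}"
  proof (rule card_inj_on_le[where f = "\<lambda>R. R - {v}"])
    show "inj_on (\<lambda>R. R - {v}) {R. R \<subseteq> U \<and> card R = r \<and> v \<in> R}" by (auto simp: inj_on_def)
  qed (use assms in \<open>auto simp: card_Diff_singleton\<close>)
  also have "\<dots> = (card U - 1) choose (r - 1)" using assms by (simp add: n_subsets)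
  also have "\<dots> \<le> (card U - 1) ^ (r - 1)"
    by (cases "r - 1 \<le> card U - 1") (auto simp: binomial_le_pow binomial_eq_0)
  also have "\<dots> \<le> card U ^ (r - 1)" by (intro power_mono) auto
  finally show ?thesis .
qed

text \<open>Exponential Markov inequality for the binomial subset of density \<open>a / N\<close>,
  transferred to uniform \<open>a\<close>-subsets by \<open>binomial_mode\<close>. An element lies
  in at most \<open>N ^ (r - 1)\<close> sets of \<open>F\<close>, which bounds its influence on the
  count.\<close>

lemma uniform_subset_lower_tail:
  fixes \<eta> :: real
  assumes U: "finite U" "card U = N" "0 < N" and "a \<le> N" and "0 < r" "0 \<le> \<eta>"
    and F: "F \<subseteq> {R. R \<subseteq> U \<and> card R = r}"
  shows "real (card {A. A \<subseteq> U \<and> card A = a \<and>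
            real (card {R\<in>F. R \<subseteq> A}) < (real a / N) ^ r * card F - \<eta> * real N ^ r})
     \<le> (N + 1) * exp (- (\<eta>\<^sup>2 * N / 4)) * (N choose a)"
proof -
  define q where "q = real a / N"
  have q: "0 \<le> q" "q \<le> 1" using assms by (auto simp: q_def)
  define s where "s = q ^ a * (1 - q) ^ (N - a)"
  define f where "f A = real (card {R\<in>F. R \<subseteq> A})" for A
  \<comment> \<open>Minimises \<open>lam\<^sup>2 * N ^ (2 * r - 1) - lam * \<eta> * N ^ r\<close>,
    the exponent given by bounded differences; the minimum is
    \<open>- \<eta>\<^sup>2 * N / 4\<close>.\<close>
  define lam where "lam = \<eta> / (2 * real N ^ (r - 1))"
  define c where "c = lam * real N ^ (r - 1)"
  have c: "c = \<eta> / 2" using assms by (simp add: c_def lam_def)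
  define B where "B = {A. A \<subseteq> U \<and> card A = a \<and> f A < q ^ r * card F - \<eta> * real N ^ r}"
  have finF: "finite F" by (rule finite_subset[of _ "Pow U"]) (use F U in auto)
  have fsum: "f X = (\<Sum>R\<in>F. if R \<subseteq> X then 1 else 0)" for X
    unfolding f_def using finF by (simp add: sum.If_cases Int_def)
  have mean: "random_subset_expectation q U f = q ^ r * card F"
  proof -
    have "random_subset_expectation q U f
      = (\<Sum>R\<in>F. random_subset_expectation q U (\<lambda>X. if R \<subseteq> X then 1 else 0))"
      unfolding random_subset_expectation_def fsum sum_distrib_left by (rule sum.swap)
    also have "\<dots> = (\<Sum>R\<in>F. q ^ r)"
      using F U by (intro sum.cong refl) (auto simp: random_subset_contains)
    finally show ?thesis by simp
  qed
  have diff: "\<bar>- lam * f (insert v X) - (- lam * f X)\<bar> \<le> c" if "X \<subseteq> U" "v \<in> U" for X v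
  proof -
    have "{R\<in>F. R \<subseteq> insert v X} \<subseteq> {R\<in>F. R \<subseteq> X} \<union> {R\<in>F. v \<in> R}" by auto
    then have "card {R\<in>F. R \<subseteq> insert v X} \<le> card ({R\<in>F. R \<subseteq> X} \<union> {R\<in>F. v \<in> R})"
      using finF by (intro card_mono) auto
    also have "\<dots> \<le> card {R\<in>F. R \<subseteq> X} + card {R\<in>F. v \<in> R}" by (rule card_Un_le)
    finally have 1: "card {R\<in>F. R \<subseteq> insert v X} \<le> card {R\<in>F. R \<subseteq> X} + card {R\<in>F. v \<in> R}" .
    have "card {R\<in>F. v \<in> R} \<le> card {R. R \<subseteq> U \<and> card R = r \<and> v \<in> R}"
      using F U by (intro card_mono) auto
    also have "\<dots> \<le> N ^ (r - 1)" using card_subsets_containing_le[of U v r] U that by simp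
    finally have 2: "card {R\<in>F. v \<in> R} \<le> N ^ (r - 1)" .
    have 3: "card {R\<in>F. R \<subseteq> X} \<le> card {R\<in>F. R \<subseteq> insert v X}" using finF by (intro card_mono) auto
    have "f (insert v X) - f X \<le> real (N ^ (r - 1))" "0 \<le> f (insert v X) - f X"
      using 1 2 3 unfolding f_def by linarith+
    then have "\<bar>f (insert v X) - f X\<bar> \<le> real N ^ (r - 1)" by simp
    moreover have "0 \<le> lam" using assms by (simp add: lam_def)
    moreover have "- lam * f (insert v X) - (- lam * f X) = - (lam * (f (insert v X) - f X))"
      by (simp add: algebra_simps)
    then have "\<bar>- lam * f (insert v X) - (- lam * f X)\<bar> = \<bar>lam\<bar> * \<bar>f (insert v X) - f X\<bar>"
      by (simp only: abs_minus_cancel abs_mult)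
    ultimately show ?thesis unfolding c_def by (simp add: mult_left_mono)
  qed
  \<comment> \<open>All \<open>a\<close>-subsets have the same binomial weight \<open>s\<close>, so
    the bad ones alone contribute at least this much to the exponential moment.\<close>
  have "real (card B) * (s * exp (- lam * (q ^ r * card F - \<eta> * real N ^ r)))
     = (\<Sum>A\<in>B. s * exp (- lam * (q ^ r * card F - \<eta> * real N ^ r)))" by simp
  also have "\<dots> \<le> (\<Sum>A\<in>B. q ^ card A * (1 - q) ^ card (U - A) * exp (- lam * f A))"
  proof (rule sum_mono)
    fix A assume A: "A \<in> B"
    then have "card (U - A) = N - a" "card A = a"
      using U by (auto simp: B_def card_Diff_subset finite_subset)
    moreover have "exp (- lam * (q ^ r * card F - \<eta> * real N ^ r)) \<le> exp (- lam * f A)"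
      using A assms by (auto simp: B_def lam_def intro!: divide_right_mono mult_left_mono)
    ultimately show "s * exp (- lam * (q ^ r * card F - \<eta> * real N ^ r))
       \<le> q ^ card A * (1 - q) ^ card (U - A) * exp (- lam * f A)"
      unfolding s_def using q by (auto intro!: mult_left_mono)
  qed
  also have "\<dots> \<le> random_subset_expectation q U (\<lambda>A. exp (- lam * f A))"
    unfolding random_subset_expectation_def
    using U q by (intro sum_mono2) (auto simp: B_def)
  also have "\<dots> \<le> exp (random_subset_expectation q U (\<lambda>A. - lam * f A) + c\<^sup>2 * card U)"
    using U q diff by (intro bounded_differences) auto
  also have "random_subset_expectation q U (\<lambda>A. - lam * f A) = - lam * (q ^ r * card F)"
    using random_subset_expectation_cmult[of q U f "- lam"] mean by (simp add: mult.commute)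
  also have "exp (- lam * (q ^ r * card F) + c\<^sup>2 * card U)
     = exp (- (\<eta>\<^sup>2 * N / 4)) * exp (- lam * (q ^ r * card F - \<eta> * real N ^ r))"
  proof -
    have "lam * (\<eta> * real N ^ r) = \<eta>\<^sup>2 * N / 2"
      using assms by (cases r) (auto simp: lam_def power2_eq_square)
    then have "- lam * (q ^ r * card F) + (\<eta> / 2)\<^sup>2 * N
        = - (\<eta>\<^sup>2 * N / 4) + - lam * (q ^ r * card F - \<eta> * real N ^ r)"
      unfolding right_diff_distrib by (simp add: power_divide)
    then show ?thesis unfolding exp_add[symmetric] c using U by simp
  qed
  finally have main: "real (card B) * s \<le> exp (- (\<eta>\<^sup>2 * N / 4))"
    by (simp only: mult.assoc[symmetric] mult_le_cancel_right exp_gt_zero not_less_iff_gr_or_eq simp_thms)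
  \<comment> \<open>With this identity \<open>binomial_mode\<close> reads
    \<open>1 \<le> (N + 1) * (N choose a) * s\<close>: the size \<open>a\<close> is hit with
    probability at least \<open>1 / (N + 1)\<close>.\<close>
  have "real N ^ N * s = real a ^ a * real (N - a) ^ (N - a)"
  proof -
    have "N * (1 - q) = real (N - a)" using assms by (simp add: q_def field_simps of_nat_diff)
    moreover have "N * q = a" using assms by (simp add: q_def)
    moreover have "real N ^ N = real N ^ a * real N ^ (N - a)"
      using assms by (simp flip: power_add)
    then have "real N ^ N * s = (N * q) ^ a * (N * (1 - q)) ^ (N - a)"
      by (simp add: s_def power_mult_distrib)
    ultimately show ?thesis by simp
  qed
  moreover have "real N ^ N * (((real N + 1) * real (N choose a)) * s)
      = ((real N + 1) * real (N choose a)) * (real N ^ N * s)"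
    by (simp only: mult.left_commute)
  ultimately have "real N ^ N * 1 \<le> real N ^ N * (((real N + 1) * real (N choose a)) * s)"
    using binomial_mode[OF \<open>a \<le> N\<close>] by (simp only: mult.assoc mult_1_right of_nat_add of_nat_1)
  moreover have "0 < real N ^ N" using assms by simp
  ultimately have one: "1 \<le> ((real N + 1) * real (N choose a)) * s"
    using mult_le_cancel_left_pos by blast
  have "real (card B) * 1 \<le> real (card B) * (((real N + 1) * real (N choose a)) * s)"
    using one by (intro mult_left_mono) auto
  also have "\<dots> = ((real N + 1) * real (N choose a)) * (real (card B) * s)"
    by (simp only: mult.left_commute)
  also have "\<dots> \<le> ((real N + 1) * real (N choose a)) * exp (- (\<eta>\<^sup>2 * N / 4))"
    using main by (intro mult_left_mono) auto
  also have "\<dots> = (N + 1) * exp (- (\<eta>\<^sup>2 * N / 4)) * (N choose a)" by simp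
  finally show ?thesis
    unfolding B_def f_def q_def by (simp only: mult_1_right of_nat_add of_nat_1)
qed

section \<open>From unordered to ordered connections\<close>

definition link :: "'a set set \<Rightarrow> 'a set \<Rightarrow> 'a set \<Rightarrow> nat \<Rightarrow> 'a set set" where
  "link E D A r = {R. R \<subseteq> A - D \<and> card R = r \<and> R \<union> D \<in> E}"

text \<open>For a list whose length is congruent to \<open>l\<close> modulo
  \<open>g = k - l\<close>, these windows are the edges of an l-path through the whole list.\<close>

definition ell_seq :: "nat \<Rightarrow> nat \<Rightarrow> 'a set set \<Rightarrow> 'a list \<Rightarrow> bool" where
  "ell_seq k g E v \<longleftrightarrow> (\<forall>j. j * g + k \<le> length v \<longrightarrow> set (take k (drop (j * g) v)) \<in> E)"

lemma card_Un3_disjoint: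
  assumes "finite A" "finite B" "finite C" "A \<inter> B = {}" "A \<inter> C = {}" "B \<inter> C = {}"
  shows "card (A \<union> B \<union> C) = card A + card B + card C"
  using assms by (simp add: card_Un_disjoint Int_Un_distrib2)

lemma set_window: "p + m \<le> length v \<Longrightarrow> set (take m (drop p v)) = (!) v ` {p..<p + m}"
proof -
  assume "p + m \<le> length v"
  then have "set (take m (drop p v)) = (\<lambda>i. v ! (p + i)) ` {0..<m}"
    using nth_image[of m "drop p v"] by simp
  also have "\<dots> = (!) v ` (+) p ` {0..<m}" unfolding image_image ..
  also have "(+) p ` {0..<m} = {p..<p + m}" by (simp add: add.commute)
  finally show ?thesis .
qed

text \<open>
  The connectivity hypothesis prescribes the end sets but not the order of their vertices. Replace the end tuples \<open>x\<close> and \<open>y\<close>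
  by sets \<open>X\<close> and \<open>Y\<close> of interchangeable dummies: a set \<open>e\<close> is an edge if its image \<open>\<rho> e\<close> is, where \<open>i\<close> dummies of \<open>X\<close>
  stand for the last \<open>i\<close> entries of \<open>x\<close> and \<open>i\<close> dummies of \<open>Y\<close> for the first \<open>i\<close> entries of \<open>y\<close>. Degrees are preserved, and
  in a path the dummies may be replaced by \<open>x\<close> and \<open>y\<close> in the prescribed order.
\<close>

lemma ordered_Hamilton_connection:
  fixes E :: "'a set set" and x y :: "'a list"
  assumes par: "l < k" "d < k" "d \<le> N"
    and U: "finite U" "card U = N"
    and xy: "distinct x" "distinct y" "length x = l" "length y = l"
      "set x \<inter> U = {}" "set y \<inter> U = {}" "set x \<inter> set y = {}"
    and dvd: "(k - l) dvd (N + l)"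
    and conn: "\<And>F (H :: nat hypergraph) S T. F \<in> ell_paths k l \<Longrightarrow> card (verts F) = N + 2 * l \<Longrightarrow>
          uniform_hypergraph k H \<Longrightarrow> card (verts H) = N + 2 * l \<Longrightarrow>
          real (min_degree d H) \<ge> c * real ((N + 2 * l - d) choose (k - d)) \<Longrightarrow>
          S \<subseteq> verts H \<Longrightarrow> T \<subseteq> verts H \<Longrightarrow> S \<inter> T = {} \<Longrightarrow> card S = l \<Longrightarrow> card T = l \<Longrightarrow>
          (\<exists>G f. subhypergraph G H \<and> hypergraph_iso f F G \<and>
                 f ` {1..l} = S \<and> f ` {N + 2 * l - l + 1..N + 2 * l} = T)"
    and deg: "\<And>D. D \<subseteq> U \<union> set x \<union> set y \<Longrightarrow> card D = d \<Longrightarrow>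
        c * real ((N + 2 * l - d) choose (k - d)) \<le> real (card (link E D U (k - d)))"
  shows "\<exists>w. distinct w \<and> set w = U \<and> ell_seq k (k - l) E (x @ w @ y)"
proof -
  obtain h where h: "bij_betw h {..<N} U"
    using ex_bij_betw_nat_finite[OF U(1)] U(2) by (auto simp: atLeast0LessThan)
  define X where "X = {N..<N + l}"
  define Y where "Y = {N + l..<N + 2 * l}"
  define V where "V = {..<N + 2 * l}"
  define \<rho> where "\<rho> e = h ` (e \<inter> {..<N}) \<union> set (drop (l - card (e \<inter> X)) x) \<union> set (take (card (e \<inter> Y)) y)" for e
  define H where "H = \<lparr>verts = V, edges = {e. e \<subseteq> V \<and> card e = k \<and> \<rho> e \<in> E}\<rparr>"
  have Vsplit: "V = {..<N} \<union> X \<union> Y" by (auto simp: V_def X_def Y_def)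
  have injh: "inj_on h {..<N}" using h by (simp add: bij_betw_def)
  have card_\<rho>: "card (\<rho> e) = card e" and \<rho>_sub: "\<rho> e \<subseteq> U \<union> set x \<union> set y" if e: "e \<subseteq> V" for e
  proof -
    have fin: "finite e" using e by (auto simp: V_def finite_subset)
    have hU: "h ` (e \<inter> {..<N}) \<subseteq> U" using h by (auto simp: bij_betw_def)
    have dx: "set (drop m x) \<subseteq> set x" and ty: "set (take m y) \<subseteq> set y" for m
      by (simp_all add: set_drop_subset set_take_subset)
    show "\<rho> e \<subseteq> U \<union> set x \<union> set y" using hU dx ty unfolding \<rho>_def by blast
    have cX: "card (e \<inter> X) \<le> l" using card_mono[of X "e \<inter> X"] by (auto simp: X_def)
    have cY: "card (e \<inter> Y) \<le> l" using card_mono[of Y "e \<inter> Y"] by (auto simp: Y_def)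
    have "card (\<rho> e) = card (h ` (e \<inter> {..<N})) + card (set (drop (l - card (e \<inter> X)) x)) + card (set (take (card (e \<inter> Y)) y))"
      unfolding \<rho>_def
    proof (rule card_Un3_disjoint)
      show "h ` (e \<inter> {..<N}) \<inter> set (drop (l - card (e \<inter> X)) x) = {}"
        "h ` (e \<inter> {..<N}) \<inter> set (take (card (e \<inter> Y)) y) = {}"
        using hU xy(5,6) dx[of "l - card (e \<inter> X)"] ty[of "card (e \<inter> Y)"] by blast+
      show "set (drop (l - card (e \<inter> X)) x) \<inter> set (take (card (e \<inter> Y)) y) = {}"
        using xy(7) dx[of "l - card (e \<inter> X)"] ty[of "card (e \<inter> Y)"] by blast
    qed (use fin in auto)
    also have "card (h ` (e \<inter> {..<N})) = card (e \<inter> {..<N})"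
      by (rule card_image) (use injh in \<open>auto intro: inj_on_subset\<close>)
    also have "card (set (drop (l - card (e \<inter> X)) x)) = card (e \<inter> X)"
      using xy cX by (simp add: distinct_card)
    also have "card (set (take (card (e \<inter> Y)) y)) = card (e \<inter> Y)"
      using xy cY by (simp add: distinct_card)
    also have "card (e \<inter> {..<N}) + card (e \<inter> X) + card (e \<inter> Y) = card e"
    proof -
      have "e = (e \<inter> {..<N}) \<union> (e \<inter> X) \<union> (e \<inter> Y)" using e Vsplit by auto
      moreover have "card ((e \<inter> {..<N}) \<union> (e \<inter> X) \<union> (e \<inter> Y)) = card (e \<inter> {..<N}) + card (e \<inter> X) + card (e \<inter> Y)"
        by (rule card_Un3_disjoint) (use fin in \<open>auto simp: X_def Y_def\<close>)
      ultimately show ?thesis by metis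
    qed
    finally show "card (\<rho> e) = card e" .
  qed
  have deg_H: "c * real ((N + 2 * l - d) choose (k - d)) \<le> real (card {e \<in> edges H. D \<subseteq> e})"
    if D: "D \<subseteq> V" "card D = d" for D
  proof -
    have finD: "finite D" using D by (auto simp: V_def finite_subset)
    define h' where "h' = inv_into {..<N} h"
    have h': "bij_betw h' U {..<N}" unfolding h'_def by (rule bij_betw_inv_into[OF h])
    have hh': "h (h' u) = u" if "u \<in> U" for u
      unfolding h'_def using h that by (metis bij_betw_inv_into_right)
    \<comment> \<open>A completion \<open>R \<subseteq> U\<close> pulls back through
      \<open>h\<close> without involving dummies, so \<open>\<rho>\<close> maps the enlarged set to
      \<open>R \<union> \<rho> D\<close>. This is why the degree hypothesis counts only completions
      inside \<open>U\<close>.\<close>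
    have "card (link E (\<rho> D) U (k - d)) \<le> card {e \<in> edges H. D \<subseteq> e}"
    proof (rule card_inj_on_le[where f = "\<lambda>R. D \<union> h' ` R"])
      have R: "h ` (h' ` R) = R \<and> h' ` R \<subseteq> {..<N} \<and> h' ` R \<inter> D = {} \<and> finite (h' ` R) \<and> card (h' ` R) = k - d"
        if "R \<in> link E (\<rho> D) U (k - d)" for R
      proof -
        have RU: "R \<subseteq> U" "R \<inter> \<rho> D = {}" "card R = k - d" using that by (auto simp: link_def)
        have 1: "h ` (h' ` R) = R" using RU hh' by (force simp: image_image)
        have 2: "h' ` R \<subseteq> {..<N}" using RU h' by (auto simp: bij_betw_def)
        have 3: "h' ` R \<inter> D = {}"
        proof -
          have "h ` (D \<inter> {..<N}) \<subseteq> \<rho> D" by (auto simp: \<rho>_def)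
          then show ?thesis using 1 2 RU by blast
        qed
        have 4: "card (h' ` R) = card R"
          by (rule card_image) (use h' RU in \<open>auto simp: bij_betw_def intro: inj_on_subset\<close>)
        show ?thesis using 1 2 3 4 RU finite_subset[OF 2] by auto
      qed
      show "inj_on (\<lambda>R. D \<union> h' ` R) (link E (\<rho> D) U (k - d))"
      proof (rule inj_onI)
        fix R S assume RS: "R \<in> link E (\<rho> D) U (k - d)" "S \<in> link E (\<rho> D) U (k - d)"
          and eq: "D \<union> h' ` R = D \<union> h' ` S"
        have d: "h' ` R \<inter> D = {}" "h' ` S \<inter> D = {}" and b: "h ` (h' ` R) = R" "h ` (h' ` S) = S"
          using R[OF RS(1)] R[OF RS(2)] by simp_all
        have "A = B" if "D \<union> A = D \<union> B" "A \<inter> D = {}" "B \<inter> D = {}" for A B :: "nat set"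
          using that by blast
        from this[OF eq d] have "h ` (h' ` R) = h ` (h' ` S)" by (rule arg_cong)
        then show "R = S" unfolding b .
      qed
      show "(\<lambda>R. D \<union> h' ` R) ` link E (\<rho> D) U (k - d) \<subseteq> {e \<in> edges H. D \<subseteq> e}"
      proof (rule image_subsetI)
        fix R assume RL: "R \<in> link E (\<rho> D) U (k - d)"
        have R: "h ` (h' ` R) = R" "h' ` R \<subseteq> {..<N}" "h' ` R \<inter> D = {}" "finite (h' ` R)"
            "card (h' ` R) = k - d"
          using R[OF RL] by simp_all
        have "card (D \<union> h' ` R) = card D + card (h' ` R)"
          using finD R(3,4) by (intro card_Un_disjoint) auto
        then have "card (D \<union> h' ` R) = k" using R(5) D par by simp
        moreover have "(D \<union> h' ` R) \<inter> X = D \<inter> X" "(D \<union> h' ` R) \<inter> Y = D \<inter> Y"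
          using R(2) by (auto simp: X_def Y_def)
        moreover have "(D \<union> h' ` R) \<inter> {..<N} = D \<inter> {..<N} \<union> h' ` R" using R(2) by blast
        ultimately have "\<rho> (D \<union> h' ` R) = R \<union> \<rho> D"
          unfolding \<rho>_def using R(1) by (simp add: image_Un Un_ac)
        then have "\<rho> (D \<union> h' ` R) \<in> E" using RL by (simp add: link_def)
        moreover have "D \<union> h' ` R \<subseteq> V" using D R(2) by (auto simp: V_def)
        ultimately show "D \<union> h' ` R \<in> {e \<in> edges H. D \<subseteq> e}"
          using \<open>card (D \<union> h' ` R) = k\<close> by (simp add: H_def)
      qed
      have "finite {e. e \<subseteq> V}" by (simp add: V_def)
      then show "finite {e \<in> edges H. D \<subseteq> e}"
        by (rule rev_finite_subset) (auto simp: H_def)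
    qed
    moreover have "c * real ((N + 2 * l - d) choose (k - d)) \<le> real (card (link E (\<rho> D) U (k - d)))"
      using deg[OF \<rho>_sub[OF D(1)]] card_\<rho>[OF D(1)] D(2) by simp
    ultimately show ?thesis by linarith
  qed
  obtain s where s: "N + l = (k - l) * s" using dvd by (auto elim: dvdE)
  define F where "F = ell_path k l s"
  have vF: "verts F = {1..N + 2 * l}" using s by (simp add: F_def ell_path_def mult.commute)
  have "\<exists>G f. subhypergraph G H \<and> hypergraph_iso f F G \<and>
                 f ` {1..l} = X \<and> f ` {N + 2 * l - l + 1..N + 2 * l} = Y"
  proof (rule conn)
    show "F \<in> ell_paths k l" by (auto simp: F_def ell_paths_def)
    show "card (verts F) = N + 2 * l" by (simp add: vF)
    show "uniform_hypergraph k H" "card (verts H) = N + 2 * l"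
      by (auto simp: uniform_hypergraph_def H_def V_def)
    have "min_degree d H \<in> (\<lambda>D. card {e \<in> edges H. D \<subseteq> e}) ` {D. D \<subseteq> verts H \<and> card D = d}"
      unfolding min_degree_def
    proof (rule Min_in)
      show "finite ((\<lambda>D. card {e \<in> edges H. D \<subseteq> e}) ` {D. D \<subseteq> verts H \<and> card D = d})"
        by (simp add: H_def V_def)
      have "{..<d} \<in> {D. D \<subseteq> verts H \<and> card D = d}" using par by (auto simp: H_def V_def)
      then show "(\<lambda>D. card {e \<in> edges H. D \<subseteq> e}) ` {D. D \<subseteq> verts H \<and> card D = d} \<noteq> {}" by blast
    qed
    then obtain D where "D \<subseteq> V" "card D = d" "min_degree d H = card {e \<in> edges H. D \<subseteq> e}"
      by (auto simp: H_def)
    then show "c * real ((N + 2 * l - d) choose (k - d)) \<le> real (min_degree d H)"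
      using deg_H by simp
  qed (auto simp: H_def V_def X_def Y_def)
  moreover have "N + 2 * l - l + 1 = N + l + 1" by simp
  ultimately obtain G f where G: "subhypergraph G H" "hypergraph_iso f F G" "f ` {1..l} = X"
      "f ` {N + l + 1..N + 2 * l} = Y" by metis
  have fb: "bij_betw f {1..N + 2 * l} (verts G)" using G(2) by (simp add: hypergraph_iso_def vF)
  have "verts G = V"
  proof (rule card_subset_eq)
    show "verts G \<subseteq> V" using G(1) by (simp add: subhypergraph_def H_def)
    show "card (verts G) = card V" using bij_betw_same_card[OF fb] by (simp add: V_def)
  qed (simp add: V_def)
  then have fb: "bij_betw f {1..N + 2 * l} V" using fb by simp
  then have injf: "inj_on f {1..N + 2 * l}" by (simp add: bij_betw_def)
  have fmid: "f ` {l + 1..N + l} = {..<N}"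
  proof -
    have "{l + 1..N + l} = {1..N + 2 * l} - ({1..l} \<union> {N + l + 1..N + 2 * l})" by auto
    then have "f ` {l + 1..N + l} = f ` {1..N + 2 * l} - f ` ({1..l} \<union> {N + l + 1..N + 2 * l})"
      using inj_on_image_set_diff[OF injf, of "{1..N + 2 * l}" "{1..l} \<union> {N + l + 1..N + 2 * l}"] by auto
    also have "\<dots> = V - (X \<union> Y)" using fb G by (simp add: bij_betw_def image_Un)
    also have "\<dots> = {..<N}" by (auto simp: V_def X_def Y_def)
    finally show ?thesis .
  qed
  \<comment> \<open>List positions start at 0 and path positions at 1; the first \<open>l\<close> of
    the latter belong to \<open>x\<close>.\<close>
  define w where "w = map (\<lambda>i. h (f (i + l + 1))) [0..<N]"
  have lw: "length w = N" by (simp add: w_def)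
  have bw: "bij_betw (\<lambda>i. h (f (i + l + 1))) {0..<N} U"
  proof -
    have "bij_betw (\<lambda>i. i + l + 1) {0..<N} {l + 1..N + l}"
      by (rule bij_betwI[where g = "\<lambda>i. i - (l + 1)"]) auto
    moreover have "bij_betw f {l + 1..N + l} {..<N}"
      using fmid injf by (auto simp: bij_betw_def intro: inj_on_subset)
    ultimately have "bij_betw (h \<circ> (f \<circ> (\<lambda>i. i + l + 1))) {0..<N} U"
      using h by (blast intro: bij_betw_trans)
    then show ?thesis by (simp add: comp_def)
  qed
  have "distinct w" "set w = U"
    using bw by (auto simp: w_def distinct_map bij_betw_def)
  moreover have "ell_seq k (k - l) E (x @ w @ y)"
    unfolding ell_seq_def
  proof (intro allI impI)
    fix j assume "j * (k - l) + k \<le> length (x @ w @ y)"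
    define p where "p = j * (k - l)"
    have p: "p + k \<le> N + 2 * l" using \<open>j * (k - l) + k \<le> _\<close> xy lw by (simp add: p_def)
    define I where "I = {p + 1..p + k}"
    have "(k - l) * (j + 1) = p + (k - l)" by (simp add: p_def)
    then have "(k - l) * (j + 1) \<le> (k - l) * s" using p s par by linarith
    then have "j + 1 \<le> s" using par by (simp del: mult_Suc_right)
    then have "I \<in> edges F" unfolding F_def ell_path_def I_def p_def
      by (auto simp: image_iff mult.commute intro!: bexI[of _ "j + 1"])
    then have "f ` I \<in> edges H" using G by (auto simp: hypergraph_iso_def subhypergraph_def)
    then have "\<rho> (f ` I) \<in> E" by (simp add: H_def)
    \<comment> \<open>Since \<open>k > l\<close>, an interval \<open>I\<close> of length
      \<open>k\<close> meets the first \<open>l\<close> positions in a final segment and the last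
      \<open>l\<close> positions in an initial segment. So the dummies in its image stand for
      exactly the entries of \<open>x\<close> and \<open>y\<close> at the positions in
      \<open>I\<close>.\<close>
    moreover have "\<rho> (f ` I) = set (take k (drop p (x @ w @ y)))"
    proof -
      have I: "I \<subseteq> {1..N + 2 * l}" using p by (auto simp: I_def)
      have "f ` I \<inter> X = f ` (I \<inter> {1..l})"
        unfolding G(3)[symmetric] using inj_on_image_Int[OF injf I, of "{1..l}"] by auto
      then have "card (f ` I \<inter> X) = card (I \<inter> {1..l})"
        using card_image[OF inj_on_subset[OF injf], of "I \<inter> {1..l}"] I by auto
      also have "I \<inter> {1..l} = {p + 1..l}" using par by (auto simp: I_def)
      finally have "l - card (f ` I \<inter> X) = min l p" by auto
      then have eX: "set (drop (l - card (f ` I \<inter> X)) x) = (!) x ` {p..<l}"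
        using xy set_window[of "min l p" "l - min l p" x] by (cases "p \<le> l") (auto simp: min_def)
      have "f ` I \<inter> Y = f ` (I \<inter> {N + l + 1..N + 2 * l})"
        unfolding G(4)[symmetric] using inj_on_image_Int[OF injf I, of "{N + l + 1..N + 2 * l}"] by auto
      then have "card (f ` I \<inter> Y) = card (I \<inter> {N + l + 1..N + 2 * l})"
        using card_image[OF inj_on_subset[OF injf], of "I \<inter> {N + l + 1..N + 2 * l}"] I by auto
      also have "I \<inter> {N + l + 1..N + 2 * l} = {N + l + 1..p + k}" using par p by (auto simp: I_def)
      finally have cY: "card (f ` I \<inter> Y) = p + k - (N + l)" by simp
      then have eY: "set (take (card (f ` I \<inter> Y)) y) = (!) y ` {0..<p + k - (N + l)}"
        using xy p set_window[of 0 "p + k - (N + l)" y] by simp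
      have "f ` I \<inter> {..<N} = f ` (I \<inter> {l + 1..N + l})"
        unfolding fmid[symmetric] using inj_on_image_Int[OF injf I, of "{l + 1..N + l}"] by auto
      then have eM: "h ` (f ` I \<inter> {..<N}) = (\<lambda>i. h (f i)) ` (I \<inter> {l + 1..N + l})"
        by (simp add: image_image)
      have "set (take k (drop p (x @ w @ y))) = (!) (x @ w @ y) ` {p..<p + k}"
        using p xy lw by (intro set_window) simp
      also have "{p..<p + k} = {p..<l} \<union> {max p l..<min (p + k) (N + l)} \<union> (\<lambda>i. i + (N + l)) ` {0..<p + k - (N + l)}"
      proof -
        have "(\<lambda>i. i + (N + l)) ` {0..<p + k - (N + l)} = {N + l..<p + k}"
          unfolding image_add_atLeastLessThan' by (cases "N + l \<le> p + k") auto
        moreover have "i \<in> {p..<p + k} \<longleftrightarrow>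
            i \<in> {p..<l} \<union> {max p l..<min (p + k) (N + l)} \<union> {N + l..<p + k}" for i
          unfolding Un_iff atLeastLessThan_iff using p par by linarith
        ultimately show ?thesis by blast
      qed
      also have "(!) (x @ w @ y) ` \<dots> = (!) x ` {p..<l} \<union> (\<lambda>i. h (f (i + 1))) ` {max p l..<min (p + k) (N + l)} \<union> (!) y ` {0..<p + k - (N + l)}"
      proof -
        have "(!) (x @ w @ y) ` {p..<l} = (!) x ` {p..<l}"
          using xy by (intro image_cong) (auto simp: nth_append)
        moreover have "(!) (x @ w @ y) ` {max p l..<min (p + k) (N + l)} = (\<lambda>i. h (f (i + 1))) ` {max p l..<min (p + k) (N + l)}"
          using xy lw by (intro image_cong) (auto simp: nth_append w_def)
        moreover have "(!) (x @ w @ y) ` (\<lambda>i. i + (N + l)) ` {0..<p + k - (N + l)} = (!) y ` {0..<p + k - (N + l)}"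
          unfolding image_image using xy lw by (intro image_cong) (auto simp: nth_append)
        ultimately show ?thesis by (simp add: image_Un)
      qed
      also have "(\<lambda>i. h (f (i + 1))) ` {max p l..<min (p + k) (N + l)} = (\<lambda>i. h (f i)) ` (I \<inter> {l + 1..N + l})"
      proof -
        have "I \<inter> {l + 1..N + l} = Suc ` {max p l..<min (p + k) (N + l)}"
          unfolding image_Suc_atLeastLessThan by (auto simp: I_def)
        then show ?thesis by (simp only: image_image Suc_eq_plus1)
      qed
      finally show ?thesis unfolding \<rho>_def eX eY eM by auto
    qed
    ultimately show "set (take k (drop (j * (k - l)) (x @ w @ y))) \<in> E" by (simp add: p_def)
  qed
  ultimately show ?thesis by blast
qed

section \<open>Spread weights\<close>

text \<open>Makes a prescribed partial embedding a set \<open>P\<close> of pairs and compliance with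
  it the inclusion \<open>P \<subseteq> graph_of w\<close>, so that \<open>card P\<close> is the
  number of prescribed vertices.\<close>

definition graph_of :: "'a list \<Rightarrow> (nat \<times> 'a) set" where
  "graph_of w = (\<lambda>i. (i, w ! i)) ` {..<length w}"

abbreviation perms :: "'a set \<Rightarrow> 'a list set" where
  "perms \<equiv> permutations_of_set"

text \<open>
  The bound compares the law \<open>m\<close> with the uniform law on the orderings of \<open>U\<close>, and not with
  \<open>(K / card U) ^ card P\<close>, so that splitting \<open>U\<close> uniformly at random costs nothing. For infinite \<open>P\<close> both sides vanish.
\<close>

definition spread_bound :: "'a set \<Rightarrow> real \<Rightarrow> ('a list \<Rightarrow> real) \<Rightarrow> bool" where
  "spread_bound U K m \<longleftrightarrow> (\<forall>P. (\<Sum>w\<in>perms U. of_bool (P \<subseteq> graph_of w) * m w)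
     \<le> K ^ card P * (\<Sum>w\<in>perms U. of_bool (P \<subseteq> graph_of w)) / fact (card U))"

definition has_spread :: "'a set \<Rightarrow> real \<Rightarrow> ('a list \<Rightarrow> bool) \<Rightarrow> bool" where
  "has_spread U K S \<longleftrightarrow> (\<exists>m. (\<forall>w. 0 \<le> m w) \<and> (\<forall>w. m w \<noteq> 0 \<longrightarrow> S w) \<and>
     (\<Sum>w\<in>perms U. m w) = 1 \<and> spread_bound U K m)"

lemma finite_graph_of: "finite (graph_of w)"
  by (simp add: graph_of_def)

lemma graph_of_append:
  "P \<subseteq> graph_of (u @ v) \<longleftrightarrow>
     {(i, c) \<in> P. i < length u} \<subseteq> graph_of u \<and> {(i, c). (i + length u, c) \<in> P} \<subseteq> graph_of v"
proof -
  have gr: "(i, c) \<in> graph_of w \<longleftrightarrow> i < length w \<and> w ! i = c" for i c and w :: "'a list"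
    by (auto simp: graph_of_def)
  show ?thesis
  proof (intro iffI conjI subsetI)
    fix p assume P: "P \<subseteq> graph_of (u @ v)" and p: "p \<in> {(i, c) \<in> P. i < length u}"
    obtain i c where ic: "p = (i, c)" by (cases p)
    then have "(i, c) \<in> graph_of (u @ v)" "i < length u" using P p by auto
    then show "p \<in> graph_of u" by (simp add: ic gr nth_append)
  next
    fix p assume P: "P \<subseteq> graph_of (u @ v)" and p: "p \<in> {(i, c). (i + length u, c) \<in> P}"
    obtain i c where ic: "p = (i, c)" by (cases p)
    then have "(i + length u, c) \<in> graph_of (u @ v)" using P p by auto
    then show "p \<in> graph_of v" by (simp add: ic gr nth_append)
  next
    fix p assume A: "{(i, c) \<in> P. i < length u} \<subseteq> graph_of u \<and> {(i, c). (i + length u, c) \<in> P} \<subseteq> graph_of v"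
      and p: "p \<in> P"
    obtain i c where ic: "p = (i, c)" by (cases p)
    show "p \<in> graph_of (u @ v)"
    proof (cases "i < length u")
      case True
      then have "(i, c) \<in> graph_of u" using A p ic by blast
      then show ?thesis by (simp add: ic gr nth_append)
    next
      case False
      then have "(i - length u, c) \<in> graph_of v" using A p ic by auto
      then show ?thesis using False by (auto simp add: ic gr nth_append)
    qed
  qed
qed

lemma card_split_at:
  fixes P :: "(nat \<times> 'a) set"
  assumes "finite P"
  shows "card P = card {(i, c) \<in> P. i < a} + card {(i, c). (i + a, c) \<in> P}"
proof -
  have "P = {(i, c) \<in> P. i < a} \<union> (\<lambda>(i, c). (i + a, c)) ` {(i, c). (i + a, c) \<in> P}"
  proof (intro equalityI subsetI)
    fix p assume p: "p \<in> P"
    obtain i c where ic: "p = (i, c)" by (cases p)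
    show "p \<in> {(i, c) \<in> P. i < a} \<union> (\<lambda>(i, c). (i + a, c)) ` {(i, c). (i + a, c) \<in> P}"
    proof (cases "i < a")
      case False
      then have "(i, c) = (\<lambda>(i, c). (i + a, c)) (i - a, c)" "(i - a, c) \<in> {(i, c). (i + a, c) \<in> P}"
        using p ic by auto
      then show ?thesis using ic by blast
    qed (use p ic in auto)
  qed auto
  then have "card P = card ({(i, c) \<in> P. i < a} \<union> (\<lambda>(i, c). (i + a, c)) ` {(i, c). (i + a, c) \<in> P})"
    by simp
  also have "\<dots> = card {(i, c) \<in> P. i < a} + card ((\<lambda>(i, c). (i + a, c)) ` {(i, c). (i + a, c) \<in> P})"
  proof (rule card_Un_disjoint)
    show "finite {(i, c) \<in> P. i < a}" by (rule finite_subset[OF _ assms]) auto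
    show "finite ((\<lambda>(i, c). (i + a, c)) ` {(i, c). (i + a, c) \<in> P})" by (rule finite_subset[OF _ assms]) auto
  qed auto
  also have "card ((\<lambda>(i, c). (i + a, c)) ` {(i, c). (i + a, c) \<in> P}) = card {(i, c). (i + a, c) \<in> P}"
    by (rule card_image) (auto simp: inj_on_def)
  finally show ?thesis .
qed

lemma sum_permutations_split:
  fixes f :: "'a list \<Rightarrow> real"
  assumes "finite U" "a \<le> card U"
  shows "(\<Sum>w\<in>perms U. f w) =
    (\<Sum>A | A \<subseteq> U \<and> card A = a. \<Sum>u\<in>perms A. \<Sum>v\<in>perms (U - A). f (u @ v))"
proof -
  let ?I = "{A. A \<subseteq> U \<and> card A = a}"
  have finI: "finite ?I" using assms by simp
  have "(\<Sum>A\<in>?I. \<Sum>u\<in>perms A. \<Sum>v\<in>perms (U - A). f (u @ v))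
     = (\<Sum>A\<in>?I. \<Sum>(u, v)\<in>perms A \<times> perms (U - A). f (u @ v))"
    by (simp add: sum.cartesian_product)
  also have "\<dots> = (\<Sum>(A, u, v)\<in>(SIGMA A:?I. perms A \<times> perms (U - A)). f (u @ v))"
    using finI by (subst sum.Sigma) (auto simp: case_prod_unfold)
  also have "\<dots> = (\<Sum>w\<in>perms U. f w)"
  proof (rule sum.reindex_bij_witness[where
        i = "\<lambda>w. (set (take a w), take a w, drop a w)" and j = "\<lambda>(A, u, v). u @ v"])
    fix t assume "t \<in> (SIGMA A:?I. perms A \<times> perms (U - A))"
    then obtain A u v where t: "t = (A, u, v)" "A \<subseteq> U" "card A = a" "set u = A" "distinct u"
      "set v = U - A" "distinct v" by (auto simp: permutations_of_set_def)
    then have "length u = a" by (metis distinct_card)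
    then show "(set (take a (case t of (A, u, v) \<Rightarrow> u @ v)), take a (case t of (A, u, v) \<Rightarrow> u @ v),
         drop a (case t of (A, u, v) \<Rightarrow> u @ v)) = t" using t by simp
    show "(case t of (A, u, v) \<Rightarrow> u @ v) \<in> perms U"
      using t by (auto simp: permutations_of_set_def)
  next
    fix w assume "w \<in> perms U"
    then have w: "set w = U" "distinct w" by (auto simp: permutations_of_set_def)
    then have lw: "length w = card U" by (metis distinct_card)
    have "set (take a w) \<union> set (drop a w) = U" "set (take a w) \<inter> set (drop a w) = {}"
      using w by (metis append_take_drop_id set_append, metis append_take_drop_id distinct_append)
    then have "set (drop a w) = U - set (take a w)" "set (take a w) \<subseteq> U" by blast+
    moreover have "card (set (take a w)) = a" using w lw assms by (simp add: distinct_card)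
    ultimately show "(set (take a w), take a w, drop a w) \<in> (SIGMA A:?I. perms A \<times> perms (U - A))"
      using w by (auto simp: permutations_of_set_def)
  qed auto
  finally show ?thesis by simp
qed

lemma sum_permutations_split3:
  fixes f :: "'a list \<Rightarrow> real"
  assumes "finite U" "a + l \<le> card U"
  shows "(\<Sum>w\<in>perms U. f w) =
    (\<Sum>A | A \<subseteq> U \<and> card A = a. \<Sum>Z | Z \<subseteq> U - A \<and> card Z = l. \<Sum>z\<in>perms Z.
       \<Sum>u\<in>perms A. \<Sum>v\<in>perms (U - A - Z). f (u @ z @ v))"
proof -
  have "(\<Sum>u\<in>perms A. \<Sum>v\<in>perms (U - A). f (u @ v)) =
     (\<Sum>Z | Z \<subseteq> U - A \<and> card Z = l. \<Sum>z\<in>perms Z.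
       \<Sum>u\<in>perms A. \<Sum>v\<in>perms (U - A - Z). f (u @ z @ v))"
    if A: "A \<subseteq> U" "card A = a" for A
  proof -
    have "l \<le> card (U - A)" using assms A by (simp add: card_Diff_subset finite_subset)
    then have "(\<Sum>u\<in>perms A. \<Sum>v\<in>perms (U - A). f (u @ v)) =
      (\<Sum>u\<in>perms A. \<Sum>Z | Z \<subseteq> U - A \<and> card Z = l. \<Sum>z\<in>perms Z.
        \<Sum>v\<in>perms (U - A - Z). f (u @ z @ v))"
      using assms by (subst sum_permutations_split[where a = l and U = "U - A"]) auto
    also have "\<dots> = (\<Sum>Z | Z \<subseteq> U - A \<and> card Z = l. \<Sum>u\<in>perms A. \<Sum>z\<in>perms Z.
        \<Sum>v\<in>perms (U - A - Z). f (u @ z @ v))" by (rule sum.swap)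
    also have "\<dots> = (\<Sum>Z | Z \<subseteq> U - A \<and> card Z = l. \<Sum>z\<in>perms Z. \<Sum>u\<in>perms A. 
        \<Sum>v\<in>perms (U - A - Z). f (u @ z @ v))" by (intro sum.cong refl sum.swap)
    finally show ?thesis .
  qed
  then show ?thesis
    using assms by (subst sum_permutations_split[where a = a]) (auto intro!: sum.cong)
qed

text \<open>Draw the left set \<open>A\<close> and the middle tuple \<open>z\<close> uniformly
  subject to \<open>good\<close>, then use independent spread laws on both sides. As each side is
  compared with its uniform orderings, the bounds sum over \<open>A\<close> and \<open>z\<close> to
  at most the uniform count on \<open>U\<close>. Prescribed entries of \<open>z\<close> cost no
  factor \<open>K\<close>, and the only loss is the conditioning, a factor
  \<open>1 / (1 - \<epsilon>)\<close>.\<close>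

lemma has_spread_splice:
  fixes S1 S2 :: "'a list \<Rightarrow> 'a list \<Rightarrow> bool" and good :: "'a set \<Rightarrow> 'a set \<Rightarrow> bool"
  assumes U: "finite U" "card U = a + l + b"
    and sp1: "\<And>A z. A \<subseteq> U \<Longrightarrow> card A = a \<Longrightarrow> set z \<subseteq> U - A \<Longrightarrow> distinct z \<Longrightarrow> length z = l \<Longrightarrow>
        good A (U - A - set z) \<Longrightarrow> has_spread A K (S1 z)"
    and sp2: "\<And>A z. A \<subseteq> U \<Longrightarrow> card A = a \<Longrightarrow> set z \<subseteq> U - A \<Longrightarrow> distinct z \<Longrightarrow> length z = l \<Longrightarrow>
        good A (U - A - set z) \<Longrightarrow> has_spread (U - A - set z) K (S2 z)"
    and many: "(1 - \<epsilon>) * fact (card U)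
       \<le> (\<Sum>w\<in>perms U. of_bool (good (set (take a w)) (set (drop (a + l) w))))"
    and K: "1 \<le> K" "K \<le> K' * (1 - \<epsilon>)" "0 \<le> \<epsilon>" "\<epsilon> < 1"
  shows "has_spread U K' (\<lambda>w. length (take l (drop a w)) = l \<and>
    S1 (take l (drop a w)) (take a w) \<and> S2 (take l (drop a w)) (drop (a + l) w))"
proof -
  let ?pm = perms
  define valid where "valid A z \<longleftrightarrow> A \<subseteq> U \<and> card A = a \<and> set z \<subseteq> U - A \<and> distinct z \<and> length z = l
      \<and> good A (U - A - set z)" for A z
  define is_m where "is_m V S m \<longleftrightarrow> (\<forall>w. 0 \<le> m w) \<and> (\<forall>w. m w \<noteq> 0 \<longrightarrow> S w) \<and>
     (\<Sum>w\<in>?pm V. m w) = 1 \<and> spread_bound V K m"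
    for V and S :: "'a list \<Rightarrow> bool" and m :: "'a list \<Rightarrow> real"
  define m1 where "m1 A z = (SOME m. is_m A (S1 z) m)" for A z
  define m2 where "m2 A z = (SOME m. is_m (U - A - set z) (S2 z) m)" for A z
  have m1: "is_m A (S1 z) (m1 A z)" if "valid A z" for A z
  proof -
    have "has_spread A K (S1 z)" by (rule sp1) (use that in \<open>simp_all add: valid_def\<close>)
    then have "\<exists>m. is_m A (S1 z) m" unfolding has_spread_def is_m_def .
    then show ?thesis unfolding m1_def by (rule someI_ex)
  qed
  have m2: "is_m (U - A - set z) (S2 z) (m2 A z)" if "valid A z" for A z
  proof -
    have "has_spread (U - A - set z) K (S2 z)" by (rule sp2) (use that in \<open>simp_all add: valid_def\<close>)
    then have "\<exists>m. is_m (U - A - set z) (S2 z) m" unfolding has_spread_def is_m_def .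
    then show ?thesis unfolding m2_def by (rule someI_ex)
  qed
  define Q where "Q = (\<Sum>w\<in>?pm U. of_bool (good (set (take a w)) (set (drop (a + l) w))) :: real)"
  have "0 < (1 - \<epsilon>) * fact (card U)" using K by simp
  then have Q: "0 < Q" using many unfolding Q_def by linarith
  \<comment> \<open>\<open>Q\<close> counts orderings, and \<open>fact a * fact b\<close> of them
    share the same \<open>A\<close> and \<open>z\<close>; so \<open>c\<close> is the probability of
    each good choice of \<open>A\<close> and \<open>z\<close>.\<close>
  define c where "c = fact a * fact b / Q"
  have c: "0 \<le> c" using Q by (simp add: c_def)
  define m where "m w = (let A = set (take a w); z = take l (drop a w) in
     if valid A z then c * m1 A z (take a w) * m2 A z (drop (a + l) w) else 0)" for w
  have nonneg: "0 \<le> m w" for w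
    using m1 m2 c by (auto simp: m_def Let_def is_m_def)
  have supp: "length (take l (drop a w)) = l \<and> S1 (take l (drop a w)) (take a w) \<and>
      S2 (take l (drop a w)) (drop (a + l) w)" if "m w \<noteq> 0" for w
  proof -
    define A z where "A = set (take a w)" and "z = take l (drop a w)"
    have val: "valid A z" and "m1 A z (take a w) \<noteq> 0" "m2 A z (drop (a + l) w) \<noteq> 0"
      using that unfolding m_def Let_def A_def z_def by (auto split: if_splits)
    then have "S1 z (take a w)" "S2 z (drop (a + l) w)"
      using m1[OF val] m2[OF val] by (simp_all add: is_m_def)
    then show ?thesis using val by (simp add: valid_def z_def)
  qed
  have decomp: "m (u @ z @ v) = (if good A (U - A - Z) then c * m1 A z u * m2 A z v else 0)"
      "length u = a" "length z = l" "length v = b" "card (U - A - Z) = b" "set z = Z" "valid A z = good A (U - A - Z)"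
      "take a (u @ z @ v) = u" "drop (a + l) (u @ z @ v) = v" "set u = A" "set v = U - A - Z"
    if "A \<subseteq> U" "card A = a" "Z \<subseteq> U - A" "card Z = l"
      "z \<in> ?pm Z" "u \<in> ?pm A" "v \<in> ?pm (U - A - Z)" for A Z z u v
  proof -
    have finA: "finite A" "finite Z" using that U by (auto dest: finite_subset)
    have s: "set z = Z" "distinct z" "set u = A" "distinct u" "set v = U - A - Z" "distinct v"
      using that by (auto simp: permutations_of_set_def)
    then show "length u = a" "length z = l" "set z = Z" "set u = A" "set v = U - A - Z"
      using that by (auto simp: distinct_card[symmetric])
    moreover show cb: "card (U - A - Z) = b"
      using that U finA by (simp add: card_Diff_subset)
    then show "length v = b" using s by (metis distinct_card)
    show v: "valid A z = good A (U - A - Z)" using that s \<open>length z = l\<close> by (simp add: valid_def)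
    show "take a (u @ z @ v) = u" "drop (a + l) (u @ z @ v) = v" using \<open>length u = a\<close> \<open>length z = l\<close> by simp_all
    then show "m (u @ z @ v) = (if good A (U - A - Z) then c * m1 A z u * m2 A z v else 0)"
      using \<open>length u = a\<close> \<open>length z = l\<close> s v by (simp add: m_def Let_def)
  qed
  have al: "a + l \<le> card U" using U by simp
  note split3 = sum_permutations_split3[OF U(1) al]
  have Q3: "Q = (\<Sum>A | A \<subseteq> U \<and> card A = a. \<Sum>Z | Z \<subseteq> U - A \<and> card Z = l. \<Sum>z\<in>?pm Z.
       fact a * fact b * of_bool (good A (U - A - Z)))"
    unfolding Q_def split3
  proof (intro sum.cong refl)
    fix A Z z assume h: "A \<in> {A. A \<subseteq> U \<and> card A = a}" "Z \<in> {Z. Z \<subseteq> U - A \<and> card Z = l}" "z \<in> ?pm Z"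
    have "(\<Sum>u\<in>?pm A. \<Sum>v\<in>?pm (U - A - Z). of_bool (good (set (take a (u @ z @ v))) (set (drop (a + l) (u @ z @ v)))))
       = (\<Sum>u\<in>?pm A. \<Sum>v\<in>?pm (U - A - Z). of_bool (good A (U - A - Z)) :: real)"
      using h decomp(8-11)[of A Z z] by (intro sum.cong refl) auto
    also have "\<dots> = fact a * fact b * of_bool (good A (U - A - Z))"
    proof -
      have "finite A" "finite (U - A - Z)" "card (U - A - Z) = b" using h U by (auto simp: card_Diff_subset finite_subset)
      then show ?thesis using h by (simp del: sum_of_bool_eq)
    qed
    finally show "(\<Sum>u\<in>?pm A. \<Sum>v\<in>?pm (U - A - Z). of_bool (good (set (take a (u @ z @ v))) (set (drop (a + l) (u @ z @ v)))))
       = (fact a * fact b * of_bool (good A (U - A - Z)) :: real)" .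
  qed
  have mass: "(\<Sum>w\<in>?pm U. m w) = 1"
  proof -
    have "(\<Sum>w\<in>?pm U. m w) = (\<Sum>A | A \<subseteq> U \<and> card A = a. \<Sum>Z | Z \<subseteq> U - A \<and> card Z = l. \<Sum>z\<in>?pm Z.
       fact a * fact b * of_bool (good A (U - A - Z)) / Q)"
      unfolding split3
    proof (intro sum.cong refl)
      fix A Z z assume h: "A \<in> {A. A \<subseteq> U \<and> card A = a}" "Z \<in> {Z. Z \<subseteq> U - A \<and> card Z = l}" "z \<in> ?pm Z"
      have "(\<Sum>u\<in>?pm A. \<Sum>v\<in>?pm (U - A - Z). m (u @ z @ v))
        = (\<Sum>u\<in>?pm A. \<Sum>v\<in>?pm (U - A - Z). if good A (U - A - Z) then c * m1 A z u * m2 A z v else 0)"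
        using h decomp(1)[of A Z z] by (intro sum.cong refl) auto
      also have "\<dots> = fact a * fact b * of_bool (good A (U - A - Z)) / Q"
      proof (cases "good A (U - A - Z)")
        case True
        have sz: "set z = Z" "distinct z" using h by (auto simp: permutations_of_set_def)
        then have lz: "length z = l" using h by (auto simp: distinct_card[symmetric])
        have val: "valid A z" using h True sz lz by (auto simp: valid_def)
        have "(\<Sum>u\<in>?pm A. \<Sum>v\<in>?pm (U - A - Z). c * m1 A z u * m2 A z v)
          = c * ((\<Sum>u\<in>?pm A. m1 A z u) * (\<Sum>v\<in>?pm (U - A - Z). m2 A z v))"
          unfolding mult.assoc sum_product unfolding sum_distrib_left ..
        also have "\<dots> = c" using m1[OF val] m2[OF val] sz by (simp add: is_m_def)
        finally show ?thesis using True by (simp add: c_def)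
      qed simp
      finally show "(\<Sum>u\<in>?pm A. \<Sum>v\<in>?pm (U - A - Z). m (u @ z @ v))
         = fact a * fact b * of_bool (good A (U - A - Z)) / Q" .
    qed
    also have "\<dots> = Q / Q" by (simp only: sum_divide_distrib[symmetric] Q3[symmetric])
    finally show ?thesis using Q by simp
  qed
  have bound: "(\<Sum>w\<in>?pm U. of_bool (P \<subseteq> graph_of w) * m w)
        \<le> K' ^ card P * (\<Sum>w\<in>?pm U. of_bool (P \<subseteq> graph_of w)) / fact (card U)" for P
  proof (cases "finite P")
    case False
    then have "\<not> P \<subseteq> graph_of w" for w using finite_graph_of finite_subset by blast
    then show ?thesis by simp
  next
    case True
    show ?thesis
    \<comment> \<open>The empty prescription offers no factor \<open>K'\<close> to absorb the loss
      \<open>1 / (1 - \<epsilon>)\<close>; for it the bound is just the total mass.\<close>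
    proof (cases "P = {}")
      case True
      have "(\<Sum>w\<in>?pm U. 1) = real (fact (card U))" using U by simp
      then show ?thesis using True mass U by simp
    next
      case False
      define P1 where "P1 = {(i, c) \<in> P. i < a}"
      define P' where "P' = {(i, c). (i + a, c) \<in> P}"
      define P2 where "P2 = {(i, c) \<in> P'. i < l}"
      define P3 where "P3 = {(i, c). (i + l, c) \<in> P'}"
      have finP': "finite P'"
      proof -
        have "(\<lambda>(i, c). (i + a, c)) ` P' \<subseteq> P" by (auto simp: P'_def)
        moreover have "inj_on (\<lambda>(i, c). (i + a, c)) P'" by (auto simp: inj_on_def)
        ultimately show ?thesis using True by (metis finite_imageD finite_subset)
      qed
      have cP: "card P = card P1 + card P2 + card P3"
        unfolding P1_def P2_def P3_def using card_split_at[OF True, of a] card_split_at[OF finP', of l]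
        by (simp add: P'_def)
      have ind: "P \<subseteq> graph_of (u @ z @ v) \<longleftrightarrow> P1 \<subseteq> graph_of u \<and> P2 \<subseteq> graph_of z \<and> P3 \<subseteq> graph_of v"
        if "length u = a" "length z = l" for u z v
        unfolding graph_of_append[of P u] graph_of_append[of _ z] that P1_def P2_def P3_def P'_def by simp
      define I where "I P w = (of_bool (P \<subseteq> graph_of w) :: real)" for P and w :: "'a list"
      have I0: "0 \<le> I P w" for P w by (simp add: I_def)
      have ind': "I P (u @ z @ v) = I P1 u * I P2 z * I P3 v" if "length u = a" "length z = l" for u z v
        using ind[OF that] by (simp add: I_def)
      have "(\<Sum>w\<in>?pm U. I P w * m w)
        \<le> (\<Sum>A | A \<subseteq> U \<and> card A = a. \<Sum>Z | Z \<subseteq> U - A \<and> card Z = l. \<Sum>z\<in>?pm Z.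
            K ^ card P / Q * (\<Sum>u\<in>?pm A. \<Sum>v\<in>?pm (U - A - Z). I P (u @ z @ v)))"
        unfolding split3
      proof (intro sum_mono)
        fix A Z z assume h: "A \<in> {A. A \<subseteq> U \<and> card A = a}" "Z \<in> {Z. Z \<subseteq> U - A \<and> card Z = l}" "z \<in> ?pm Z"
        have sz: "set z = Z" "distinct z" using h by (auto simp: permutations_of_set_def)
        then have lz: "length z = l" using h by (auto simp: distinct_card[symmetric])
        have lu: "length u = a" if "u \<in> ?pm A" for u
          using that h by (auto simp: permutations_of_set_def distinct_card[symmetric])
        have cB: "card (U - A - Z) = b" using h U by (auto simp: card_Diff_subset finite_subset)
        define s1 where "s1 = (\<Sum>u\<in>?pm A. I P1 u)"
        define s3 where "s3 = (\<Sum>v\<in>?pm (U - A - Z). I P3 v)"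
        have s: "0 \<le> s1" "0 \<le> s3" by (simp_all add: s1_def s3_def sum_nonneg I0)
        have R: "(\<Sum>u\<in>?pm A. \<Sum>v\<in>?pm (U - A - Z). I P (u @ z @ v)) = I P2 z * (s1 * s3)"
        proof -
          have "(\<Sum>u\<in>?pm A. \<Sum>v\<in>?pm (U - A - Z). I P (u @ z @ v)) =
            (\<Sum>u\<in>?pm A. \<Sum>v\<in>?pm (U - A - Z). I P2 z * (I P1 u * I P3 v))"
            using ind' lu lz by (intro sum.cong refl) simp
          also have "\<dots> = I P2 z * (s1 * s3)" unfolding s1_def s3_def sum_product unfolding sum_distrib_left ..
          finally show ?thesis .
        qed
        have L: "(\<Sum>u\<in>?pm A. \<Sum>v\<in>?pm (U - A - Z). I P (u @ z @ v) * m (u @ z @ v))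
          \<le> I P2 z * (K ^ card P1 * K ^ card P3 * (s1 * s3) / Q)"
        proof (cases "good A (U - A - Z)")
          case True
          have val: "valid A z" using h True sz lz by (auto simp: valid_def)
          have b1: "(\<Sum>u\<in>?pm A. I P1 u * m1 A z u) \<le> K ^ card P1 * s1 / fact a"
            using m1[OF val] h unfolding is_m_def spread_bound_def I_def s1_def by auto
          have b3: "(\<Sum>v\<in>?pm (U - A - Z). I P3 v * m2 A z v) \<le> K ^ card P3 * s3 / fact b"
            using m2[OF val] sz cB unfolding is_m_def spread_bound_def I_def s3_def by auto
          have "(\<Sum>u\<in>?pm A. \<Sum>v\<in>?pm (U - A - Z). I P (u @ z @ v) * m (u @ z @ v))
             = (\<Sum>u\<in>?pm A. \<Sum>v\<in>?pm (U - A - Z). (c * I P2 z) * ((I P1 u * m1 A z u) * (I P3 v * m2 A z v)))"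
            using h True decomp(1)[of A Z z] ind' lu lz by (intro sum.cong refl) (simp add: mult_ac)
          also have "\<dots> = (c * I P2 z) * ((\<Sum>u\<in>?pm A. I P1 u * m1 A z u) * (\<Sum>v\<in>?pm (U - A - Z). I P3 v * m2 A z v))"
            unfolding sum_product unfolding sum_distrib_left ..
          also have "\<dots> \<le> (c * I P2 z) * ((K ^ card P1 * s1 / fact a) * (K ^ card P3 * s3 / fact b))"
            using b1 b3 c I0 s K m1[OF val] m2[OF val]
            by (intro mult_left_mono mult_mono) (auto simp: is_m_def intro!: sum_nonneg)
          also have "\<dots> = I P2 z * (K ^ card P1 * K ^ card P3 * (s1 * s3) / Q)"
            by (simp add: c_def)
          finally show ?thesis .
        next
          case False
          then have "(\<Sum>u\<in>?pm A. \<Sum>v\<in>?pm (U - A - Z). I P (u @ z @ v) * m (u @ z @ v)) = 0"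
            using h decomp(1)[of A Z z] by (intro sum.neutral ballI) auto
          also have "0 \<le> I P2 z * (K ^ card P1 * K ^ card P3 * (s1 * s3) / Q)"
            using I0 s K Q by simp
          finally show ?thesis .
        qed
        also have "\<dots> \<le> I P2 z * (K ^ card P * (s1 * s3) / Q)"
        proof -
          have "K ^ card P1 * K ^ card P3 \<le> K ^ card P"
            unfolding power_add[symmetric] using K cP by (intro power_increasing) auto
          then show ?thesis using I0 s Q by (intro mult_left_mono divide_right_mono mult_right_mono) auto
        qed
        finally show "(\<Sum>u\<in>?pm A. \<Sum>v\<in>?pm (U - A - Z). I P (u @ z @ v) * m (u @ z @ v))
          \<le> K ^ card P / Q * (\<Sum>u\<in>?pm A. \<Sum>v\<in>?pm (U - A - Z). I P (u @ z @ v))"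
          unfolding R by (simp add: mult_ac)
      qed
      also have "\<dots> = K ^ card P / Q * (\<Sum>w\<in>?pm U. I P w)"
        unfolding split3 sum_distrib_left ..
      also have "\<dots> \<le> (K' ^ card P / fact (card U)) * (\<Sum>w\<in>?pm U. I P w)"
      proof (intro mult_right_mono sum_nonneg I0)
        have "1 \<le> card P" using False True by (simp add: Suc_le_eq card_gt_0_iff)
        have "K ^ card P \<le> (K' * (1 - \<epsilon>)) ^ card P" using K by (intro power_mono) auto
        also have "\<dots> = K' ^ card P * (1 - \<epsilon>) ^ card P" by (rule power_mult_distrib)
        \<comment> \<open>As \<open>P\<close> is nonempty, a factor \<open>1 - \<epsilon>\<close> is
          available to pay for comparing \<open>Q\<close> with \<open>fact (card U)\<close>.\<close>
        also have "\<dots> \<le> K' ^ card P * (1 - \<epsilon>) ^ 1"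
        proof (intro mult_left_mono power_decreasing)
          have "0 < K' * (1 - \<epsilon>)" using K by linarith
          then have "0 < K'" using K by (simp add: zero_less_mult_iff)
          then show "0 \<le> K' ^ card P" by simp
        qed (use K \<open>1 \<le> card P\<close> in auto)
        finally have "K ^ card P * fact (card U) \<le> K' ^ card P * ((1 - \<epsilon>) * fact (card U))" by simp
        also have "\<dots> \<le> K' ^ card P * Q"
        proof (intro mult_left_mono)
          show "(1 - \<epsilon>) * fact (card U) \<le> Q" using many by (simp add: Q_def)
          have "0 < K' * (1 - \<epsilon>)" using K by linarith
          then have "0 < K'" using K by (simp add: zero_less_mult_iff)
          then show "0 \<le> K' ^ card P" by simp
        qed
        finally show "K ^ card P / Q \<le> K' ^ card P / fact (card U)"
          using Q by (simp add: divide_simps)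
      qed
      finally show ?thesis by (simp add: I_def)
    qed
  qed
  show ?thesis unfolding has_spread_def spread_bound_def using nonneg supp mass bound by blast
qed

section \<open>The halving step\<close>

text \<open>
  The set \<open>D\<close> ranges over \<open>V\<close>, but only its completions inside \<open>A\<close> count. So the condition survives
  adding the end tuples of a path to \<open>V\<close> without any correction.
\<close>

definition degree_at_least :: "'a set set \<Rightarrow> 'a set \<Rightarrow> 'a set \<Rightarrow> nat \<Rightarrow> nat \<Rightarrow> real \<Rightarrow> bool" where
  "degree_at_least E V A d r c \<longleftrightarrow>
     (\<forall>D\<subseteq>V. card D = d \<longrightarrow> c * real (card A) ^ r \<le> real (card (link E D A r)))"

lemma degree_at_least_mono:
  assumes "degree_at_least E V A d r c" "V' \<subseteq> V" "c' \<le> c"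
  shows "degree_at_least E V' A d r c'"
  unfolding degree_at_least_def
proof (intro allI impI)
  fix D assume "D \<subseteq> V'" "card D = d"
  then have "c * real (card A) ^ r \<le> real (card (link E D A r))"
    using assms by (auto simp: degree_at_least_def)
  moreover have "c' * real (card A) ^ r \<le> c * real (card A) ^ r"
    using assms by (intro mult_right_mono) auto
  ultimately show "c' * real (card A) ^ r \<le> real (card (link E D A r))" by linarith
qed

lemma sum_permutations_prefix:
  assumes "finite U" "a \<le> card U"
  shows "(\<Sum>w\<in>perms U. of_bool (Q (set (take a w)))) =
    (real (card {A. A \<subseteq> U \<and> card A = a \<and> Q A}) * fact a * fact (card U - a) :: real)"
proof -
  have "(\<Sum>w\<in>perms U. of_bool (Q (set (take a w)))) =
    (\<Sum>A | A \<subseteq> U \<and> card A = a. \<Sum>u\<in>perms A. \<Sum>v\<in>perms (U - A).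
       of_bool (Q (set (take a (u @ v)))) :: real)"
    by (rule sum_permutations_split[OF assms])
  also have "\<dots> = (\<Sum>A | A \<subseteq> U \<and> card A = a. of_bool (Q A) * (fact a * fact (card U - a)))"
  proof (intro sum.cong refl)
    fix A assume A: "A \<in> {A. A \<subseteq> U \<and> card A = a}"
    then have fin: "finite A" "finite (U - A)" using assms finite_subset by auto
    have "(\<Sum>u\<in>perms A. \<Sum>v\<in>perms (U - A). of_bool (Q (set (take a (u @ v)))) :: real)
      = (\<Sum>u\<in>perms A. \<Sum>v\<in>perms (U - A). of_bool (Q A))"
    proof (intro sum.cong refl)
      fix u v assume "u \<in> perms A"
      then have "set u = A" "length u = a"
        using A by (auto simp: permutations_of_set_def distinct_card[symmetric])
      then show "of_bool (Q (set (take a (u @ v)))) = (of_bool (Q A) :: real)" by simp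
    qed
    also have "\<dots> = of_bool (Q A) * (fact a * fact (card U - a))"
      using A fin assms by (simp add: card_Diff_subset del: sum_of_bool_eq)
    finally show "(\<Sum>u\<in>perms A. \<Sum>v\<in>perms (U - A). of_bool (Q (set (take a (u @ v)))) :: real)
      = of_bool (Q A) * (fact a * fact (card U - a))" .
  qed
  also have "\<dots> = (\<Sum>A | A \<subseteq> U \<and> card A = a. of_bool (Q A)) * (fact a * fact (card U - a))"
    by (rule sum_distrib_right[symmetric])
  also have "(\<Sum>A | A \<subseteq> U \<and> card A = a. of_bool (Q A)) = real (card {A. A \<subseteq> U \<and> card A = a \<and> Q A})"
  proof -
    have "{A. A \<subseteq> U \<and> card A = a} \<inter> {A. Q A} = {A. A \<subseteq> U \<and> card A = a \<and> Q A}" by auto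
    then show ?thesis using assms by simp
  qed
  finally show ?thesis by simp
qed

lemma sum_permutations_suffix:
  assumes "finite U" "c + b = card U"
  shows "(\<Sum>w\<in>perms U. of_bool (Q (set (drop c w)))) =
    (real (card {B. B \<subseteq> U \<and> card B = b \<and> Q B}) * fact b * fact (card U - b) :: real)"
proof -
  have "(\<Sum>w\<in>perms U. of_bool (Q (set (drop c w)))) =
     (\<Sum>w\<in>perms U. of_bool (Q (set (take b w))) :: real)"
  proof (rule sum.reindex_bij_witness[where i = rev and j = rev])
    fix w assume "w \<in> perms U"
    then have "length w = card U" by (auto simp: permutations_of_set_def distinct_card)
    then show "of_bool (Q (set (take b (rev w)))) = (of_bool (Q (set (drop c w))) :: real)"
      using assms(2) by (simp add: take_rev) (metis add_diff_cancel_right')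
  qed (auto simp: permutations_of_set_def)
  then show ?thesis using sum_permutations_prefix[of U b Q] assms by simp
qed

text \<open>Union bound over the \<open>d\<close>-sets of \<open>V\<close>, with the lower tail
  applied to the link of each. The tail loses \<open>\<eta> * N ^ r\<close>, while the degree into
  \<open>A\<close> is measured in units of \<open>a ^ r\<close>; \<open>N \<le> 3 * a\<close> turns
  the loss into \<open>3 ^ r * \<eta>\<close>.\<close>

lemma few_bad_subsets:
  fixes c \<eta> :: real
  assumes V: "finite V" "U \<subseteq> V" and N: "card U = N" "0 < N" "N \<le> 3 * a" "a \<le> N" and "0 < r" "0 \<le> \<eta>"
    and deg: "degree_at_least E V U d r c"
  shows "real (card {A. A \<subseteq> U \<and> card A = a \<and> \<not> degree_at_least E V A d r (c - 3 ^ r * \<eta>)})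
    \<le> (card V choose d) * ((real N + 1) * exp (- (\<eta>\<^sup>2 * N / 4))) * (N choose a)"
proof -
  have finU: "finite U" using V finite_subset by blast
  define \<D> where "\<D> = {D. D \<subseteq> V \<and> card D = d}"
  have fin\<D>: "finite \<D>" using V by (simp add: \<D>_def)
  define Bad where "Bad D = {A. A \<subseteq> U \<and> card A = a \<and>
      real (card {R\<in>link E D U r. R \<subseteq> A}) < (real a / N) ^ r * card (link E D U r) - \<eta> * real N ^ r}" for D
  have finBad: "finite (Bad D)" for D using finU by (simp add: Bad_def)
  have "{A. A \<subseteq> U \<and> card A = a \<and> \<not> degree_at_least E V A d r (c - 3 ^ r * \<eta>)} \<subseteq> (\<Union>D\<in>\<D>. Bad D)"
  proof
    fix A assume A: "A \<in> {A. A \<subseteq> U \<and> card A = a \<and> \<not> degree_at_least E V A d r (c - 3 ^ r * \<eta>)}"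
    then obtain D where D: "D \<subseteq> V" "card D = d" "real (card (link E D A r)) < (c - 3 ^ r * \<eta>) * real a ^ r"
      unfolding degree_at_least_def by auto
    have "{R\<in>link E D U r. R \<subseteq> A} = link E D A r" using A by (auto simp: link_def)
    moreover have "(c - 3 ^ r * \<eta>) * real a ^ r \<le> (real a / N) ^ r * card (link E D U r) - \<eta> * real N ^ r"
    proof -
      have "c * real N ^ r \<le> card (link E D U r)" using deg D N by (auto simp: degree_at_least_def)
      then have "(real a / N) ^ r * (c * real N ^ r) \<le> (real a / N) ^ r * card (link E D U r)"
        by (intro mult_left_mono) auto
      moreover have "(real a / N) ^ r * (c * real N ^ r) = c * real a ^ r"
        using N by (simp add: power_divide)
      moreover have "\<eta> * real N ^ r \<le> \<eta> * (3 * real a) ^ r"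
        using N assms by (intro mult_left_mono power_mono) auto
      moreover have "(c - 3 ^ r * \<eta>) * real a ^ r = c * real a ^ r - \<eta> * (3 * real a) ^ r"
        by (simp add: power_mult_distrib algebra_simps)
      ultimately show ?thesis by linarith
    qed
    ultimately have "A \<in> Bad D" using A D by (auto simp: Bad_def)
    then show "A \<in> (\<Union>D\<in>\<D>. Bad D)" using D by (auto simp: \<D>_def)
  qed
  then have "card {A. A \<subseteq> U \<and> card A = a \<and> \<not> degree_at_least E V A d r (c - 3 ^ r * \<eta>)} \<le> card (\<Union>D\<in>\<D>. Bad D)"
    using fin\<D> finBad by (intro card_mono) auto
  also have "\<dots> \<le> (\<Sum>D\<in>\<D>. card (Bad D))" by (rule card_UN_le[OF fin\<D>])
  finally have "real (card {A. A \<subseteq> U \<and> card A = a \<and> \<not> degree_at_least E V A d r (c - 3 ^ r * \<eta>)})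
     \<le> (\<Sum>D\<in>\<D>. real (card (Bad D)))" by (simp flip: of_nat_sum)
  also have "\<dots> \<le> (\<Sum>D\<in>\<D>. (real N + 1) * exp (- (\<eta>\<^sup>2 * N / 4)) * (N choose a))"
  proof (rule sum_mono)
    fix D
    have "link E D U r \<subseteq> {R. R \<subseteq> U \<and> card R = r}" by (auto simp: link_def)
    then show "real (card (Bad D)) \<le> (real N + 1) * exp (- (\<eta>\<^sup>2 * N / 4)) * (N choose a)"
      unfolding Bad_def using finU assms by (intro uniform_subset_lower_tail) auto
  qed
  also have "\<dots> = (card V choose d) * ((real N + 1) * exp (- (\<eta>\<^sup>2 * N / 4)) * (N choose a))"
    using n_subsets[OF V(1), of d] by (simp add: \<D>_def)
  finally show ?thesis by (simp add: mult.assoc)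
qed

text \<open>The middle tuple \<open>z\<close> starts at position \<open>(k - l) * t\<close>, which
  is a start of the window grid. The last window starting before it ends exactly where
  \<open>z\<close> ends, and all others lie in the second list.\<close>

lemma ell_seq_append:
  assumes x: "length z = l" "length x = l" "l < k"
    and len: "length u + l = (k - l) * t"
    and s1: "ell_seq k (k - l) E (x @ u @ z)" and s2: "ell_seq k (k - l) E (z @ v @ y)"
  shows "ell_seq k (k - l) E (x @ u @ z @ v @ y)"
  unfolding ell_seq_def
proof (intro allI impI)
  fix j assume j: "j * (k - l) + k \<le> length (x @ u @ z @ v @ y)"
  show "set (take k (drop (j * (k - l)) (x @ u @ z @ v @ y))) \<in> E"
  proof (cases "j < t")
    case True
    then have "(k - l) * (j + 1) \<le> (k - l) * t" by (intro mult_le_mono) auto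
    then have le: "j * (k - l) + k \<le> length (x @ u @ z)"
      using len x by (simp add: mult.commute)
    then have "take k (drop (j * (k - l)) ((x @ u @ z) @ (v @ y))) = take k (drop (j * (k - l)) (x @ u @ z))"
      by (simp only: drop_append take_append) simp
    then have "take k (drop (j * (k - l)) (x @ u @ z @ v @ y)) = take k (drop (j * (k - l)) (x @ u @ z))"
      by simp
    then show ?thesis using s1 le unfolding ell_seq_def by metis
  next
    case False
    then obtain i where i: "j = t + i" using le_Suc_ex not_less by blast
    have "j * (k - l) = length (x @ u) + i * (k - l)" using len x i by (simp add: algebra_simps)
    then have "drop (j * (k - l)) ((x @ u) @ (z @ v @ y)) = drop (i * (k - l)) (z @ v @ y)"
      by (simp only: drop_append) simp
    then have "drop (j * (k - l)) (x @ u @ z @ v @ y) = drop (i * (k - l)) (z @ v @ y)" by simp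
    moreover have "i * (k - l) + k \<le> length (z @ v @ y)"
      using j \<open>j * (k - l) = _\<close> by simp
    ultimately show ?thesis using s2 unfolding ell_seq_def by metis
  qed
qed

lemma has_spread_mono:
  assumes "has_spread U K S" "0 \<le> K" "K \<le> K'" "\<And>w. S w \<Longrightarrow> S' w"
  shows "has_spread U K' S'"
proof -
  obtain m where m: "\<And>w. 0 \<le> m w" "\<And>w. m w \<noteq> 0 \<Longrightarrow> S w" "(\<Sum>w\<in>perms U. m w) = 1"
     "spread_bound U K m"
    using assms(1) unfolding has_spread_def by blast
  have "(\<Sum>w\<in>perms U. of_bool (P \<subseteq> graph_of w) * m w)
        \<le> K' ^ card P * (\<Sum>w\<in>perms U. of_bool (P \<subseteq> graph_of w)) / fact (card U)" for P
    by (rule order_trans[OF m(4)[unfolded spread_bound_def, rule_format]])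
      (use assms in \<open>intro divide_right_mono mult_right_mono power_mono sum_nonneg, auto\<close>)
  then show ?thesis unfolding has_spread_def spread_bound_def using m assms(4) by blast
qed

text \<open>The ends \<open>x\<close> and \<open>y\<close> may coincide here, which is what closes
  paths into cycles later. Each half is tested against all \<open>d\<close>-sets of
  \<open>U \<union> set x \<union> set y\<close>, so it can be treated on its own as a uniform
  subset of \<open>U\<close>, and the condition already covers the \<open>d\<close>-sets that use
  vertices of \<open>z\<close>.\<close>

lemma has_spread_halving:
  fixes x y :: "'a list" and c \<eta> K K' \<epsilon> :: real
  assumes par: "0 < l" "l < k" "0 < r" "0 \<le> \<eta>"
    and U: "finite U" "card U = N" "0 < N"
    and ab: "N = a + l + b" "N \<le> 3 * a" "N \<le> 3 * b" "(k - l) dvd (a + l)"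
    and xy: "length x = l"
    and deg: "degree_at_least E (U \<union> set x \<union> set y) U d r c"
    and ihA: "\<And>A z. A \<subseteq> U \<Longrightarrow> card A = a \<Longrightarrow> set z \<subseteq> U - A \<Longrightarrow> distinct z \<Longrightarrow> length z = l \<Longrightarrow>
      degree_at_least E (A \<union> set x \<union> set z) A d r (c - 3 ^ r * \<eta>) \<Longrightarrow>
      has_spread A K (\<lambda>w. ell_seq k (k - l) E (x @ w @ z))"
    and ihB: "\<And>B z. B \<subseteq> U \<Longrightarrow> card B = b \<Longrightarrow> set z \<subseteq> U - B \<Longrightarrow> distinct z \<Longrightarrow> length z = l \<Longrightarrow>
      degree_at_least E (B \<union> set z \<union> set y) B d r (c - 3 ^ r * \<eta>) \<Longrightarrow>
      has_spread B K (\<lambda>w. ell_seq k (k - l) E (z @ w @ y))"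
    and eps: "2 * real (card (U \<union> set x \<union> set y) choose d) * ((real N + 1) * exp (- (\<eta>\<^sup>2 * N / 4))) \<le> \<epsilon>" "\<epsilon> < 1"
    and K: "1 \<le> K" "K \<le> K' * (1 - \<epsilon>)"
  shows "has_spread U K' (\<lambda>w. ell_seq k (k - l) E (x @ w @ y))"
proof -
  let ?pm = "perms"
  define V where "V = U \<union> set x \<union> set y"
  define c' where "c' = c - 3 ^ r * \<eta>"
  define ok where "ok A = degree_at_least E V A d r c'" for A
  define good where "good A B \<longleftrightarrow> ok A \<and> ok B" for A B
  have V: "finite V" "U \<subseteq> V" using U by (auto simp: V_def)
  have "0 \<le> 2 * real (card (U \<union> set x \<union> set y) choose d) * ((real N + 1) * exp (- (\<eta>\<^sup>2 * N / 4)))" by simp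
  then have e0: "0 \<le> \<epsilon>" using eps(1) by linarith
  \<comment> \<open>Each half fails with probability at most \<open>\<epsilon> / 2\<close>, whence
    the factor 2 in \<open>eps\<close>.\<close>
  have few: "real (card {A. A \<subseteq> U \<and> card A = s \<and> \<not> ok A}) * fact s * fact (N - s) \<le> \<epsilon> / 2 * fact N"
    if s: "s \<le> N" "N \<le> 3 * s" for s
  proof -
    have "real (card {A. A \<subseteq> U \<and> card A = s \<and> \<not> ok A})
       \<le> (card V choose d) * ((real N + 1) * exp (- (\<eta>\<^sup>2 * N / 4))) * (N choose s)"
      unfolding ok_def c'_def using V U par deg s
      by (intro few_bad_subsets) (auto simp: V_def)
    also have "\<dots> \<le> \<epsilon> / 2 * (N choose s)"
      using eps(1) by (intro mult_right_mono) (auto simp: V_def)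
    finally have "real (card {A. A \<subseteq> U \<and> card A = s \<and> \<not> ok A}) * (fact s * fact (N - s))
       \<le> \<epsilon> / 2 * (N choose s) * (fact s * fact (N - s))"
      by (rule mult_right_mono) auto
    also have "\<dots> = \<epsilon> / 2 * real (fact s * fact (N - s) * (N choose s))" by simp
    also have "fact s * fact (N - s) * (N choose s) = fact N" using s by (rule_tac binomial_fact_lemma)
    finally show ?thesis by (simp add: mult.assoc)
  qed
  have many: "(1 - \<epsilon>) * fact (card U)
       \<le> (\<Sum>w\<in>?pm U. of_bool (good (set (take a w)) (set (drop (a + l) w))))"
  proof -
    have "fact (card U) = (\<Sum>w\<in>?pm U. 1 :: real)" using U by simp
    also have "\<dots> \<le> (\<Sum>w\<in>?pm U. of_bool (good (set (take a w)) (set (drop (a + l) w)))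
       + of_bool (\<not> ok (set (take a w))) + of_bool (\<not> ok (set (drop (a + l) w))))"
      by (intro sum_mono) (auto simp: good_def)
    also have "\<dots> = (\<Sum>w\<in>?pm U. of_bool (good (set (take a w)) (set (drop (a + l) w))))
       + (\<Sum>w\<in>?pm U. of_bool (\<not> ok (set (take a w)))) + (\<Sum>w\<in>?pm U. of_bool (\<not> ok (set (drop (a + l) w))))"
      by (simp only: sum.distrib)
    also have "(\<Sum>w\<in>?pm U. of_bool (\<not> ok (set (take a w))) :: real) \<le> \<epsilon> / 2 * fact N"
      using sum_permutations_prefix[of U a "\<lambda>A. \<not> ok A"] few[of a] U ab by simp
    also have "(\<Sum>w\<in>?pm U. of_bool (\<not> ok (set (drop (a + l) w))) :: real) \<le> \<epsilon> / 2 * fact N"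
      using sum_permutations_suffix[of U "a + l" b "\<lambda>A. \<not> ok A"] few[of b] U ab by simp
    finally show ?thesis using U by (simp add: algebra_simps)
  qed
  have sp: "has_spread U K' (\<lambda>w. length (take l (drop a w)) = l \<and>
      ell_seq k (k - l) E (x @ take a w @ take l (drop a w)) \<and>
      ell_seq k (k - l) E (take l (drop a w) @ drop (a + l) w @ y))"
  proof (rule has_spread_splice[where good = good and \<epsilon> = \<epsilon> and K = K and b = b])
    fix A z assume h: "A \<subseteq> U" "card A = a" "set z \<subseteq> U - A" "distinct z" "length z = l" "good A (U - A - set z)"
    show "has_spread A K (\<lambda>w. ell_seq k (k - l) E (x @ w @ z))"
    proof (rule ihA)
      show "degree_at_least E (A \<union> set x \<union> set z) A d r (c - 3 ^ r * \<eta>)"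
        by (rule degree_at_least_mono[of E V A d r c']) (use h in \<open>auto simp: good_def ok_def c'_def V_def\<close>)
    qed (use h in auto)
    show "has_spread (U - A - set z) K (\<lambda>w. ell_seq k (k - l) E (z @ w @ y))"
    proof (rule ihB)
      show "degree_at_least E (U - A - set z \<union> set z \<union> set y) (U - A - set z) d r (c - 3 ^ r * \<eta>)"
        by (rule degree_at_least_mono[of E V _ d r c']) (use h in \<open>auto simp: good_def ok_def c'_def V_def\<close>)
      have "card (set z) = l" using h by (simp add: distinct_card)
      moreover have "card (U - A) = N - a" using h U by (simp add: card_Diff_subset finite_subset)
      ultimately show "card (U - A - set z) = b" using h U ab by (simp add: card_Diff_subset)
    qed (use h in auto)
  qed (use U ab many K e0 eps in auto)
  obtain t where t: "a + l = (k - l) * t" using ab(4) by (auto elim: dvdE)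
  show ?thesis
  proof (rule has_spread_mono[OF sp])
    have "0 < K' * (1 - \<epsilon>)" using K by linarith
    then show "0 \<le> K'" using eps by (simp add: zero_less_mult_iff)
    fix w assume w: "length (take l (drop a w)) = l \<and>
      ell_seq k (k - l) E (x @ take a w @ take l (drop a w)) \<and>
      ell_seq k (k - l) E (take l (drop a w) @ drop (a + l) w @ y)"
    then have "length (take a w) = a" using par by auto
    then have "ell_seq k (k - l) E (x @ take a w @ take l (drop a w) @ drop (a + l) w @ y)"
      using w xy par t by (intro ell_seq_append[where t = t and l = l]) auto
    moreover have "take a w @ take l (drop a w) @ drop (a + l) w = w"
      by (metis add.commute append_take_drop_id drop_drop)
    then have "take a w @ take l (drop a w) @ drop (a + l) w @ y = w @ y"
      by (metis append.assoc)
    ultimately show "ell_seq k (k - l) E (x @ w @ y)" by simp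
  qed simp
qed

section \<open>Spread Hamilton paths and closed sequences\<close>

text \<open>The negative exponent makes the value grow by a fixed factor when \<open>N\<close> drops
  to two thirds. Being above -1/2, it keeps \<open>(decay N)\<^sup>2 * N\<close> a positive power of
  \<open>N\<close>, so that a halving with error \<open>decay N\<close> fails with probability below
  any inverse power of \<open>N\<close>.\<close>

definition decay :: "nat \<Rightarrow> real" where "decay N = real N powr (-1/4)"

lemma decay_nonneg: "0 \<le> decay N"
  by (simp add: decay_def)

lemma decay_tendsto_0: "decay \<longlonglongrightarrow> 0"
  unfolding decay_def by real_asymp

lemma decay_gain:
  assumes "0 < a" "3 * a \<le> 2 * N"
  shows "11 / 10 * decay N \<le> decay a"
proof -
  \<comment> \<open>The comparison behind the constant: \<open>(11 / 10) ^ 4 = 1.4641\<close> is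
    below \<open>3 / 2\<close>.\<close>
  have "((3 / 2 :: real) powr (1 / 4)) ^ 4 = 3 / 2"
    by (simp add: powr_power)
  then have "(11 / 10 :: real) ^ Suc 3 \<le> ((3 / 2) powr (1 / 4)) ^ Suc 3"
    by (simp add: numeral_eq_Suc)
  then have "(11 / 10 :: real) \<le> (3 / 2) powr (1 / 4)"
    by (rule power_le_imp_le_base) simp
  then have "11 / 10 * decay N \<le> (3 / 2) powr (1 / 4) * decay N"
    by (intro mult_right_mono decay_nonneg)
  also have "\<dots> = (2 / 3 * real N) powr (-1/4)"
  proof -
    have "(3 / 2 :: real) powr (1 / 4) = (2 / 3) powr (-1/4)"
      using powr_minus_divide[of "2/3::real" "1/4"] powr_divide[of 2 3 "1/4"] powr_divide[of 3 2 "1/4"] by simp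
    then show ?thesis using powr_mult[of "2/3" "real N" "-1/4"] by (simp add: decay_def)
  qed
  also have "\<dots> \<le> decay a"
    unfolding decay_def using assms by (intro powr_mono2') auto
  finally show ?thesis .
qed

lemma decay_square: "0 < N \<Longrightarrow> (decay N)\<^sup>2 * N = sqrt N"
proof -
  assume N: "0 < N"
  have "(decay N)\<^sup>2 = real N powr (-1/2)"
    unfolding decay_def power2_eq_square powr_add[symmetric] by simp
  moreover have "real N powr (-1/2) * real N powr 1 = real N powr (1/2)"
    unfolding powr_add[symmetric] by simp
  ultimately show ?thesis using N by (simp add: powr_half_sqrt)
qed

text \<open>The union bound over \<open>d\<close>-sets costs a polynomial in \<open>N\<close>,
  against \<open>exp (- sqrt N / 4)\<close>. The right side is the failure probability that one
  halving can afford.\<close>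

lemma eventually_exp_small:
  "\<forall>\<^sub>F N in sequentially. 2 * real ((N + 2 * l) choose d) * ((real N + 1) * exp (- ((decay N)\<^sup>2 * N / 4))) \<le> decay N / 10"
proof -
  have "((\<lambda>x::real. 20 * 2 ^ d * (x powr real d * (x + 1) * exp (- sqrt x / 4) * x powr (1/4))) \<longlongrightarrow> 0) at_top"
    by real_asymp
  from filterlim_compose[OF this filterlim_real_sequentially]
  have "(\<lambda>N. 20 * 2 ^ d * (real N powr real d * (real N + 1) * exp (- sqrt N / 4) * real N powr (1/4))) \<longlonglongrightarrow> 0"
    by simp
  then have "\<forall>\<^sub>F N in sequentially. 20 * 2 ^ d * (real N powr real d * (real N + 1) * exp (- sqrt N / 4) * real N powr (1/4)) < 1"
    by (rule order_tendstoD) simp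
  then show ?thesis using eventually_ge_at_top[of "2 * l + 1"]
  proof eventually_elim
    case (elim N)
    then have N: "0 < N" "2 * l \<le> N" by auto
    have "(N + 2 * l) choose d \<le> (N + 2 * l) ^ d"
      by (cases "d \<le> N + 2 * l") (auto simp: binomial_le_pow binomial_eq_0)
    also have "\<dots> \<le> (2 * N) ^ d" using N by (intro power_mono) auto
    finally have "real ((N + 2 * l) choose d) \<le> real ((2 * N) ^ d)" by (simp only: of_nat_le_iff)
    also have "\<dots> = 2 ^ d * real N powr real d" using N by (simp add: power_mult_distrib powr_realpow)
    finally have "2 * real ((N + 2 * l) choose d) * ((real N + 1) * exp (- ((decay N)\<^sup>2 * N / 4)))
      \<le> 2 * (2 ^ d * real N powr real d) * ((real N + 1) * exp (- ((decay N)\<^sup>2 * N / 4)))"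
      by (intro mult_right_mono mult_left_mono) auto
    also have "\<dots> = (20 * 2 ^ d * (real N powr real d * (real N + 1) * exp (- sqrt N / 4) * real N powr (1/4))) * (decay N / 10)"
    proof -
      have 1: "real N powr (1/4) * decay N = 1" unfolding decay_def powr_add[symmetric] using N by simp
      have 2: "exp (- ((decay N)\<^sup>2 * N / 4)) = exp (- sqrt N / 4)" using decay_square[OF N(1)] by simp
      have "20 * 2 ^ d * (A * B * C * p) * (q / 10) = 2 * (2 ^ d * A) * (B * C) * (p * q)" for A B C p q :: real
        by simp
      then show ?thesis unfolding 2 using 1 by (simp add: mult.commute)
    qed
    also have "\<dots> \<le> 1 * (decay N / 10)"
      using elim decay_nonneg[of N] by (intro mult_right_mono) auto
    finally show ?case by simp
  qed
qed

text \<open>Passes from degrees measured in powers of \<open>N\<close> to the binomial normalisation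
  of the threshold. The latter refers to \<open>N + 2 * l\<close> vertices because the base case
  adds both end tuples to the \<open>N\<close> inner vertices.\<close>

lemma eventually_degree_transfer:
  fixes \<kappa> c M :: real
  assumes "0 \<le> \<kappa>" "\<kappa> / fact r < c"
  shows "\<forall>\<^sub>F N in sequentially. \<kappa> * real ((N + 2 * l - d) choose r) \<le> (c - M * decay N) * real N ^ r"
proof -
  have "(\<lambda>N. (1 + real (2 * l) / real N)) \<longlonglongrightarrow> 1" by real_asymp
  then have 1: "(\<lambda>N. \<kappa> / fact r * (1 + real (2 * l) / real N) ^ r) \<longlonglongrightarrow> \<kappa> / fact r * 1 ^ r"
    by (intro tendsto_intros)
  have 2: "(\<lambda>N. c - M * decay N) \<longlonglongrightarrow> c - M * 0"
    by (intro tendsto_intros decay_tendsto_0)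
  have "(\<lambda>N. (c - M * decay N) - \<kappa> / fact r * (1 + real (2 * l) / real N) ^ r)
      \<longlonglongrightarrow> (c - M * 0) - \<kappa> / fact r * 1 ^ r" by (rule tendsto_diff[OF 2 1])
  then have "\<forall>\<^sub>F N in sequentially. 0 < (c - M * decay N) - \<kappa> / fact r * (1 + real (2 * l) / real N) ^ r"
    by (rule order_tendstoD) (use assms in simp)
  then show ?thesis using eventually_gt_at_top[of 0]
  proof eventually_elim
    case (elim N)
    have "(N + 2 * l - d choose r) * fact r \<le> (N + 2 * l - d) ^ r" by (rule binomial_fact_pow)
    also have "\<dots> \<le> (N + 2 * l) ^ r" by (intro power_mono) auto
    finally have "real ((N + 2 * l - d choose r) * fact r) \<le> real ((N + 2 * l) ^ r)" by (simp only: of_nat_le_iff)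
    then have "real (N + 2 * l - d choose r) \<le> real (N + 2 * l) ^ r / fact r"
      by (simp add: field_simps)
    then have "\<kappa> * real (N + 2 * l - d choose r) \<le> \<kappa> * (real (N + 2 * l) ^ r / fact r)"
      using assms by (intro mult_left_mono) auto
    also have "real (N + 2 * l) = (1 + real (2 * l) / real N) * real N" using elim by (simp add: field_simps)
    also have "\<kappa> * (((1 + real (2 * l) / real N) * real N) ^ r / fact r) = (\<kappa> / fact r * (1 + real (2 * l) / real N) ^ r) * real N ^ r"
      by (simp add: power_mult_distrib)
    also have "\<dots> \<le> (c - M * decay N) * real N ^ r"
      using elim by (intro mult_right_mono) auto
    finally show ?case .
  qed
qed

text \<open>A point mass. The uniform law gives every attained \<open>P\<close> at least
  \<open>1 / fact (card U)\<close>, and a nonempty \<open>P\<close> offers at least one factor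
  \<open>K\<close> to compensate.\<close>

lemma has_spread_point:
  fixes K :: real
  assumes U: "finite U" and w0: "w0 \<in> perms U" "S w0" and K: "fact (card U) \<le> K"
  shows "has_spread U K S"
proof -
  define m where "m w = (of_bool (w = w0) :: real)" for w
  have "(\<Sum>w\<in>perms U. of_bool (P \<subseteq> graph_of w) * m w)
        \<le> K ^ card P * (\<Sum>w\<in>perms U. of_bool (P \<subseteq> graph_of w)) / fact (card U)" for P
  proof -
    define s where "s = (\<Sum>w\<in>perms U. of_bool (P \<subseteq> graph_of w) :: real)"
    have K1: "1 \<le> K" using K fact_ge_1[of "card U", where ?'a = real] by linarith
    have s0: "0 \<le> s" by (simp add: s_def)
    have l: "(\<Sum>w\<in>perms U. of_bool (P \<subseteq> graph_of w) * m w) = of_bool (P \<subseteq> graph_of w0)"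
    proof -
      have "(\<Sum>w\<in>perms U. of_bool (P \<subseteq> graph_of w) * m w)
        = (\<Sum>w\<in>perms U. if w = w0 then of_bool (P \<subseteq> graph_of w0) else 0)"
        by (intro sum.cong) (auto simp: m_def)
      then show ?thesis using w0 U by simp
    qed
    have "of_bool (P \<subseteq> graph_of w0) * fact (card U) \<le> K ^ card P * s"
    proof (cases "P \<subseteq> graph_of w0")
      case True
      then have finP: "finite P" using finite_graph_of finite_subset by blast
      show ?thesis
      proof (cases "P = {}")
        case True
        then show ?thesis using U by (simp add: s_def)
      next
        case False
        have "of_bool (P \<subseteq> graph_of w0) \<le> s"
          unfolding s_def using w0 by (intro member_le_sum) auto
        then have "1 \<le> s" using True by simp
        have "K ^ 1 \<le> K ^ card P" using K1 False finP by (intro power_increasing) (auto simp: Suc_le_eq card_gt_0_iff)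
        then have "fact (card U) * 1 \<le> K ^ card P * s" using K \<open>1 \<le> s\<close> K1 by (intro mult_mono) auto
        then show ?thesis using True by simp
      qed
    qed (use K1 s0 in simp)
    then show ?thesis unfolding l s_def[symmetric] by (simp add: field_simps)
  qed
  moreover have "(\<Sum>w\<in>perms U. m w) = 1" using w0 U by (simp add: m_def of_bool_def)
  ultimately show ?thesis unfolding has_spread_def spread_bound_def
    by (intro exI[of _ m]) (use w0 in \<open>auto simp: m_def\<close>)
qed

text \<open>\<open>(N + l) / g\<close> is the number of edges of the path. The edges are halved
  instead of the vertices, which keeps both divisibility conditions; rounding and the removed tuple
  are small enough against \<open>N \<ge> 3 * (g + l)\<close>.\<close>

lemma halving_sizes:
  fixes N g l :: nat
  assumes "0 < g" "g dvd (N + l)" "3 * (g + l) \<le> N"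
  obtains a b where "N = a + l + b" "g dvd (a + l)" "g dvd (b + l)" "N \<le> 3 * a" "N \<le> 3 * b"
    "3 * a \<le> 2 * N" "3 * b \<le> 2 * N"
proof -
  obtain t where t: "N + l = g * t" using assms(2) by (auto elim: dvdE)
  define t1 t2 where "t1 = t div 2" and "t2 = t - t div 2"
  have "t1 + t2 = t" "t1 \<le> t2" "t2 \<le> t1 + 1" by (auto simp: t1_def t2_def)
  then have sum: "g * t1 + g * t2 = N + l" and "g * t1 \<le> g * t2" "g * t2 \<le> g * (t1 + 1)"
    using t by (auto simp flip: distrib_left simp del: mult_Suc_right intro!: mult_le_mono)
  then have le: "g * t1 \<le> g * t2" "g * t2 \<le> g * t1 + g" by (simp_all add: distrib_left)
  show ?thesis
  proof (rule that[of "g * t1 - l" "g * t2 - l"])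
    have large: "N \<ge> 3 * g + 3 * l" using assms(3) by simp
    have l1: "l \<le> g * t1" using large sum le by linarith
    then have l2: "l \<le> g * t2" using le by linarith
    show "g dvd (g * t1 - l + l)" "g dvd (g * t2 - l + l)" using l1 l2 by simp_all
    show "N = g * t1 - l + l + (g * t2 - l)" using l1 l2 sum by linarith
    show "N \<le> 3 * (g * t1 - l)" using large l1 sum le by linarith
    show "N \<le> 3 * (g * t2 - l)" using large l1 l2 sum le by linarith
    show "3 * (g * t1 - l) \<le> 2 * N" using large l1 l2 sum le by linarith
    show "3 * (g * t2 - l) \<le> 2 * N" using large l1 l2 sum le by linarith
  qed
qed

text \<open>Both occurrences of \<open>decay\<close> favour an induction from small to large sizes:
  for smaller \<open>N\<close> the required degree is lower and the constant obtained is better. The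
  type argument fixes the vertex type, which otherwise occurs only in bound variables.\<close>

definition spread_connection :: "'a itself \<Rightarrow> nat \<Rightarrow> nat \<Rightarrow> nat \<Rightarrow> real \<Rightarrow> real \<Rightarrow> nat \<Rightarrow> bool" where
  "spread_connection _ k l d c L N \<longleftrightarrow>
     (\<forall>(E :: 'a set set) U x y. finite U \<longrightarrow> card U = N \<longrightarrow> (k - l) dvd (N + l) \<longrightarrow>
        distinct x \<longrightarrow> distinct y \<longrightarrow> length x = l \<longrightarrow> length y = l \<longrightarrow>
        set x \<inter> U = {} \<longrightarrow> set y \<inter> U = {} \<longrightarrow> set x \<inter> set y = {} \<longrightarrow>
        degree_at_least E (U \<union> set x \<union> set y) U d (k - d) (c - 10 * 3 ^ (k - d) * decay N) \<longrightarrow>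
        has_spread U (L * (1 - decay N)) (\<lambda>w. ell_seq k (k - l) E (x @ w @ y)))"

text \<open>
  With \<open>decay N = N powr (-1/4)\<close>, passing from \<open>N\<close> to at most \<open>2 N / 3\<close> increases \<open>decay\<close> by a tenth
  of its value. This pays for the loss \<open>3 ^ (k - d) * decay N\<close> in the degree and for the failure probability of a halving.
\<close>

lemma spread_connection_exists:
  fixes \<kappa> c :: real
  assumes par: "0 < l" "l < k" "d < k" and \<kappa>: "0 \<le> \<kappa>" "\<kappa> / fact (k - d) < c"
    and conn: "Hamilton_connected_above k l d \<kappa>"
  shows "\<exists>L N0. 1 \<le> L \<and> 0 < N0 \<and> (\<forall>N\<ge>N0. spread_connection TYPE('a) k l d c L N \<and> decay N \<le> 1 / 2 \<and> 3 * k \<le> N \<and>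
     2 * real ((N + 2 * l) choose d) * ((real N + 1) * exp (- ((decay N)\<^sup>2 * N / 4))) \<le> decay N / 10)"
proof -
  define r where "r = k - d"
  \<comment> \<open>The factor 10 fits the gain of a tenth: \<open>M * (decay s - decay N)\<close>
    is at least \<open>3 ^ r * decay N\<close> for the size \<open>s\<close> of either half.\<close>
  define M where "M = 10 * (3::real) ^ r"
  define P where "P n \<longleftrightarrow> (\<forall>F\<in>ell_paths k l. \<forall>(H :: nat hypergraph) S T.
          card (verts F) = n \<longrightarrow>
          uniform_hypergraph k H \<longrightarrow> card (verts H) = n \<longrightarrow>
          real (min_degree d H) \<ge> \<kappa> * real ((n - d) choose (k - d)) \<longrightarrow>
          S \<subseteq> verts H \<longrightarrow> T \<subseteq> verts H \<longrightarrow> S \<inter> T = {} \<longrightarrow> card S = l \<longrightarrow> card T = l \<longrightarrow>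
          (\<exists>G f. subhypergraph G H \<and> hypergraph_iso f F G \<and>
                 f ` {1..l} = S \<and> f ` {n - l + 1..n} = T))" for n
  have "eventually P sequentially" using conn unfolding Hamilton_connected_above_def P_def .
  then have "\<forall>\<^sub>F N in sequentially. P (N + 2 * l)" by (rule sequentially_offset)
  moreover have "\<forall>\<^sub>F N in sequentially. \<kappa> * real ((N + 2 * l - d) choose r) \<le> (c - M * decay N) * real N ^ r"
    by (rule eventually_degree_transfer) (use \<kappa> in \<open>auto simp: r_def\<close>)
  moreover have "\<forall>\<^sub>F N in sequentially. decay N < 1 / 2"
    by (rule order_tendstoD(2)[OF decay_tendsto_0]) simp
  moreover note eventually_exp_small[of l d]
  moreover note eventually_ge_at_top[of "3 * k"]
  ultimately have "\<forall>\<^sub>F N in sequentially. P (N + 2 * l) \<and>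
      \<kappa> * real ((N + 2 * l - d) choose r) \<le> (c - M * decay N) * real N ^ r \<and> decay N < 1 / 2 \<and>
      2 * real ((N + 2 * l) choose d) * ((real N + 1) * exp (- ((decay N)\<^sup>2 * N / 4))) \<le> decay N / 10 \<and>
      3 * k \<le> N"
    by eventually_elim auto
  then obtain N1 where N1: "P (N + 2 * l)"
      "\<kappa> * real ((N + 2 * l - d) choose r) \<le> (c - M * decay N) * real N ^ r" "decay N < 1 / 2"
      "2 * real ((N + 2 * l) choose d) * ((real N + 1) * exp (- ((decay N)\<^sup>2 * N / 4))) \<le> decay N / 10"
      "3 * k \<le> N" if "N \<ge> N1" for N
    unfolding eventually_sequentially by blast
  define N0 where "N0 = N1 + 1"
  \<comment> \<open>Below \<open>3 * N0\<close> a point mass is used, for which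
    \<open>fact (3 * N0)\<close> suffices; from there on both halves have size at least
    \<open>N0\<close>. The factor 4 leaves room for \<open>1 - decay N \<ge> 1 / 2\<close> and keeps
    the intermediate constant \<open>K\<close> above 1.\<close>
  define L where "L = 4 * (fact (3 * N0) :: real)"
  have L1: "4 \<le> L" unfolding L_def using fact_ge_1[of "3 * N0", where ?'a = real] by linarith
  have main: "spread_connection TYPE('a) k l d c L N" if "N0 \<le> N" for N
    using that
  proof (induction N rule: less_induct)
    case (less N)
    then have N: "N1 \<le> N" "0 < N" by (auto simp: N0_def)
    note n = N1[OF N(1)]
    show ?case unfolding spread_connection_def
    proof (intro allI impI)
      fix E :: "'a set set" and U x y
      assume U: "finite U" "card U = N" and dvd: "(k - l) dvd (N + l)"
        and xy: "distinct x" "distinct y" "length x = l" "length y = l"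
          "set x \<inter> U = {}" "set y \<inter> U = {}" "set x \<inter> set y = {}"
        and deg: "degree_at_least E (U \<union> set x \<union> set y) U d (k - d) (c - 10 * 3 ^ (k - d) * decay N)"
      have deg': "degree_at_least E (U \<union> set x \<union> set y) U d r (c - M * decay N)"
        using deg by (simp add: r_def M_def)
      show "has_spread U (L * (1 - decay N)) (\<lambda>w. ell_seq k (k - l) E (x @ w @ y))"
      proof (cases "N < 3 * N0")
        case True
        have "\<exists>w. distinct w \<and> set w = U \<and> ell_seq k (k - l) E (x @ w @ y)"
        proof (rule ordered_Hamilton_connection[where c = \<kappa> and d = d and N = N])
          show "d \<le> N" using n(5) par by simp
        next
          fix F and H :: "nat hypergraph" and S T
          assume "F \<in> ell_paths k l" "card (verts F) = N + 2 * l"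
            "uniform_hypergraph k H" "card (verts H) = N + 2 * l"
            "real (min_degree d H) \<ge> \<kappa> * real ((N + 2 * l - d) choose (k - d))"
            "S \<subseteq> verts H" "T \<subseteq> verts H" "S \<inter> T = {}" "card S = l" "card T = l"
          then show "\<exists>G f. subhypergraph G H \<and> hypergraph_iso f F G \<and>
                 f ` {1..l} = S \<and> f ` {N + 2 * l - l + 1..N + 2 * l} = T"
            using n(1) unfolding P_def by blast
        next
          fix D assume "D \<subseteq> U \<union> set x \<union> set y" "card D = d"
          then have "(c - M * decay N) * real N ^ r \<le> real (card (link E D U r))"
            using deg' U by (auto simp: degree_at_least_def)
          then show "\<kappa> * real ((N + 2 * l - d) choose (k - d)) \<le> real (card (link E D U (k - d)))"
            using n(2) by (simp add: r_def)
        qed (use par U xy dvd in auto)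
        then obtain w where w: "distinct w" "set w = U" "ell_seq k (k - l) E (x @ w @ y)" by blast
        show ?thesis
        proof (rule has_spread_point[of _ w])
          have "(fact (card U) :: real) \<le> fact (3 * N0)" using U True by (intro fact_mono) auto
          also have "\<dots> \<le> L * (1 / 2)" by (simp add: L_def)
          also have "\<dots> \<le> L * (1 - decay N)" using n(3) L1 by (intro mult_left_mono) auto
          finally show "fact (card U) \<le> L * (1 - decay N)" .
        qed (use w U in \<open>auto simp: permutations_of_set_def\<close>)
      next
        case False
        then have N3: "3 * N0 \<le> N" by simp
        have "3 * (k - l + l) \<le> N" using n(5) par by simp
        then obtain a b where ab: "N = a + l + b" "(k - l) dvd (a + l)" "(k - l) dvd (b + l)"
            "N \<le> 3 * a" "N \<le> 3 * b" "3 * a \<le> 2 * N" "3 * b \<le> 2 * N"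
          using halving_sizes[of "k - l" N l] par dvd by (metis zero_less_diff)
        have IH: "spread_connection TYPE('a) k l d c L a" "spread_connection TYPE('a) k l d c L b"
          using less.IH N3 ab par N by auto
        \<comment> \<open>Lies between the constants \<open>L * (1 - decay s)\<close> of the halves
          and \<open>L * (1 - decay N) * (1 - decay N / 10)\<close>, the constant of the whole
          reduced by the failure probability.\<close>
        define K where "K = L * (1 - 11 / 10 * decay N)"
        have K1: "1 \<le> K"
        proof -
          have "4 * (9 / 20) \<le> L * (1 - 11 / 10 * decay N)"
            using n(3) L1 by (intro mult_mono) auto
          then show ?thesis by (simp add: K_def)
        qed
        have gain: "11 / 10 * decay N \<le> decay s" if "s = a \<or> s = b" for s
          using that ab N by (intro decay_gain) auto
        have step: "c - M * decay s \<le> c - M * decay N - 3 ^ r * decay N" if "s = a \<or> s = b" for s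
          using mult_left_mono[OF gain[OF that], of M] by (simp add: M_def)
        have Ks: "0 \<le> L * (1 - decay s)" "L * (1 - decay s) \<le> K" if "s = a \<or> s = b" for s
        proof -
          have "N1 \<le> s" using that N3 ab by (auto simp: N0_def)
          then show "0 \<le> L * (1 - decay s)" using N1(3)[of s] L1 by simp
          show "L * (1 - decay s) \<le> K" unfolding K_def using gain[OF that] L1 by (intro mult_left_mono) auto
        qed
        have cardV: "card (U \<union> set x \<union> set y) = N + 2 * l"
          using U xy by (subst card_Un3_disjoint) (auto simp: distinct_card Int_commute)
        show ?thesis
        proof (rule has_spread_halving[where a = a and b = b and \<epsilon> = "decay N / 10" and K = K and N = N
              and \<eta> = "decay N" and c = "c - M * decay N" and r = r and d = d and l = l and k = k])
          show "1 \<le> K" by (rule K1)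
          have "1 - 11 / 10 * decay N \<le> (1 - decay N) * (1 - decay N / 10)"
            by (simp add: algebra_simps)
          then show "K \<le> L * (1 - decay N) * (1 - decay N / 10)"
            unfolding K_def mult.assoc using L1 by (intro mult_left_mono) auto
        next
          fix A z assume A: "A \<subseteq> U" "card A = a" "set z \<subseteq> U - A" "distinct z" "length z = l"
            "degree_at_least E (A \<union> set x \<union> set z) A d r (c - M * decay N - 3 ^ r * decay N)"
          have dg: "degree_at_least E (A \<union> set x \<union> set z) A d r (c - M * decay a)"
            by (rule degree_at_least_mono[OF A(6) order_refl]) (use step in simp)
          have "has_spread A (L * (1 - decay a)) (\<lambda>w. ell_seq k (k - l) E (x @ w @ z))"
          proof (rule IH(1)[unfolded spread_connection_def, rule_format])
            show "finite A" using A(1) U(1) by (rule finite_subset)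
          qed (use A xy ab dg in \<open>auto simp: M_def r_def\<close>)
          then show "has_spread A K (\<lambda>w. ell_seq k (k - l) E (x @ w @ z))"
            by (rule has_spread_mono) (use Ks in auto)
        next
          fix B z assume B: "B \<subseteq> U" "card B = b" "set z \<subseteq> U - B" "distinct z" "length z = l"
            "degree_at_least E (B \<union> set z \<union> set y) B d r (c - M * decay N - 3 ^ r * decay N)"
          have dg: "degree_at_least E (B \<union> set z \<union> set y) B d r (c - M * decay b)"
            by (rule degree_at_least_mono[OF B(6) order_refl]) (use step in simp)
          have "has_spread B (L * (1 - decay b)) (\<lambda>w. ell_seq k (k - l) E (z @ w @ y))"
          proof (rule IH(2)[unfolded spread_connection_def, rule_format])
            show "finite B" using B(1) U(1) by (rule finite_subset)
          qed (use B xy ab dg in \<open>auto simp: M_def r_def\<close>)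
          then show "has_spread B K (\<lambda>w. ell_seq k (k - l) E (z @ w @ y))"
            by (rule has_spread_mono) (use Ks in auto)
        qed (use par U N ab xy deg' n cardV decay_nonneg in \<open>auto simp: r_def\<close>)
      qed
    qed
  qed
  show ?thesis
  proof (intro exI[of _ L] exI[of _ N0] conjI allI impI)
    fix N assume "N0 \<le> N"
    then have "N1 \<le> N" by (simp add: N0_def)
    from N1(3-5)[OF this] show "decay N \<le> 1 / 2" "3 * k \<le> N"
      "2 * real ((N + 2 * l) choose d) * ((real N + 1) * exp (- ((decay N)\<^sup>2 * N / 4))) \<le> decay N / 10" by auto
  qed (use main L1 in \<open>auto simp: N0_def\<close>)
qed

text \<open>\<open>w @ take l w\<close> is a path from a tuple \<open>x\<close> to itself with
  \<open>n - l\<close> inner vertices. One halving with both ends equal to \<open>x\<close> leaves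
  connections from \<open>x\<close> to \<open>z\<close> and from \<open>z\<close> to
  \<open>x\<close>, whose ends are disjoint.\<close>

lemma spread_closed_sequences:
  fixes L c :: real and V :: "'a set"
  assumes par: "0 < l" "l < k" "d < k"
    and L: "1 \<le> L" "0 < N0"
    and conn: "\<And>N. N0 \<le> N \<Longrightarrow> spread_connection TYPE('a) k l d c L N \<and> decay N \<le> 1 / 2 \<and> 3 * k \<le> N \<and>
     2 * real ((N + 2 * l) choose d) * ((real N + 1) * exp (- ((decay N)\<^sup>2 * N / 4))) \<le> decay N / 10"
    and V: "finite V" "card V = n" "(k - l) dvd n" "3 * N0 + l \<le> n"
    and deg: "\<And>x. set x \<subseteq> V \<Longrightarrow> distinct x \<Longrightarrow> length x = l \<Longrightarrow> degree_at_least E V (V - set x) d (k - d) c"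
  shows "has_spread V (2 * L) (\<lambda>w. ell_seq k (k - l) E (w @ take l w))"
proof -
  define N where "N = n - l"
  have N: "n = N + l" "3 * N0 \<le> N" "N0 \<le> N" "0 < N" using V L by (auto simp: N_def)
  note cN = conn[OF N(3)]
  have closed: "has_spread (V - set x) (2 * L) (\<lambda>w. ell_seq k (k - l) E (x @ w @ x))"
    if x: "set x \<subseteq> V" "distinct x" "length x = l" for x
  proof -
    have U: "finite (V - set x)" "card (V - set x) = N"
      using V x N by (simp_all add: card_Diff_subset distinct_card)
    have "3 * (k - l + l) \<le> N" using cN par by simp
    then obtain a b where ab: "N = a + l + b" "(k - l) dvd (a + l)" "(k - l) dvd (b + l)"
        "N \<le> 3 * a" "N \<le> 3 * b" "3 * a \<le> 2 * N" "3 * b \<le> 2 * N"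
      using halving_sizes[of "k - l" N l] par V N by (metis zero_less_diff)
    have Ns: "N0 \<le> a" "N0 \<le> b" using N ab by auto
    \<comment> \<open>The degree \<open>c\<close> carries no error term yet, so the slack allowed at
      the size of a half only has to cover this first loss.\<close>
    have step: "c - 10 * 3 ^ (k - d) * decay s \<le> c - 3 ^ (k - d) * decay N" if "s = a \<or> s = b" for s
    proof -
      have "11 / 10 * decay N \<le> decay s" using that ab N by (intro decay_gain) auto
      then have "decay N \<le> 10 * decay s" using decay_nonneg[of N] by linarith
      then have "3 ^ (k - d) * decay N \<le> 3 ^ (k - d) * (10 * decay s)" by (intro mult_left_mono) auto
      then show ?thesis by simp
    qed
    have Ks: "0 \<le> L * (1 - decay s)" "L * (1 - decay s) \<le> L" if "s = a \<or> s = b" for s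
    proof -
      have "decay s \<le> 1 / 2" using conn[of s] Ns that by auto
      then show "0 \<le> L * (1 - decay s)" using L by simp
      show "L * (1 - decay s) \<le> L" using L decay_nonneg[of s] by (simp add: algebra_simps)
    qed
    have VU: "V - set x \<union> set x \<union> set x = V" using x by auto
    show ?thesis
    proof (rule has_spread_halving[where a = a and b = b and \<epsilon> = "decay N / 10" and K = L and N = N
          and \<eta> = "decay N" and c = c and r = "k - d" and d = d and l = l and k = k])
      show "degree_at_least E (V - set x \<union> set x \<union> set x) (V - set x) d (k - d) c"
        using deg[OF x] VU by simp
      have "n choose d \<le> (N + 2 * l) choose d" using N by (intro binomial_right_mono) auto
      then have "2 * real (n choose d) * ((real N + 1) * exp (- ((decay N)\<^sup>2 * N / 4)))
         \<le> 2 * real ((N + 2 * l) choose d) * ((real N + 1) * exp (- ((decay N)\<^sup>2 * N / 4)))"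
        by (intro mult_right_mono mult_left_mono) auto
      then show "2 * real (card (V - set x \<union> set x \<union> set x) choose d) * ((real N + 1) * exp (- ((decay N)\<^sup>2 * N / 4))) \<le> decay N / 10"
        unfolding VU V using cN by linarith
      show "L \<le> 2 * L * (1 - decay N / 10)" using cN L by (simp add: algebra_simps)
    next
      fix A z assume A: "A \<subseteq> V - set x" "card A = a" "set z \<subseteq> V - set x - A" "distinct z" "length z = l"
        "degree_at_least E (A \<union> set x \<union> set z) A d (k - d) (c - 3 ^ (k - d) * decay N)"
      have dg: "degree_at_least E (A \<union> set x \<union> set z) A d (k - d) (c - 10 * 3 ^ (k - d) * decay a)"
        by (rule degree_at_least_mono[OF A(6) order_refl]) (use step in simp)
      have "has_spread A (L * (1 - decay a)) (\<lambda>w. ell_seq k (k - l) E (x @ w @ z))"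
      proof (rule conjunct1[OF conn[OF Ns(1)], unfolded spread_connection_def, rule_format])
        show "finite A" using A(1) U(1) by (rule finite_subset)
      qed (use A x ab dg in auto)
      then show "has_spread A L (\<lambda>w. ell_seq k (k - l) E (x @ w @ z))"
        by (rule has_spread_mono) (use Ks in auto)
    next
      fix B z assume B: "B \<subseteq> V - set x" "card B = b" "set z \<subseteq> V - set x - B" "distinct z" "length z = l"
        "degree_at_least E (B \<union> set z \<union> set x) B d (k - d) (c - 3 ^ (k - d) * decay N)"
      have dg: "degree_at_least E (B \<union> set z \<union> set x) B d (k - d) (c - 10 * 3 ^ (k - d) * decay b)"
        by (rule degree_at_least_mono[OF B(6) order_refl]) (use step in simp)
      have "has_spread B (L * (1 - decay b)) (\<lambda>w. ell_seq k (k - l) E (z @ w @ x))"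
      proof (rule conjunct1[OF conn[OF Ns(2)], unfolded spread_connection_def, rule_format])
        show "finite B" using B(1) U(1) by (rule finite_subset)
      qed (use B x ab dg in auto)
      then show "has_spread B L (\<lambda>w. ell_seq k (k - l) E (z @ w @ x))"
        by (rule has_spread_mono) (use Ks in auto)
    qed (use par U N ab x cN decay_nonneg L in auto)
  qed
  \<comment> \<open>A splice with empty left part and \<open>\<epsilon> = 0\<close>. Its middle
    tuple is formed by the first \<open>l\<close> entries, so the starting tuple of the cycle
    becomes uniformly random too.\<close>
  have "has_spread V (2 * L) (\<lambda>w. length (take l (drop 0 w)) = l \<and> True \<and>
      ell_seq k (k - l) E (take l (drop 0 w) @ drop (0 + l) w @ take l (drop 0 w)))"
  proof (rule has_spread_splice[where good = "\<lambda>_ _. True" and \<epsilon> = 0 and b = N and K = "2 * L"])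
    fix A z assume h: "A \<subseteq> V" "card A = 0" "set z \<subseteq> V - A" "distinct z" "length z = l"
    then have A: "A = {}" using V finite_subset by (metis card_0_eq)
    show "has_spread A (2 * L) (\<lambda>_. True)"
      by (rule has_spread_point[of _ "[]"]) (use A L in auto)
    show "has_spread (V - A - set z) (2 * L) (\<lambda>w. ell_seq k (k - l) E (z @ w @ z))"
      using closed[of z] h A by simp
  qed (use V N L in auto)
  then show ?thesis
  proof (rule has_spread_mono)
    fix w assume "length (take l (drop 0 w)) = l \<and> True \<and>
      ell_seq k (k - l) E (take l (drop 0 w) @ drop (0 + l) w @ take l (drop 0 w))"
    then have "ell_seq k (k - l) E (take l w @ drop l w @ take l w)" by simp
    then show "ell_seq k (k - l) E (w @ take l w)" by (metis append.assoc append_take_drop_id)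
  qed (use L in auto)
qed

section \<open>The second moment method\<close>

lemma prob_all_kept:
  assumes "finite A" "C \<subseteq> A" "0 \<le> p" "p \<le> 1"
  shows "measure_pmf.expectation (Pi_pmf A False (\<lambda>_. bernoulli_pmf p)) (\<lambda>X. of_bool (\<forall>e\<in>C. X e)) = p ^ card C"
proof -
  let ?M = "Pi_pmf A False (\<lambda>_. bernoulli_pmf p)"
  have "measure_pmf.expectation ?M (\<lambda>X. of_bool (\<forall>e\<in>C. X e))
     = measure_pmf.expectation ?M (indicator (Pi A (\<lambda>e. if e \<in> C then {True} else UNIV)))"
    using assms(2) by (intro Bochner_Integration.integral_cong refl) (auto simp: indicator_def Pi_iff)
  also have "\<dots> = measure_pmf.prob ?M (Pi A (\<lambda>e. if e \<in> C then {True} else UNIV))" by simp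
  also have "\<dots> = (\<Prod>e\<in>A. measure_pmf.prob (bernoulli_pmf p) (if e \<in> C then {True} else UNIV))"
    using assms by (simp add: measure_Pi_pmf_Pi)
  also have "\<dots> = (\<Prod>e\<in>A. if e \<in> C then p else 1)"
    using assms by (intro prod.cong refl) (auto simp: measure_pmf_single)
  also have "\<dots> = (\<Prod>e\<in>C. p)"
    using assms by (simp add: prod.If_cases Int_absorb1)
  finally show ?thesis by simp
qed

text \<open>The correlation is bounded for every fixed \<open>u\<close> instead of on average over
  two copies, so only one of the two cycles has to be analysed as random. If no \<open>C w\<close>
  of positive weight is kept, then \<open>Y = 0\<close> and \<open>(Y - 1)\<^sup>2 = 1\<close>, so
  the variance bounds the failure probability.\<close>

lemma second_moment_existence:
  fixes m :: "'b \<Rightarrow> real" and C :: "'b \<Rightarrow> 'a set"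
  assumes A: "finite A" and p: "0 < p" "p \<le> 1" and W: "finite W"
    and m: "\<And>w. w \<in> W \<Longrightarrow> 0 \<le> m w" "(\<Sum>w\<in>W. m w) = 1"
    and C: "\<And>w. w \<in> W \<Longrightarrow> m w \<noteq> 0 \<Longrightarrow> C w \<subseteq> A"
    and corr: "\<And>u. u \<in> W \<Longrightarrow> m u \<noteq> 0 \<Longrightarrow> (\<Sum>w\<in>W. m w * (1 / p) ^ card (C w \<inter> C u)) \<le> 1 + \<beta>"
  shows "1 - \<beta> \<le> measure_pmf.prob (Pi_pmf A False (\<lambda>_. bernoulli_pmf p))
     {X. \<exists>w\<in>W. m w \<noteq> 0 \<and> (\<forall>e\<in>C w. X e)}"
proof -
  define M where "M = Pi_pmf A False (\<lambda>_. bernoulli_pmf p)"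
  define I where "I D X = (of_bool (\<forall>e\<in>D. X e) :: real)" for D and X :: "'a \<Rightarrow> bool"
  define B where "B = {X. \<exists>w\<in>W. m w \<noteq> 0 \<and> (\<forall>e\<in>C w. X e)}"
  define Y where "Y X = (\<Sum>w\<in>W. m w / p ^ card (C w) * I (C w) X)" for X
  have fin: "finite (set_pmf M)"
  proof (rule finite_subset)
    show "set_pmf M \<subseteq> PiE_dflt A False (\<lambda>_. UNIV)"
      unfolding M_def using set_Pi_pmf_subset[OF A, of False "\<lambda>_. bernoulli_pmf p"] by (auto simp: PiE_dflt_def)
    show "finite (PiE_dflt A False (\<lambda>_. UNIV :: bool set))" using A by (intro finite_PiE_dflt) auto
  qed
  have int: "integrable (measure_pmf M) f" for f :: "('a \<Rightarrow> bool) \<Rightarrow> real"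
    by (rule integrable_measure_pmf_finite[OF fin])
  have EI: "measure_pmf.expectation M (I D) = p ^ card D" if "D \<subseteq> A" for D
    unfolding I_def M_def using prob_all_kept[OF A that] p by simp
  have EY: "measure_pmf.expectation M Y = 1"
  proof -
    have "measure_pmf.expectation M Y = (\<Sum>w\<in>W. m w / p ^ card (C w) * measure_pmf.expectation M (I (C w)))"
      unfolding Y_def by (simp add: int)
    also have "\<dots> = (\<Sum>w\<in>W. m w)"
    proof (rule sum.cong[OF refl])
      fix w assume "w \<in> W"
      then show "m w / p ^ card (C w) * measure_pmf.expectation M (I (C w)) = m w"
        using EI[of "C w"] C[of w] p by (cases "m w = 0") auto
    qed
    finally show ?thesis using m by simp
  qed
  have EY2: "measure_pmf.expectation M (\<lambda>X. (Y X)\<^sup>2) \<le> 1 + \<beta>"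
  proof -
    have "measure_pmf.expectation M (\<lambda>X. (Y X)\<^sup>2) = (\<Sum>u\<in>W. \<Sum>w\<in>W.
       m u / p ^ card (C u) * (m w / p ^ card (C w)) * measure_pmf.expectation M (I (C u \<union> C w)))"
    proof -
      have "(Y X)\<^sup>2 = (\<Sum>u\<in>W. \<Sum>w\<in>W. m u / p ^ card (C u) * (m w / p ^ card (C w)) * I (C u \<union> C w) X)" for X
      proof -
        have "I (C u \<union> C w) X = I (C u) X * I (C w) X" for u w by (auto simp: I_def)
        then show ?thesis unfolding Y_def power2_eq_square sum_product
          by (intro sum.cong refl) simp
      qed
      then show ?thesis by (simp add: int)
    qed
    also have "\<dots> = (\<Sum>u\<in>W. m u * (\<Sum>w\<in>W. m w * (1 / p) ^ card (C w \<inter> C u)))"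
      unfolding sum_distrib_left
    proof (intro sum.cong refl)
      fix u w assume uw: "u \<in> W" "w \<in> W"
      show "m u / p ^ card (C u) * (m w / p ^ card (C w)) * measure_pmf.expectation M (I (C u \<union> C w))
         = m u * (m w * (1 / p) ^ card (C w \<inter> C u))"
      proof (cases "m u = 0 \<or> m w = 0")
        case False
        then have sub: "C u \<subseteq> A" "C w \<subseteq> A" using C uw by auto
        then have f: "finite (C u)" "finite (C w)" using A finite_subset by auto
        have "card (C u) + card (C w) = card (C u \<union> C w) + card (C w \<inter> C u)"
          using card_Un_Int[OF f] by (simp add: Int_commute)
        then have "p ^ card (C u) * p ^ card (C w) = p ^ card (C u \<union> C w) * p ^ card (C w \<inter> C u)"
          by (simp flip: power_add)
        then have e1: "p ^ card (C u \<union> C w) / (p ^ card (C u) * p ^ card (C w)) = (1 / p) ^ card (C w \<inter> C u)"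
          using p by (simp add: power_one_over field_simps)
        have e2: "measure_pmf.expectation M (I (C u \<union> C w)) = p ^ card (C u \<union> C w)"
          using sub by (intro EI) auto
        show ?thesis unfolding e2 e1[symmetric] by simp
      qed auto
    qed
    also have "\<dots> \<le> (\<Sum>u\<in>W. m u * (1 + \<beta>))"
    proof (rule sum_mono)
      fix u assume "u \<in> W"
      then show "m u * (\<Sum>w\<in>W. m w * (1 / p) ^ card (C w \<inter> C u)) \<le> m u * (1 + \<beta>)"
        using corr[of u] m(1)[of u] by (cases "m u = 0") (auto intro: mult_left_mono)
    qed
    also have "\<dots> = 1 + \<beta>" unfolding sum_distrib_right[symmetric] m(2) by simp
    finally show ?thesis .
  qed
  have "measure_pmf.prob M (- B) = measure_pmf.expectation M (indicator (- B))" by simp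
  also have "\<dots> \<le> measure_pmf.expectation M (\<lambda>X. (Y X - 1)\<^sup>2)"
  proof (rule integral_mono)
    fix X
    show "indicator (- B) X \<le> (Y X - 1)\<^sup>2"
    proof (cases "X \<in> B")
      case False
      then have "Y X = 0" unfolding Y_def by (intro sum.neutral) (auto simp: B_def I_def)
      then show ?thesis by (simp add: indicator_def)
    qed simp
  qed (use int in auto)
  also have "\<dots> = measure_pmf.expectation M (\<lambda>X. (Y X)\<^sup>2) - 2 * measure_pmf.expectation M Y + 1"
    by (simp add: power2_diff int)
  also have "\<dots> \<le> \<beta>" using EY EY2 by simp
  finally have "measure_pmf.prob M (- B) \<le> \<beta>" .
  moreover have "measure_pmf.prob M (- B) = 1 - measure_pmf.prob M B"
    using measure_pmf.prob_compl[of B M] by (simp add: Compl_eq_Diff_UNIV)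
  ultimately show ?thesis unfolding M_def B_def by simp
qed

section \<open>Prescribed windows of a cyclic sequence\<close>

lemma power_self_le_exp_fact: "real v ^ v \<le> exp (real v) * fact v"
proof -
  have s: "(\<lambda>i. real v ^ i /\<^sub>R fact i) sums exp (real v)" by (rule exp_converges)
  have "(\<Sum>i\<in>{v}. real v ^ i /\<^sub>R fact i) \<le> (\<Sum>i. real v ^ i /\<^sub>R fact i)"
    using s by (intro sum_le_suminf) (auto simp: sums_iff)
  then have "real v ^ v /\<^sub>R fact v \<le> exp (real v)" using s by (simp add: sums_iff)
  then show ?thesis by (simp add: field_simps)
qed

text \<open>Combines \<open>(n / v) ^ v \<le> n choose v\<close> with
  \<open>v ^ v \<le> exp v * fact v\<close>. Validity up to \<open>v = n\<close> matters, because
  the prescribed windows may cover almost all vertices.\<close>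

lemma fact_diff_over_fact_le:
  assumes "v \<le> n" "0 < n"
  shows "fact (n - v) / fact n \<le> (exp 1 / real n) ^ v"
proof (cases "v = 0")
  case False
  have "(real n / real v) ^ v \<le> real (n choose v)"
    using binomial_ge_n_over_k_pow_k[OF assms(1), where ?'a = real] by simp
  then have "(real n / real v) ^ v * real v ^ v \<le> real (n choose v) * (exp (real v) * fact v)"
    by (rule mult_mono[OF _ power_self_le_exp_fact]) auto
  also have "(real n / real v) ^ v * real v ^ v = real n ^ v"
    using False by (simp add: power_divide)
  finally have "real n ^ v * fact (n - v) \<le> real (n choose v) * (exp (real v) * fact v) * fact (n - v)"
    by (rule mult_right_mono) auto
  also have "\<dots> = exp (real v) * real (fact v * fact (n - v) * (n choose v))" by simp
  also have "fact v * fact (n - v) * (n choose v) = fact n" by (rule binomial_fact_lemma[OF assms(1)])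
  finally have "real n ^ v * fact (n - v) \<le> exp (real v) * fact n" by simp
  moreover have "exp (real v) = exp 1 ^ v" by (simp flip: exp_of_nat_mult)
  ultimately show ?thesis using assms by (simp add: power_divide field_simps)
qed simp

text \<open>If some ordering contains \<open>P\<close>, then \<open>P\<close> is injective in both
  coordinates, and deleting the prescribed positions maps the orderings containing \<open>P\<close>
  injectively to orderings of the remaining values. Otherwise the count is 0.\<close>

lemma card_agreeing_permutations:
  assumes V: "finite V"
  shows "card {w \<in> perms V. P \<subseteq> graph_of w} \<le> fact (card V - card P)"
proof (cases "\<exists>w0 \<in> perms V. P \<subseteq> graph_of w0")
  case True
  then obtain w0 where w0: "set w0 = V" "distinct w0" "P \<subseteq> graph_of w0"
    by (auto simp: permutations_of_set_def)
  define n where "n = card V"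
  have len: "length w = n" if "w \<in> perms V" for w
    using that by (auto simp: permutations_of_set_def n_def distinct_card)
  have l0: "length w0 = n" using w0 by (auto simp: n_def distinct_card)
  have finP: "finite P" using w0(3) finite_graph_of finite_subset by blast
  define R where "R = {..<n} - fst ` P"
  have gr: "i < length w0 \<and> w0 ! i = c" if "(i, c) \<in> P" for i c
    using w0(3) that by (auto simp: graph_of_def)
  have injf: "inj_on fst P" by (rule inj_onI) (metis gr prod.collapse)
  have injs: "inj_on snd P"
  proof (rule inj_onI)
    fix x y assume xy: "x \<in> P" "y \<in> P" "snd x = snd y"
    obtain i c i' c' where [simp]: "x = (i, c)" "y = (i', c')" by (cases x, cases y)
    then have "i < length w0" "w0 ! i = c" "i' < length w0" "w0 ! i' = c" using xy gr by auto
    then show "x = y" using w0(2) xy by (auto simp: nth_eq_iff_index_eq)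
  qed
  have fstP: "fst ` P \<subseteq> {..<n}" using w0 l0 by (auto simp: graph_of_def)
  have cR: "card R = n - card P"
    unfolding R_def using finP fstP by (simp add: card_Diff_subset card_image[OF injf])
  obtain h where h: "bij_betw h {..<n - card P} R"
    using ex_bij_betw_nat_finite[of R] cR by (auto simp: R_def atLeast0LessThan)
  define f where "f w = map (\<lambda>i. w ! h i) [0..<n - card P]" for w :: "'a list"
  have hR: "h i \<in> R" if "i < n - card P" for i using h that by (auto simp: bij_betw_def)
  have "card {w \<in> perms V. P \<subseteq> graph_of w} \<le> card (perms (V - snd ` P))"
  proof (rule card_inj_on_le[where f = f])
    show "inj_on f {w \<in> perms V. P \<subseteq> graph_of w}"
    proof (rule inj_onI)
      fix w w' assume w: "w \<in> {w \<in> perms V. P \<subseteq> graph_of w}"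
        "w' \<in> {w \<in> perms V. P \<subseteq> graph_of w}" and eq: "f w = f w'"
      show "w = w'"
      proof (rule nth_equalityI)
        show "length w = length w'" using len w by simp
        fix j assume j: "j < length w"
        show "w ! j = w' ! j"
        proof (cases "j \<in> fst ` P")
          case True
          then obtain c where "(j, c) \<in> P" by auto
          then have "(j, c) \<in> graph_of w" "(j, c) \<in> graph_of w'" using w by auto
          then show ?thesis by (auto simp: graph_of_def)
        next
          case False
          then have "j \<in> R" using j len w by (auto simp: R_def)
          then obtain i where i: "i < n - card P" "j = h i" using h by (auto simp: bij_betw_def)
          have "f w ! i = f w' ! i" using eq by simp
          then show ?thesis using i by (simp add: f_def)
        qed
      qed
    qed
    show "f ` {w \<in> perms V. P \<subseteq> graph_of w} \<subseteq> perms (V - snd ` P)"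
    proof (rule image_subsetI)
      fix w assume "w \<in> {w \<in> perms V. P \<subseteq> graph_of w}"
      then have w: "set w = V" "distinct w" "P \<subseteq> graph_of w" "length w = n"
        using len by (auto simp: permutations_of_set_def)
      have "distinct (f w)"
        unfolding f_def distinct_map using w h hR
        by (auto simp: inj_on_def bij_betw_def nth_eq_iff_index_eq R_def)
      moreover have "set (f w) \<subseteq> V - snd ` P"
      proof
        fix v assume "v \<in> set (f w)"
        then obtain i where i: "i < n - card P" "v = w ! h i" by (auto simp: f_def)
        have hi: "h i < n" "h i \<notin> fst ` P" using hR[OF i(1)] by (auto simp: R_def)
        have "v \<notin> snd ` P"
        proof
          assume "v \<in> snd ` P"
          then obtain j where j: "(j, v) \<in> P" by auto
          then have "j < n" "w ! j = v" using w by (auto simp: graph_of_def)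
          then have "j = h i" using i hi w by (auto simp: nth_eq_iff_index_eq)
          then show False using hi j by force
        qed
        then show "v \<in> V - snd ` P" using i hi w by auto
      qed
      moreover have "card (set (f w)) = card (V - snd ` P)"
      proof -
        have "snd ` P \<subseteq> V" using w by (auto simp: graph_of_def)
        then have "card (V - snd ` P) = n - card P"
          using V finP by (simp add: card_Diff_subset card_image[OF injs] n_def)
        moreover have "card (set (f w)) = n - card P" 
          using distinct_card[OF \<open>distinct (f w)\<close>] by (simp only: f_def length_map length_upt diff_zero)
        ultimately show ?thesis by simp
      qed
      ultimately have "set (f w) = V - snd ` P" using V by (intro card_subset_eq) auto
      then show "f w \<in> perms (V - snd ` P)" using \<open>distinct (f w)\<close> by (simp add: permutations_of_set_def)
    qed
  qed (use V in auto)
  also have "\<dots> = fact (card (V - snd ` P))" using V by simp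
  also have "card (V - snd ` P) = card V - card P"
  proof -
    have "snd ` P \<subseteq> V" using w0 by (auto simp: graph_of_def)
    then show ?thesis using V finP by (simp add: card_Diff_subset card_image[OF injs])
  qed
  finally show ?thesis .
next
  case False
  then have none: "{w \<in> perms V. P \<subseteq> graph_of w} = {}" by blast
  show ?thesis unfolding none by simp
qed

section \<open>Common windows of two cyclic sequences\<close>

text \<open>\<open>M\<close> is the number of edges of the cycle, and \<open>g + 2 \<le> k\<close>
  encodes \<open>l \<ge> 2\<close>.\<close>

locale cyclic_windows =
  fixes k g n M :: nat and V :: "'a set"
  assumes g: "0 < g" "g + 2 \<le> k" and n: "n = M * g" "k \<le> n" and V: "finite V" "card V = n"
begin

definition window :: "'a list \<Rightarrow> nat \<Rightarrow> 'a set" where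
  "window u j = (\<lambda>t. u ! ((j * g + t) mod n)) ` {..<k}"

definition hits :: "'a list \<Rightarrow> 'a list \<Rightarrow> nat set \<Rightarrow> bool" where
  "hits w u S \<longleftrightarrow> (\<forall>j\<in>S. window u j \<in> window w ` {..<M})"

definition cover :: "'a list \<Rightarrow> nat set \<Rightarrow> 'a set" where
  "cover u S = (\<Union>j\<in>S. window u j)"

text \<open>
  The event that \<open>w\<close> hits \<open>S\<close> is a union of prescriptions of a partial embedding, one for each trace. So its weight is
  bounded by the number of traces times the spread bound for a single one.
\<close>

definition traces :: "'a list \<Rightarrow> nat set \<Rightarrow> (nat \<times> 'a) set set" where
  "traces u S = (\<lambda>w. {(i, c) \<in> graph_of w. c \<in> cover u S}) ` {w \<in> perms V. hits w u S}"

lemma n_pos: "0 < n" using g n by linarith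

lemma perm:
  assumes "w \<in> perms V"
  shows "set w = V" "distinct w" "length w = n"
  using assms V by (auto simp: permutations_of_set_def distinct_card[symmetric])

lemma window_subset: "u \<in> perms V \<Longrightarrow> window u j \<subseteq> V"
  using perm[of u] n_pos by (auto simp: window_def)

lemma cover_subset: "u \<in> perms V \<Longrightarrow> cover u S \<subseteq> V"
  using window_subset by (auto simp: cover_def)

lemma finite_window: "finite (window u j)"
  by (simp add: window_def)

lemma card_window_le: "card (window u j) \<le> k"
  unfolding window_def using card_image_le[of "{..<k}"] by auto

lemma finite_traces: "finite (traces u S)"
  by (simp add: traces_def)

lemma card_trace:
  assumes u: "u \<in> perms V" and P: "P \<in> traces u S"
  shows "card P = card (cover u S)"
proof -
  obtain w where w: "w \<in> perms V" "P = {(i, c) \<in> graph_of w. c \<in> cover u S}"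
    using P by (auto simp: traces_def)
  note pw = perm[OF w(1)]
  have "bij_betw snd P (cover u S)"
    unfolding bij_betw_def
  proof
    show "inj_on snd P" using w pw by (auto simp: inj_on_def graph_of_def nth_eq_iff_index_eq)
    show "snd ` P = cover u S"
    proof
      show "cover u S \<subseteq> snd ` P"
      proof
        fix c assume c: "c \<in> cover u S"
        then have "c \<in> set w" using cover_subset[OF u] pw by auto
        then obtain i where "i < length w" "w ! i = c" by (auto simp: in_set_conv_nth)
        then have "(i, c) \<in> P" using c w by (auto simp: graph_of_def)
        then show "c \<in> snd ` P" by force
      qed
    qed (use w in auto)
  qed
  then show ?thesis by (rule bij_betw_same_card)
qed

lemma card_traces_empty: "card (traces u {}) \<le> 1"
proof -
  have "traces u {} \<subseteq> {{}}" by (auto simp: traces_def cover_def)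
  then show ?thesis using card_mono[of "{{}}" "traces u {}"] by simp
qed

text \<open>To extend a trace by window \<open>j\<close>, choose where the matching window of
  \<open>w\<close> starts and at which offset each vertex sits, the latter in at most
  \<open>k ^ k\<close> ways. If window \<open>j\<close> meets \<open>cover u S\<close>, a common
  vertex has a known position and leaves only \<open>k\<close> starts; otherwise there are at most
  \<open>n\<close>.\<close>

lemma card_traces_insert:
  assumes u: "u \<in> perms V"
  shows "card (traces u (insert j S)) \<le>
    card (traces u S) * ((if window u j \<inter> cover u S = {} then n else k) * k ^ k)"
proof -
  define q where "q = (if window u j \<inter> cover u S = {} then n else k)"
  define c0 where "c0 = (SOME c. c \<in> window u j \<inter> cover u S)"
  have c0: "c0 \<in> window u j" "c0 \<in> cover u S" if "window u j \<inter> cover u S \<noteq> {}"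
    using someI_ex[of "\<lambda>c. c \<in> window u j \<inter> cover u S"] that unfolding c0_def by auto
  define B where "B P = {b. b < n \<and> (window u j \<inter> cover u S = {} \<or> (\<exists>t<k. ((b + t) mod n, c0) \<in> P))}"
    for P :: "(nat \<times> 'a) set"
  define Q where "Q = (window u j \<rightarrow>\<^sub>E {..<k})"
  define ext where "ext P b h = P \<union> (\<lambda>c. ((b + h c) mod n, c)) ` window u j"
    for P :: "(nat \<times> 'a) set" and b and h :: "'a \<Rightarrow> nat"
  have finQ: "finite Q" unfolding Q_def by (intro finite_PiE finite_window) auto
  have cardQ: "card Q \<le> k ^ k"
  proof -
    have "card Q = k ^ card (window u j)" unfolding Q_def by (simp add: card_PiE finite_window)
    also have "\<dots> \<le> k ^ k" using g card_window_le by (intro power_increasing) auto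
    finally show ?thesis .
  qed
  have finB: "finite (B P)" for P by (simp add: B_def)
  have cardB: "card (B P) \<le> q" if P: "P \<in> traces u S" for P
  proof (cases "window u j \<inter> cover u S = {}")
    case True
    have "card (B P) \<le> card {..<n}" by (intro card_mono) (auto simp: B_def)
    then show ?thesis using True by (simp add: q_def)
  next
    case False
    obtain w where w: "w \<in> perms V" "P = {(i, c) \<in> graph_of w. c \<in> cover u S}"
      using P by (auto simp: traces_def)
    note pw = perm[OF w(1)]
    have "c0 \<in> set w" using c0[OF False] cover_subset[OF u] pw by auto
    then obtain i where i: "i < n" "w ! i = c0" using pw by (auto simp: in_set_conv_nth)
    \<comment> \<open>Adding \<open>n - t\<close> subtracts \<open>t\<close> modulo
      \<open>n\<close>; \<open>t < k \<le> n\<close> keeps the natural difference genuine.\<close>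
    have "B P \<subseteq> (\<lambda>t. (i + (n - t)) mod n) ` {..<k}"
    proof
      fix b assume "b \<in> B P"
      then obtain t where b: "b < n" "t < k" "((b + t) mod n, c0) \<in> P" using False by (auto simp: B_def)
      then have "w ! ((b + t) mod n) = c0" using w by (auto simp: graph_of_def)
      then have "(b + t) mod n = i" using i pw n_pos by (metis mod_less_divisor nth_eq_iff_index_eq)
      then have "(i + (n - t)) mod n = (b + t + (n - t)) mod n" by (metis mod_add_left_eq)
      also have "\<dots> = b" using b n by simp
      finally show "b \<in> (\<lambda>t. (i + (n - t)) mod n) ` {..<k}" using b by force
    qed
    then have "card (B P) \<le> card {..<k}" by (intro surj_card_le) auto
    then show ?thesis using False by (simp add: q_def)
  qed
  have "traces u (insert j S) \<subseteq> (\<Union>P\<in>traces u S. \<Union>b\<in>B P. ext P b ` Q)"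
  proof
    fix P' assume "P' \<in> traces u (insert j S)"
    then obtain w where w: "w \<in> perms V" "hits w u (insert j S)"
        "P' = {(i, c) \<in> graph_of w. c \<in> cover u (insert j S)}" by (auto simp: traces_def)
    note pw = perm[OF w(1)]
    define P where "P = {(i, c) \<in> graph_of w. c \<in> cover u S}"
    have P: "P \<in> traces u S" using w by (auto simp: traces_def P_def hits_def)
    obtain i0 where i0: "i0 < M" "window u j = window w i0" using w by (auto simp: hits_def)
    define b where "b = i0 * g"
    have bn: "b < n" using i0 g n by (simp add: b_def)
    have "\<exists>t<k. w ! ((b + t) mod n) = c" if "c \<in> window u j" for c
      using that unfolding i0(2) by (auto simp: window_def b_def)
    then obtain h0 where h0: "\<And>c. c \<in> window u j \<Longrightarrow> h0 c < k \<and> w ! ((b + h0 c) mod n) = c" by metis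
    define h where "h = restrict h0 (window u j)"
    have h: "h c < k" "w ! ((b + h c) mod n) = c" if "c \<in> window u j" for c
      using h0 that by (auto simp: h_def)
    have hQ: "h \<in> Q" using h by (auto simp: Q_def h_def)
    have "P' = ext P b h"
    proof (intro equalityI subsetI)
      fix x assume "x \<in> P'"
      then obtain i c where x: "x = (i, c)" "(i, c) \<in> graph_of w" "c \<in> window u j \<or> c \<in> cover u S"
        using w by (auto simp: cover_def)
      show "x \<in> ext P b h"
      proof (cases "c \<in> window u j")
        case True
        have "i < n" "w ! i = c" using x pw by (auto simp: graph_of_def)
        then have "i = (b + h c) mod n" using h[OF True] pw n_pos
          by (metis mod_less_divisor nth_eq_iff_index_eq)
        then show ?thesis using x True by (auto simp: ext_def)
      qed (use x in \<open>auto simp: ext_def P_def\<close>)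
    next
      fix x assume "x \<in> ext P b h"
      then consider "x \<in> P" | c where "c \<in> window u j" "x = ((b + h c) mod n, c)" by (auto simp: ext_def)
      then show "x \<in> P'"
      proof cases
        case 2
        then have "x \<in> graph_of w" using h[of c] pw n_pos by (auto simp: graph_of_def image_iff)
        then show ?thesis using 2 w by (auto simp: cover_def)
      qed (use w in \<open>auto simp: P_def cover_def\<close>)
    qed
    moreover have "b \<in> B P"
    proof (cases "window u j \<inter> cover u S = {}")
      case False
      have "((b + h c0) mod n, c0) \<in> P"
        using h[OF c0(1)[OF False]] c0(2)[OF False] pw n_pos by (auto simp: P_def graph_of_def image_iff)
      then show ?thesis using bn h[OF c0(1)[OF False]] by (auto simp: B_def)
    qed (use bn in \<open>auto simp: B_def\<close>)
    ultimately show "P' \<in> (\<Union>P\<in>traces u S. \<Union>b\<in>B P. ext P b ` Q)" using P hQ by blast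
  qed
  then have "card (traces u (insert j S)) \<le> card (\<Union>P\<in>traces u S. \<Union>b\<in>B P. ext P b ` Q)"
    using finite_traces finB finQ by (intro card_mono) auto
  also have "\<dots> \<le> (\<Sum>P\<in>traces u S. card (\<Union>b\<in>B P. ext P b ` Q))"
    by (rule card_UN_le[OF finite_traces])
  also have "\<dots> \<le> (\<Sum>P\<in>traces u S. q * k ^ k)"
  proof (rule sum_mono)
    fix P assume P: "P \<in> traces u S"
    have "card (\<Union>b\<in>B P. ext P b ` Q) \<le> (\<Sum>b\<in>B P. card (ext P b ` Q))" by (rule card_UN_le[OF finB])
    also have "\<dots> \<le> (\<Sum>b\<in>B P. k ^ k)"
      by (intro sum_mono order_trans[OF card_image_le[OF finQ] cardQ])
    also have "\<dots> \<le> q * k ^ k" using cardB[OF P] by simp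
    finally show "card (\<Union>b\<in>B P. ext P b ` Q) \<le> q * k ^ k" .
  qed
  also have "\<dots> = card (traces u S) * (q * k ^ k)" by simp
  finally show ?thesis unfolding q_def .
qed

end

section \<open>Weight of a set of common windows\<close>

lemma one_plus_power_eq_sum_Pow:
  fixes x :: real
  assumes "finite J"
  shows "(1 + x) ^ card J = (\<Sum>S\<in>Pow J. x ^ card S)"
  using assms
proof (induction rule: finite_induct)
  case (insert a J)
  have "(\<Sum>S\<in>Pow (insert a J). x ^ card S) = (\<Sum>S\<in>Pow J. x ^ card S) + (\<Sum>S\<in>insert a ` Pow J. x ^ card S)"
    unfolding Pow_insert using insert by (intro sum.union_disjoint) auto
  also have "(\<Sum>S\<in>insert a ` Pow J. x ^ card S) = (\<Sum>S\<in>Pow J. x ^ card (insert a S))"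
    using insert by (subst sum.reindex) (auto simp: inj_on_def)
  also have "\<dots> = (\<Sum>S\<in>Pow J. x * x ^ card S)"
  proof (intro sum.cong refl)
    fix S assume "S \<in> Pow J"
    then have "finite S" "a \<notin> S" using insert finite_subset by auto
    then show "x ^ card (insert a S) = x * x ^ card S" by simp
  qed
  finally show ?case using insert by (simp add: sum_distrib_left sum.distrib algebra_simps)
qed simp

context cyclic_windows
begin

definition hit_weight :: "('a list \<Rightarrow> real) \<Rightarrow> 'a list \<Rightarrow> nat set \<Rightarrow> real" where
  "hit_weight m u S = (\<Sum>w\<in>perms V. of_bool (hits w u S) * m w)"

text \<open>For \<open>\<kappa> = K * exp 1\<close> this dominates
  \<open>hit_weight m u S * (1 / p) ^ card S\<close>. Unlike that weight, it grows by a controlled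
  factor when one window is added to \<open>S\<close>.\<close>

definition trace_bound :: "real \<Rightarrow> real \<Rightarrow> 'a list \<Rightarrow> nat set \<Rightarrow> real" where
  "trace_bound \<kappa> p u S = real (card (traces u S)) * (\<kappa> / n) ^ card (cover u S) * (1 / p) ^ card S"

lemma hit_weight_le:
  assumes u: "u \<in> perms V" and m: "\<And>w. 0 \<le> m w" and K: "0 \<le> K"
    and spread: "spread_bound V K m"
  shows "hit_weight m u S \<le> real (card (traces u S)) * (K * exp 1 / n) ^ card (cover u S)"
proof -
  let ?W = "perms V"
  define v where "v = card (cover u S)"
  have vn: "v \<le> n" unfolding v_def using card_mono[OF V(1) cover_subset[OF u]] V by simp
  have "hit_weight m u S \<le> (\<Sum>w\<in>?W. \<Sum>P\<in>traces u S. of_bool (P \<subseteq> graph_of w) * m w)"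
    unfolding hit_weight_def
  proof (rule sum_mono)
    fix w assume w: "w \<in> ?W"
    show "of_bool (hits w u S) * m w \<le> (\<Sum>P\<in>traces u S. of_bool (P \<subseteq> graph_of w) * m w)"
    proof (cases "hits w u S")
      case True
      define P where "P = {(i, c) \<in> graph_of w. c \<in> cover u S}"
      have "P \<in> traces u S" using True w by (auto simp: traces_def P_def)
      moreover have "P \<subseteq> graph_of w" by (auto simp: P_def)
      ultimately show ?thesis
        using member_le_sum[OF \<open>P \<in> traces u S\<close>, of "\<lambda>P. of_bool (P \<subseteq> graph_of w) * m w"] m finite_traces True
        by auto
    qed (use m in \<open>auto intro: sum_nonneg\<close>)
  qed
  also have "\<dots> = (\<Sum>P\<in>traces u S. \<Sum>w\<in>?W. of_bool (P \<subseteq> graph_of w) * m w)" by (rule sum.swap)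
  also have "\<dots> \<le> (\<Sum>P\<in>traces u S. (K * exp 1 / n) ^ v)"
  proof (rule sum_mono)
    fix P assume P: "P \<in> traces u S"
    have cP: "card P = v" using card_trace[OF u P] by (simp add: v_def)
    have "(\<Sum>w\<in>?W. of_bool (P \<subseteq> graph_of w) * m w) \<le> K ^ card P * (\<Sum>w\<in>?W. of_bool (P \<subseteq> graph_of w)) / fact (card V)"
      using spread unfolding spread_bound_def by blast
    also have "(\<Sum>w\<in>?W. of_bool (P \<subseteq> graph_of w) :: real) = real (card {w \<in> ?W. P \<subseteq> graph_of w})"
      by (simp add: Int_def)
    also have "K ^ card P * real (card {w \<in> ?W. P \<subseteq> graph_of w}) / fact (card V)
       \<le> K ^ v * real (fact (n - v)) / fact n"
    proof -
      have "real (card {w \<in> ?W. P \<subseteq> graph_of w}) \<le> real (fact (n - v))"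
        using card_agreeing_permutations[OF V(1), of P] unfolding V cP by (simp only: of_nat_le_iff)
      then show ?thesis unfolding V cP using K by (intro divide_right_mono mult_left_mono) auto
    qed
    also have "\<dots> = K ^ v * (fact (n - v) / fact n)" by simp
    also have "\<dots> \<le> K ^ v * (exp 1 / n) ^ v"
      using K vn n_pos by (intro mult_left_mono fact_diff_over_fact_le) auto
    also have "\<dots> = (K * exp 1 / n) ^ v" by (simp flip: power_mult_distrib)
    finally show "(\<Sum>w\<in>?W. of_bool (P \<subseteq> graph_of w) * m w) \<le> (K * exp 1 / n) ^ v" .
  qed
  finally show ?thesis by (simp add: v_def)
qed

lemma window_linear:
  assumes "j * g + k \<le> n" "length u = n"
  shows "window u j = (!) u ` {j * g..<j * g + k}"
proof -
  have "window u j = (\<lambda>t. u ! (j * g + t)) ` {..<k}"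
    unfolding window_def using assms by (intro image_cong) auto
  also have "\<dots> = (!) u ` (+) (j * g) ` {0..<k}" unfolding image_image by (simp add: atLeast0LessThan)
  also have "(+) (j * g) ` {0..<k} = {j * g..<j * g + k}" by (simp add: add.commute)
  finally show ?thesis .
qed

end

text \<open>\<open>\<beta>\<close> is the cost of a window that overlaps earlier ones:
  \<open>k\<close> starts, \<open>k ^ k\<close> offsets, at least \<open>g\<close> new vertices
  contributing \<open>1 / n\<close> each, and one edge contributing \<open>1 / p\<close>. The power
  \<open>\<kappa> ^ k\<close> covers the at most \<open>k\<close> new vertices.\<close>

locale window_bounds = cyclic_windows k g n M V for k g n M and V :: "'a set" +
  fixes \<kappa> p \<beta> :: real
  assumes \<kappa>: "1 \<le> \<kappa>" and p: "0 < p" "p \<le> 1"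
    and \<beta>: "real k ^ (k + 1) * \<kappa> ^ k / (p * real n ^ g) \<le> \<beta>"
begin

lemma \<beta>_nonneg: "0 \<le> \<beta>"
proof -
  have "0 \<le> real k ^ (k + 1) * \<kappa> ^ k / (p * real n ^ g)" using \<kappa> p by simp
  then show ?thesis using \<beta> by linarith
qed

lemma trace_bound_nonneg: "0 \<le> trace_bound \<kappa> p u S"
  using \<kappa> p by (simp add: trace_bound_def)

lemma trace_bound_empty: "trace_bound \<kappa> p u {} \<le> 1"
  using card_traces_empty[of u] by (simp add: trace_bound_def cover_def)

text \<open>Windows are added from left to right without wrap-around, so each brings at least
  \<open>g\<close> new vertices. A window disjoint from the earlier ones brings all
  \<open>k \<ge> g + 2\<close>, which outweighs the larger number of starts.\<close>

lemma trace_bound_insert: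
  assumes u: "u \<in> perms V" and S: "finite S" "\<And>i. i \<in> S \<Longrightarrow> i < j"
    and j: "j * g + k \<le> n"
  shows "trace_bound \<kappa> p u (insert j S) \<le> trace_bound \<kappa> p u S * \<beta>"
    and "(\<And>i. i \<in> S \<Longrightarrow> i * g + k \<le> j * g) \<Longrightarrow> trace_bound \<kappa> p u (insert j S) \<le> trace_bound \<kappa> p u S * (\<beta> / n)"
proof -
  note pu = perm[OF u]
  have inju: "inj_on ((!) u) {..<n}" using pu by (auto simp: inj_on_def nth_eq_iff_index_eq)
  have jS: "j \<notin> S" using S by blast
  have wj: "window u j = (!) u ` {j * g..<j * g + k}" using window_linear[OF j] pu by simp
  have step: "i * g + g \<le> j * g" if "i \<in> S" for i
  proof -
    have "(i + 1) * g \<le> j * g" using S(2)[OF that] by (intro mult_le_mono) auto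
    then show ?thesis by simp
  qed
  have wi: "window u i = (!) u ` {i * g..<i * g + k}" if "i \<in> S" for i
    using step[OF that] j by (intro window_linear) (auto simp: pu)
  have cov: "cover u S = (!) u ` (\<Union>i\<in>S. {i * g..<i * g + k})"
    using wi by (auto simp: cover_def)
  have covn: "(\<Union>i\<in>S. {i * g..<i * g + k}) \<subseteq> {..<n}"
    using step j by fastforce
  have sub: "{j * g..<j * g + k} \<subseteq> {..<n}" using j by auto
  define D where "D = {j * g..<j * g + k} - (\<Union>i\<in>S. {i * g..<i * g + k})"
  have cwj: "card (window u j) = k"
    unfolding wj using card_image[OF inj_on_subset[OF inju sub]] by simp
  have diff: "window u j - cover u S = (!) u ` D"
    unfolding wj cov D_def using inj_on_image_set_diff[OF inju, of "{j * g..<j * g + k}" "\<Union>i\<in>S. {i * g..<i * g + k}"] sub covn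
    by auto
  define \<nu> where "\<nu> = card (window u j - cover u S)"
  have fin: "finite (cover u S)" using cover_subset[OF u] V finite_subset by blast
  have cc: "card (cover u (insert j S)) = card (cover u S) + \<nu>"
  proof -
    have "cover u (insert j S) = cover u S \<union> (window u j - cover u S)" by (auto simp: cover_def)
    moreover have "card (cover u S \<union> (window u j - cover u S)) = card (cover u S) + card (window u j - cover u S)"
      by (rule card_Un_disjoint) (use fin finite_window in auto)
    ultimately show ?thesis by (simp only: \<nu>_def)
  qed
  have \<nu>k: "\<nu> \<le> k" unfolding \<nu>_def using card_mono[OF finite_window, of "window u j - cover u S" u j] cwj by auto
  have \<nu>g: "g \<le> \<nu>"
  proof -
    \<comment> \<open>Every earlier window ends at least \<open>g\<close> positions before this
      one.\<close>
    have "{j * g + k - g..<j * g + k} \<subseteq> D"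
      unfolding D_def using step g by fastforce
    then have "(!) u ` {j * g + k - g..<j * g + k} \<subseteq> window u j - cover u S" unfolding diff by blast
    then have "card ((!) u ` {j * g + k - g..<j * g + k}) \<le> \<nu>"
      unfolding \<nu>_def using finite_window by (intro card_mono) auto
    moreover have "card ((!) u ` {j * g + k - g..<j * g + k}) = card {j * g + k - g..<j * g + k}"
      by (rule card_image, rule inj_on_subset[OF inju]) (use j in auto)
    ultimately show ?thesis using g by simp
  qed
  define q where "q = (if window u j \<inter> cover u S = {} then n else k)"
  have ct: "real (card (traces u (insert j S))) \<le> real (card (traces u S)) * (real q * real k ^ k)"
  proof -
    have "card (traces u (insert j S)) \<le> card (traces u S) * (q * k ^ k)"
      unfolding q_def by (rule card_traces_insert[OF u])
    then have "real (card (traces u (insert j S))) \<le> real (card (traces u S) * (q * k ^ k))" by (simp only: of_nat_le_iff)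
    then show ?thesis by simp
  qed
  have gen: "trace_bound \<kappa> p u (insert j S) \<le> trace_bound \<kappa> p u S * (real q * real k ^ k * (\<kappa> / n) ^ \<nu> * (1 / p))"
  proof -
    have "trace_bound \<kappa> p u (insert j S) \<le>
      (real (card (traces u S)) * (real q * real k ^ k)) * (\<kappa> / n) ^ card (cover u (insert j S)) * (1 / p) ^ card (insert j S)"
      unfolding trace_bound_def using ct \<kappa> p by (intro mult_right_mono) auto
    also have "\<dots> = trace_bound \<kappa> p u S * (real q * real k ^ k * (\<kappa> / n) ^ \<nu> * (1 / p))"
      unfolding cc power_add using S jS by (simp add: trace_bound_def)
    finally show ?thesis .
  qed
  have pw: "(\<kappa> / n) ^ \<nu> \<le> \<kappa> ^ k / real n ^ s" if "s \<le> \<nu>" for s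
  proof -
    have "\<kappa> ^ \<nu> \<le> \<kappa> ^ k" using \<kappa> \<nu>k by (intro power_increasing) auto
    moreover have "real n ^ s \<le> real n ^ \<nu>" using n_pos that by (intro power_increasing) auto
    ultimately show ?thesis unfolding power_divide using \<kappa> n_pos by (intro frac_le) auto
  qed
  have second: "real q * real k ^ k * (\<kappa> / n) ^ \<nu> * (1 / p) \<le> \<beta> / n" if dis: "window u j \<inter> cover u S = {}"
  proof -
    have "\<nu> = k" unfolding \<nu>_def using dis cwj by (simp add: Diff_triv)
    have q: "q = n" using dis by (simp add: q_def)
    \<comment> \<open>Two spare powers of \<open>n\<close>: one cancels the choice of the start in
      \<open>w\<close>, the other will pay for the choice of \<open>j\<close>.\<close>
    have "real q * real k ^ k * (\<kappa> / n) ^ \<nu> * (1 / p) \<le> real n * real k ^ k * (\<kappa> ^ k / real n ^ (g + 2)) * (1 / p)"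
      unfolding q by (intro mult_right_mono mult_left_mono pw) (use g p \<open>\<nu> = k\<close> in auto)
    also have "\<dots> = real k ^ k * \<kappa> ^ k / (p * real n ^ g) / n"
      using n_pos p by (simp add: field_simps power_add)
    also have "\<dots> \<le> real k ^ (k + 1) * \<kappa> ^ k / (p * real n ^ g) / n"
      using g \<kappa> p by (intro divide_right_mono mult_right_mono power_increasing) auto
    also have "\<dots> \<le> \<beta> / n" using \<beta> by (intro divide_right_mono) auto
    finally show ?thesis .
  qed
  have first: "real q * real k ^ k * (\<kappa> / n) ^ \<nu> * (1 / p) \<le> \<beta>"
  proof (cases "window u j \<inter> cover u S = {}")
    case True
    have "\<beta> / n \<le> \<beta> / 1" using \<beta>_nonneg n_pos by (intro divide_left_mono) auto
    then show ?thesis using second[OF True] by simp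
  next
    case False
    then have "real q * real k ^ k * (\<kappa> / n) ^ \<nu> * (1 / p) \<le> real k * real k ^ k * (\<kappa> ^ k / real n ^ g) * (1 / p)"
      by (intro mult_mono mult_right_mono mult_left_mono pw \<nu>g) (use p \<kappa> in \<open>auto simp: q_def\<close>)
    also have "\<dots> = real k ^ (k + 1) * \<kappa> ^ k / (p * real n ^ g)" by (simp add: field_simps)
    finally show ?thesis using \<beta> by linarith
  qed
  show "trace_bound \<kappa> p u (insert j S) \<le> trace_bound \<kappa> p u S * \<beta>"
    using gen mult_left_mono[OF first trace_bound_nonneg[of u S]] by linarith
  assume dis: "\<And>i. i \<in> S \<Longrightarrow> i * g + k \<le> j * g"
  have "D = {j * g..<j * g + k}" unfolding D_def using dis by fastforce
  moreover have "card ((!) u ` D) = card D"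
    unfolding D_def by (rule card_image, rule inj_on_subset[OF inju]) (use j in auto)
  ultimately have "card (window u j - cover u S) = card (window u j)" using diff cwj by simp
  then have "window u j - cover u S = window u j" using finite_window by (intro card_subset_eq) auto
  then have "window u j \<inter> cover u S = {}" by blast
  from second[OF this] show "trace_bound \<kappa> p u (insert j S) \<le> trace_bound \<kappa> p u S * (\<beta> / n)"
    using gen mult_left_mono[OF _ trace_bound_nonneg[of u S]] by fastforce
qed

lemma trace_bound_le_power:
  assumes u: "u \<in> perms V" and S: "finite S" "\<And>j. j \<in> S \<Longrightarrow> j * g + k \<le> n"
  shows "trace_bound \<kappa> p u S \<le> \<beta> ^ card S"
  using S
proof (induction S rule: finite_linorder_max_induct)
  case empty
  then show ?case using trace_bound_empty by simp
next
  case (insert j S)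
  have "trace_bound \<kappa> p u (insert j S) \<le> trace_bound \<kappa> p u S * \<beta>"
    using insert by (intro trace_bound_insert(1)[OF u]) auto
  also have "\<dots> \<le> \<beta> ^ card S * \<beta>" using insert \<beta>_nonneg by (intro mult_right_mono) auto
  also have "\<dots> = \<beta> ^ card (insert j S)" using insert by (subst card_insert_disjoint) auto
  finally show ?case .
qed

text \<open>
  Removing the largest index bounds the sum \<open>T\<close> by the term of \<open>{0}\<close> plus \<open>T / 2\<close>: an overlapping next window has fewer than \<open>k\<close>
  possible indices, each of weight \<open>\<beta>\<close>, a disjoint one at most \<open>n\<close>, each of weight \<open>\<beta> / n\<close>.
\<close>

lemma sum_trace_bounds:
  assumes u: "u \<in> perms V" and small: "\<beta> * (real k + 1) \<le> 1 / 2"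
    and m: "\<And>j. j < m \<Longrightarrow> j * g + k \<le> n" "m \<le> n"
  shows "(\<Sum>S | S \<subseteq> {..<m} \<and> 0 \<in> S. trace_bound \<kappa> p u S) \<le> 2 * \<beta> / n"
proof -
  define \<S> where "\<S> = {S. S \<subseteq> {..<m} \<and> 0 \<in> S}"
  have fin: "finite \<S>" by (simp add: \<S>_def)
  have finS: "finite S" if "S \<in> \<S>" for S using that finite_subset by (auto simp: \<S>_def)
  define T where "T = (\<Sum>S\<in>\<S>. trace_bound \<kappa> p u S)"
  define Js where "Js S = {j. j < m \<and> (\<forall>i\<in>S. i < j)}" for S
  \<comment> \<open>The factor \<open>1 / n\<close> of the first window is saved for the sum over
    rotations in \<open>correlation_bound\<close>.\<close>
  have base: "trace_bound \<kappa> p u {0} \<le> \<beta> / n" 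
  proof -
    have "trace_bound \<kappa> p u (insert 0 {}) \<le> trace_bound \<kappa> p u {} * (\<beta> / n)"
      using n by (intro trace_bound_insert(2)[OF u]) auto
    also have "\<dots> \<le> 1 * (\<beta> / n)" using trace_bound_empty \<beta>_nonneg by (intro mult_right_mono) auto
    finally show ?thesis by simp
  qed
  have "T \<le> trace_bound \<kappa> p u {0} + (\<Sum>S\<in>\<S> - {{0}}. trace_bound \<kappa> p u S)"
  proof (cases "{0} \<in> \<S>")
    case True
    then show ?thesis unfolding T_def using sum.remove[OF fin True, of "trace_bound \<kappa> p u"] by simp
  next
    case False
    then show ?thesis unfolding T_def using trace_bound_nonneg[of u "{0}"] by simp
  qed
  also have "(\<Sum>S\<in>\<S> - {{0}}. trace_bound \<kappa> p u S) \<le>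
      (\<Sum>x\<in>(SIGMA S:\<S>. Js S). trace_bound \<kappa> p u (insert (snd x) (fst x)))"
  proof (rule sum_le_included[where i = "\<lambda>x. insert (snd x) (fst x)"])
    show "finite (\<S> - {{0}})" "finite (SIGMA S:\<S>. Js S)" using fin by (auto simp: Js_def)
    show "\<forall>S\<in>\<S> - {{0}}. \<exists>x\<in>SIGMA S:\<S>. Js S. insert (snd x) (fst x) = S \<and>
        trace_bound \<kappa> p u S \<le> trace_bound \<kappa> p u (insert (snd x) (fst x))"
    proof
      fix S assume S: "S \<in> \<S> - {{0}}"
      have fS: "finite S" "S \<noteq> {}" using S finS by (auto simp: \<S>_def)
      define j where "j = Max S"
      have j: "j \<in> S" "\<And>i. i \<in> S \<Longrightarrow> i \<le> j" using fS by (auto simp: j_def)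
      have "j \<noteq> 0"
      proof
        assume "j = 0"
        then have "S \<subseteq> {0}" using j(2) by auto
        then show False using S fS by auto
      qed
      then have "S - {j} \<in> \<S>" using S by (auto simp: \<S>_def)
      moreover have "i < j" if "i \<in> S - {j}" for i using j(2)[of i] that by (simp add: le_neq_implies_less)
      then have "j \<in> Js (S - {j})" using S j(1) by (auto simp: \<S>_def Js_def)
      ultimately have "(S - {j}, j) \<in> (SIGMA S:\<S>. Js S)" by (rule SigmaI)
      then show "\<exists>x\<in>SIGMA S:\<S>. Js S. insert (snd x) (fst x) = S \<and>
        trace_bound \<kappa> p u S \<le> trace_bound \<kappa> p u (insert (snd x) (fst x))"
        using j by (intro bexI[of _ "(S - {j}, j)"]) (auto simp: insert_absorb)
    qed
  qed (use trace_bound_nonneg in auto)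
  also have "\<dots> = (\<Sum>S\<in>\<S>. \<Sum>j\<in>Js S. trace_bound \<kappa> p u (insert j S))"
    using fin by (subst sum.Sigma) (auto simp: Js_def case_prod_unfold)
  also have "\<dots> \<le> (\<Sum>S\<in>\<S>. trace_bound \<kappa> p u S * (\<beta> * (real k + 1)))"
  proof (rule sum_mono)
    fix S assume S: "S \<in> \<S>"
    define a where "a = Max S"
    have "S \<noteq> {}" using S by (auto simp: \<S>_def)
    then have a: "a \<in> S" "\<And>i. i \<in> S \<Longrightarrow> i \<le> a" using finS[OF S] by (simp_all add: a_def)
    have "(\<Sum>j\<in>Js S. trace_bound \<kappa> p u (insert j S)) \<le>
      (\<Sum>j\<in>Js S. trace_bound \<kappa> p u S * (\<beta> * of_bool (j < a + k) + \<beta> / n))"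
    proof (rule sum_mono)
      fix j assume j: "j \<in> Js S"
      then have jm: "j * g + k \<le> n" and Sj: "\<And>i. i \<in> S \<Longrightarrow> i < j" using m by (auto simp: Js_def)
      show "trace_bound \<kappa> p u (insert j S) \<le> trace_bound \<kappa> p u S * (\<beta> * of_bool (j < a + k) + \<beta> / n)"
      \<comment> \<open>From \<open>j = a + k\<close> on, all windows of \<open>S\<close> have
        ended, because \<open>k * g \<ge> k\<close>.\<close>
      proof (cases "j < a + k")
        case True
        have "trace_bound \<kappa> p u (insert j S) \<le> trace_bound \<kappa> p u S * \<beta>"
          by (rule trace_bound_insert(1)[OF u finS[OF S] Sj jm])
        also have "\<dots> \<le> trace_bound \<kappa> p u S * (\<beta> * of_bool (j < a + k) + \<beta> / n)"
          using True \<beta>_nonneg by (intro mult_left_mono trace_bound_nonneg) auto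
        finally show ?thesis .
      next
        case False
        have "i * g + k \<le> j * g" if "i \<in> S" for i
        proof -
          have "i + k \<le> j" using a(2)[OF that] False by simp
          then have "(i + k) * g \<le> j * g" by (intro mult_le_mono) auto
          then have "i * g + k * g \<le> j * g" by (simp only: distrib_right)
          moreover have "k \<le> k * g" using g by simp
          ultimately show ?thesis by linarith
        qed
        from trace_bound_insert(2)[OF u finS[OF S] Sj jm this] False show ?thesis by simp
      qed
    qed
    also have "\<dots> = trace_bound \<kappa> p u S * (\<beta> * real (card {j\<in>Js S. j < a + k}) + real (card (Js S)) * (\<beta> / n))"
      by (simp add: sum_distrib_left[symmetric] sum.distrib Js_def Int_def conj_ac)
    also have "\<dots> \<le> trace_bound \<kappa> p u S * (\<beta> * real k + real n * (\<beta> / n))"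
    proof (intro mult_left_mono add_mono mult_right_mono trace_bound_nonneg \<beta>_nonneg)
      have "{j\<in>Js S. j < a + k} \<subseteq> {a..<a + k}" using a by (auto simp: Js_def order_less_imp_le)
      then show "real (card {j\<in>Js S. j < a + k}) \<le> real k"
        using card_mono[of "{a..<a + k}" "{j\<in>Js S. j < a + k}"] by simp
      have "card (Js S) \<le> card {..<m}" by (intro card_mono) (auto simp: Js_def)
      then show "real (card (Js S)) \<le> real n" using m by simp
      show "0 \<le> \<beta> / n" using \<beta>_nonneg by simp
    qed
    also have "\<dots> = trace_bound \<kappa> p u S * (\<beta> * (real k + 1))" using n_pos by (simp add: algebra_simps)
    finally show "(\<Sum>j\<in>Js S. trace_bound \<kappa> p u (insert j S)) \<le> trace_bound \<kappa> p u S * (\<beta> * (real k + 1))" .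
  qed
  also have "\<dots> = T * (\<beta> * (real k + 1))" unfolding T_def by (rule sum_distrib_right[symmetric])
  also have "\<dots> \<le> T * (1 / 2)"
    using small trace_bound_nonneg by (intro mult_left_mono) (auto simp: T_def intro: sum_nonneg)
  finally have "T \<le> 2 * trace_bound \<kappa> p u {0}" by simp
  also have "\<dots> \<le> 2 * \<beta> / n" using base by simp
  finally show ?thesis by (simp add: T_def \<S>_def)
qed

end

section \<open>Rotations and the total correlation\<close>

context window_bounds
begin

lemma window_rotate:
  assumes "u \<in> perms V"
  shows "window (rotate (a * g) u) i = window u ((i + a) mod M)"
proof -
  have "rotate (a * g) u ! ((i * g + t) mod n) = u ! (((i + a) mod M * g + t) mod n)" for t
  proof -
    have "rotate (a * g) u ! ((i * g + t) mod n) = u ! ((a * g + (i * g + t) mod n) mod n)"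
      using perm[OF assms] n_pos by (simp add: nth_rotate)
    also have "(a * g + (i * g + t) mod n) mod n = ((i + a) * g + t) mod n"
      by (simp add: mod_add_right_eq algebra_simps)
    also have "\<dots> = (((i + a) * g) mod n + t) mod n" by (simp add: mod_add_left_eq)
    also have "((i + a) * g) mod n = (i + a) mod M * g" unfolding n by (rule mult_mod_left[symmetric])
    finally show ?thesis .
  qed
  then show ?thesis by (simp add: window_def)
qed

lemma rotate_permutation: "u \<in> perms V \<Longrightarrow> rotate a u \<in> perms V"
  by (simp add: permutations_of_set_def)

lemma shift_index: "j < M \<Longrightarrow> a < M \<Longrightarrow> ((j + M - a) mod M + a) mod M = j"
  by (simp add: mod_add_left_eq)

text \<open>
  An uncovered position exists by counting; rotate to the first window of \<open>S\<close> behind it.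
\<close>

lemma gap_exists:
  assumes S: "S \<subseteq> {..<M}" "S \<noteq> {}" "k * card S < n"
  shows "\<exists>a\<in>S. \<forall>j\<in>S. ((j + M - a) mod M) * g + k \<le> n"
proof -
  have finS: "finite S" using S finite_subset by blast
  define W where "W = (\<Union>j\<in>S. (\<lambda>t. (j * g + t) mod n) ` {..<k})"
  have "card W \<le> (\<Sum>j\<in>S. card ((\<lambda>t. (j * g + t) mod n) ` {..<k}))"
    unfolding W_def by (rule card_UN_le[OF finS])
  also have "\<dots> \<le> (\<Sum>j\<in>S. k)" 
  proof (rule sum_mono)
    fix j
    show "card ((\<lambda>t. (j * g + t) mod n) ` {..<k}) \<le> k"
      using card_image_le[of "{..<k}" "\<lambda>t. (j * g + t) mod n"] by simp
  qed
  also have "\<dots> < n" using S(3) by (simp add: mult.commute)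
  finally have "card W < card {..<n}" by simp
  moreover have "W \<subseteq> {..<n}" using n_pos by (auto simp: W_def)
  ultimately obtain q where q: "q < n" "q \<notin> W" by (metis lessThan_iff less_irrefl subsetI subset_antisym)
  \<comment> \<open>Forward cyclic distance from the uncovered position \<open>q\<close> to the
    start of window \<open>j\<close>. A window with \<open>D j + k > n\<close> would run through
    \<open>q\<close>.\<close>
  define D where "D j = (j * g + n - q) mod n" for j
  have D: "D j + k \<le> n" if j: "j \<in> S" for j
  proof (rule ccontr)
    assume "\<not> D j + k \<le> n"
    moreover have Dn: "D j < n" using n_pos by (simp add: D_def)
    ultimately have nd: "n - D j < k" by simp
    define t where "t = (if D j = 0 then 0 else n - D j)"
    have t: "t < k" "(D j + t) mod n = 0" using nd Dn g by (auto simp: t_def)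
    have "(j * g + n - q) + t + q = (j * g + t) + n" using q by simp
    then have "(j * g + t) mod n = ((j * g + n - q) + t + q) mod n" by (simp only: mod_add_self2)
    also have "\<dots> = ((D j + t) mod n + q) mod n" unfolding D_def by (simp add: mod_add_left_eq) 
    also have "\<dots> = q" using t q by simp
    finally have "q \<in> W" using t j by (auto simp: W_def intro!: bexI[of _ j] rev_image_eqI[of t])
    then show False using q by simp
  qed
  \<comment> \<open>The window of \<open>S\<close> that comes first after \<open>q\<close>. Relative
    to it, window \<open>j\<close> starts at distance \<open>D j - D a\<close>, without
    wrap-around.\<close>
  define a where "a = (ARG_MIN D j. j \<in> S)"
  have a: "a \<in> S" "\<And>j. j \<in> S \<Longrightarrow> D a \<le> D j"
    using S(2) unfolding a_def by (auto intro: arg_min_natI arg_min_nat_le)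
  have "((j + M - a) mod M) * g + k \<le> n" if j: "j \<in> S" for j
  proof -
    have jM: "j < M" "a < M" using j a S by auto
    then have "a * g \<le> M * g" by (intro mult_le_mono) auto
    then have ag: "a * g \<le> n" by (simp add: n)
    define X where "X = (j + M - a) * g"
    have X: "X = j * g + n - a * g" unfolding X_def n using jM by (simp add: diff_mult_distrib add_mult_distrib)
    have "(X + D a) mod n = (X + (a * g + n - q)) mod n" unfolding D_def by (rule mod_add_right_eq)
    also have "X + (a * g + n - q) = (j * g + n - q) + n" using X ag q by simp
    also have "\<dots> mod n = D j" by (simp add: D_def)
    finally have XD: "(X + D a) mod n = D j" .
    have "X + D a = n * ((X + D a) div n) + D j" using XD mult_div_mod_eq[of n "X + D a"] by simp
    then have "X = n * ((X + D a) div n) + (D j - D a)" using a(2)[OF j] by simp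
    then have "X mod n = (D j - D a) mod n" by (metis mod_mult_self4)
    also have "\<dots> = D j - D a" using D[OF j] g by simp
    finally have "X mod n = D j - D a" .
    moreover have "((j + M - a) mod M) * g = X mod n" unfolding X_def n by (rule mult_mod_left)
    ultimately show ?thesis using D[OF j] by simp
  qed
  then show ?thesis using a(1) by blast
qed

text \<open>
  Sets \<open>S\<close> of windows leaving a gap are rotated so that no window wraps around. The remaining sets have at least \<open>n / k\<close> elements,
  and a crude bound suffices for them.
\<close>

lemma correlation_bound:
  assumes u: "u \<in> perms V" and m: "\<And>w. 0 \<le> m w" "(\<Sum>w\<in>perms V. m w) = 1"
    and K: "\<kappa> = K * exp 1" "1 \<le> K"
    and spread: "spread_bound V K m"
    and small: "\<beta> * (real k + 1) \<le> 1 / 2" "\<beta> \<le> (1 / 4) ^ k" and pn: "1 / p \<le> real n ^ g"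
  shows "(\<Sum>w\<in>perms V. m w * (1 / p) ^ card (window w ` {..<M} \<inter> window u ` {..<M}))
    \<le> 1 + (2 * \<beta> + 2 ^ n * ((real n ^ g) ^ k * (1 / 4) ^ (n - k * k)))"
proof -
  let ?W = "perms V"
  have p1: "1 \<le> 1 / p" using p by simp
  have hit: "hit_weight m v S * (1 / p) ^ card S \<le> trace_bound \<kappa> p v S" if "v \<in> ?W" for v S
    using hit_weight_le[OF that m(1) _ spread, of S] K p unfolding trace_bound_def
    by (intro mult_right_mono) auto
  have MN: "M \<le> n" using n g by simp
  define f where "f S = hit_weight m u S * (1 / p) ^ card S" for S
  have f0: "0 \<le> f S" for S using m p by (auto simp: f_def hit_weight_def intro!: mult_nonneg_nonneg sum_nonneg)
  have "(\<Sum>w\<in>?W. m w * (1 / p) ^ card (window w ` {..<M} \<inter> window u ` {..<M}))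
     \<le> (\<Sum>w\<in>?W. \<Sum>S\<in>Pow {..<M}. of_bool (hits w u S) * m w * (1 / p) ^ card S)"
  proof (rule sum_mono)
    fix w
    define J where "J = {j. j < M \<and> window u j \<in> window w ` {..<M}}"
    have J: "finite J" "J \<subseteq> {..<M}" by (auto simp: J_def)
    have "window w ` {..<M} \<inter> window u ` {..<M} = window u ` J" by (auto simp: J_def)
    then have "card (window w ` {..<M} \<inter> window u ` {..<M}) \<le> card J" using card_image_le[OF J(1)] by simp
    then have "(1 / p) ^ card (window w ` {..<M} \<inter> window u ` {..<M}) \<le> (1 / p) ^ card J"
      using p1 by (intro power_increasing) auto
    \<comment> \<open>Expands \<open>(1 + (1 / p - 1)) ^ card J\<close> over the subsets of
      \<open>J\<close>, which are the sets hit by \<open>w\<close>. Enlarging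
      \<open>1 / p - 1\<close> to \<open>1 / p\<close> afterwards does not affect the empty set,
      whose term is the main term 1.\<close>
    also have "\<dots> = (\<Sum>S\<in>Pow J. (1 / p - 1) ^ card S)"
      using one_plus_power_eq_sum_Pow[OF J(1), of "1 / p - 1"] by simp
    also have "\<dots> \<le> (\<Sum>S\<in>Pow J. (1 / p) ^ card S)"
      using p1 by (intro sum_mono power_mono) auto
    also have "\<dots> = (\<Sum>S\<in>Pow J. of_bool (hits w u S) * (1 / p) ^ card S)"
      by (intro sum.cong refl) (auto simp: hits_def J_def)
    also have "\<dots> \<le> (\<Sum>S\<in>Pow {..<M}. of_bool (hits w u S) * (1 / p) ^ card S)"
      using J p by (intro sum_mono2) auto
    finally have "m w * (1 / p) ^ card (window w ` {..<M} \<inter> window u ` {..<M}) \<le>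
      m w * (\<Sum>S\<in>Pow {..<M}. of_bool (hits w u S) * (1 / p) ^ card S)" using m(1) by (rule mult_left_mono)
    then show "m w * (1 / p) ^ card (window w ` {..<M} \<inter> window u ` {..<M}) \<le>
      (\<Sum>S\<in>Pow {..<M}. of_bool (hits w u S) * m w * (1 / p) ^ card S)"
      by (simp only: sum_distrib_left mult.left_commute[of "m w"] mult.assoc)
  qed
  also have "\<dots> = (\<Sum>S\<in>Pow {..<M}. f S)"
    unfolding f_def hit_weight_def sum_distrib_right by (rule sum.swap)
  also have "\<dots> = f {} + (\<Sum>S\<in>Pow {..<M} - {{}}. f S)"
    by (rule sum.remove) auto
  also have "f {} = 1" using m by (simp add: f_def hit_weight_def hits_def)
  finally have main: "(\<Sum>w\<in>?W. m w * (1 / p) ^ card (window w ` {..<M} \<inter> window u ` {..<M}))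
    \<le> 1 + (\<Sum>S\<in>Pow {..<M} - {{}}. f S)" .
  define G where "G = {S. S \<subseteq> {..<M} \<and> S \<noteq> {} \<and> (\<exists>a\<in>S. \<forall>j\<in>S. ((j + M - a) mod M) * g + k \<le> n)}"
  define B where "B = Pow {..<M} - {{}} - G"
  have split: "(\<Sum>S\<in>Pow {..<M} - {{}}. f S) = (\<Sum>S\<in>G. f S) + (\<Sum>S\<in>B. f S)"
  proof -
    have "Pow {..<M} - {{}} = G \<union> B" "G \<inter> B = {}" "finite G" "finite B" by (auto simp: G_def B_def)
    then show ?thesis by (simp add: sum.union_disjoint)
  qed
  define L where "L = (n - k) div g + 1"
  have L: "j < L \<longleftrightarrow> j * g + k \<le> n" for j
  proof -
    have "j < L \<longleftrightarrow> j \<le> (n - k) div g" by (auto simp: L_def)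
    also have "\<dots> \<longleftrightarrow> j * g \<le> n - k" using g by (simp add: less_eq_div_iff_mult_less_eq)
    finally show ?thesis using n by auto
  qed
  have LM: "L \<le> n"
  proof -
    have "(n - k) div g \<le> n - k" by (rule div_le_dividend)
    then show ?thesis using g n unfolding L_def by linarith
  qed
  have good: "(\<Sum>S\<in>G. f S) \<le> 2 * \<beta>"
  proof -
    have "(\<Sum>S\<in>G. f S) \<le> (\<Sum>x\<in>{..<M} \<times> {S. S \<subseteq> {..<L} \<and> 0 \<in> S}. trace_bound \<kappa> p (rotate (fst x * g) u) (snd x))"
    \<comment> \<open>A set may arise from several pairs of a rotation and a rotated set; the terms
      are nonnegative, so overcounting is harmless.\<close>
    proof (rule sum_le_included[where i = "\<lambda>x. (\<lambda>i. (i + fst x) mod M) ` snd x"])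
      show "finite G" by (simp add: G_def)
      show "finite ({..<M} \<times> {S. S \<subseteq> {..<L} \<and> 0 \<in> S})" by simp
      show "\<forall>S\<in>G. \<exists>x\<in>{..<M} \<times> {S. S \<subseteq> {..<L} \<and> 0 \<in> S}. (\<lambda>i. (i + fst x) mod M) ` snd x = S \<and>
          f S \<le> trace_bound \<kappa> p (rotate (fst x * g) u) (snd x)"
      proof
        fix S assume "S \<in> G"
        then obtain a where S: "S \<subseteq> {..<M}" and a: "a \<in> S" "\<And>j. j \<in> S \<Longrightarrow> ((j + M - a) mod M) * g + k \<le> n"
          by (auto simp: G_def)
        have aM: "a < M" using a S by auto
        define v where "v = rotate (a * g) u"
        have v: "v \<in> ?W" unfolding v_def by (rule rotate_permutation[OF u])
        define S' where "S' = (\<lambda>j. (j + M - a) mod M) ` S"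
        have unshift: "((j + M - a) mod M + a) mod M = j" if "j \<in> S" for j
          using shift_index that S aM by auto
        have im: "(\<lambda>i. (i + a) mod M) ` S' = S" unfolding S'_def image_image using unshift by force
        have cS: "card S' = card S"
          unfolding S'_def by (rule card_image, rule inj_on_inverseI[of _ "\<lambda>i. (i + a) mod M"]) (rule unshift)
        have win: "window v ((j + M - a) mod M) = window u j" if "j \<in> S" for j
          unfolding v_def window_rotate[OF u] unshift[OF that] ..
        have "hits w u S = hits w v S'" for w using win by (auto simp: hits_def S'_def)
        then have "f S = hit_weight m v S' * (1 / p) ^ card S'" by (simp add: f_def hit_weight_def cS)
        also have "\<dots> \<le> trace_bound \<kappa> p v S'" by (rule hit[OF v])
        finally have "f S \<le> trace_bound \<kappa> p v S'" .
        moreover have "S' \<subseteq> {..<L}" using a(2) L by (auto simp: S'_def)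
        moreover have "0 \<in> S'" unfolding S'_def using a(1) aM by (intro rev_image_eqI[of a]) auto
        ultimately show "\<exists>x\<in>{..<M} \<times> {S. S \<subseteq> {..<L} \<and> 0 \<in> S}. (\<lambda>i. (i + fst x) mod M) ` snd x = S \<and>
          f S \<le> trace_bound \<kappa> p (rotate (fst x * g) u) (snd x)"
          using aM im by (intro bexI[of _ "(a, S')"]) (auto simp: v_def)
      qed
    qed (use trace_bound_nonneg in auto)
    also have "\<dots> = (\<Sum>a<M. \<Sum>S | S \<subseteq> {..<L} \<and> 0 \<in> S. trace_bound \<kappa> p (rotate (a * g) u) S)"
      by (simp add: sum.cartesian_product case_prod_unfold)
    also have "\<dots> \<le> (\<Sum>a<M. 2 * \<beta> / n)"
      using L LM by (intro sum_mono sum_trace_bounds rotate_permutation u small) auto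
    also have "\<dots> = real M * (2 * \<beta> / n)" by simp
    also have "\<dots> \<le> real n * (2 * \<beta> / n)" using MN \<beta>_nonneg by (intro mult_right_mono) auto
    also have "\<dots> = 2 * \<beta>" using n_pos by simp
    finally show ?thesis .
  qed
  have bad: "(\<Sum>S\<in>B. f S) \<le> 2 ^ n * ((real n ^ g) ^ k * (1 / 4) ^ (n - k * k))"
  proof -
    have "f S \<le> (real n ^ g) ^ k * (1 / 4) ^ (n - k * k)" if S: "S \<in> B" for S
    proof -
      have SM: "S \<subseteq> {..<M}" "S \<noteq> {}" "S \<notin> G" using S by (auto simp: B_def)
      have finS: "finite S" using SM finite_subset by blast
      have big: "n \<le> k * card S"
        using gap_exists[OF SM(1,2)] SM by (force simp: G_def)
      \<comment> \<open>Windows that wrap around are dropped. Their indices are within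
        \<open>k\<close> of \<open>M\<close>, so there are at most \<open>k\<close> of them, each
        costing a factor \<open>1 / p \<le> n ^ g\<close>.\<close>
      define S1 where "S1 = {j\<in>S. j * g + k \<le> n}"
      have fin1: "finite S1" using finS by (simp add: S1_def)
      have "S - S1 \<subseteq> {M - k..<M}"
      proof
        fix j assume "j \<in> S - S1"
        then have j: "j < M" "n < j * g + k" using SM by (auto simp: S1_def)
        have "\<not> j + k < M"
        proof
          assume "j + k < M"
          then have "(j + k) * g \<le> M * g" by (intro mult_le_mono) auto
          then have "j * g + k * g \<le> n" by (simp only: distrib_right n)
          moreover have "k \<le> k * g" using g by simp
          ultimately show False using j by linarith
        qed
        then show "j \<in> {M - k..<M}" using j by auto
      qed
      then have "card (S - S1) \<le> card {M - k..<M}" by (intro card_mono) auto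
      then have "card (S - S1) \<le> k" by simp
      moreover have "card S = card S1 + card (S - S1)"
        using card_Un_disjoint[of S1 "S - S1"] finS fin1 by (auto simp: S1_def Un_absorb1 intro!: arg_cong[where f = card])
      ultimately have c: "card S \<le> card S1 + k" by simp
      have "hit_weight m u S \<le> hit_weight m u S1"
        unfolding hit_weight_def using m(1) by (intro sum_mono mult_right_mono) (auto simp: hits_def S1_def)
      then have "f S \<le> hit_weight m u S1 * (1 / p) ^ (card S1 + k)"
        unfolding f_def using p p1 c m(1)
        by (intro mult_mono power_increasing) (auto simp: hit_weight_def intro!: sum_nonneg)
      also have "\<dots> = (hit_weight m u S1 * (1 / p) ^ card S1) * (1 / p) ^ k" by (simp add: power_add)
      also have "\<dots> \<le> trace_bound \<kappa> p u S1 * (1 / p) ^ k"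
        using hit[OF u] p by (intro mult_right_mono) auto
      also have "\<dots> \<le> \<beta> ^ card S1 * (real n ^ g) ^ k"
        using trace_bound_le_power[OF u fin1] pn p \<beta>_nonneg by (intro mult_mono power_mono) (auto simp: S1_def)
      \<comment> \<open>\<open>\<beta> \<le> (1 / 4) ^ k\<close> and
        \<open>n \<le> k * card S\<close> make each term of order \<open>(1 / 4) ^ n\<close> up to a
        polynomial factor, enough against at most \<open>2 ^ n\<close> sets.\<close>
      also have "\<beta> ^ card S1 \<le> ((1 / 4) ^ k) ^ card S1" using small \<beta>_nonneg by (intro power_mono) auto
      also have "((1 / 4) ^ k) ^ card S1 = (1 / 4 :: real) ^ (k * card S1)" by (simp add: power_mult)
      also have "\<dots> \<le> (1 / 4) ^ (n - k * k)"
      proof (intro power_decreasing)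
        have "k * card S \<le> k * (card S1 + k)" using c by (intro mult_le_mono) auto
        then have "k * card S \<le> k * card S1 + k * k" by (simp only: distrib_left)
        then show "n - k * k \<le> k * card S1" using big by linarith
      qed auto
      finally show ?thesis by (simp add: mult.commute mult_right_mono)
    qed
    then have "(\<Sum>S\<in>B. f S) \<le> (\<Sum>S\<in>B. (real n ^ g) ^ k * (1 / 4) ^ (n - k * k))" by (rule sum_mono)
    also have "\<dots> = real (card B) * ((real n ^ g) ^ k * (1 / 4) ^ (n - k * k))" by simp
    also have "\<dots> \<le> 2 ^ n * ((real n ^ g) ^ k * (1 / 4) ^ (n - k * k))"
    proof (intro mult_right_mono)
      have "card B \<le> card (Pow {..<M})" by (intro card_mono) (auto simp: B_def)
      also have "\<dots> = 2 ^ M" by (simp add: card_Pow)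
      also have "\<dots> \<le> 2 ^ n" using MN by (intro power_increasing) auto
      finally have "real (card B) \<le> real (2 ^ n)" by (simp only: of_nat_le_iff)
      then show "real (card B) \<le> 2 ^ n" by simp
    qed simp
    finally show ?thesis .
  qed
  show ?thesis using main split good bad by linarith
qed

end

section \<open>Hamilton cycles in the random subhypergraph\<close>

lemma power_le_binomial_fact: "(m - r) ^ r \<le> (m choose r) * fact r"
proof (induction r)
  case (Suc r)
  have "(m - Suc r) ^ Suc r \<le> (m - r) ^ r * (m - r)"
    unfolding power_Suc2 by (intro mult_le_mono power_mono) auto
  also have "\<dots> \<le> (m choose r) * fact r * (m - r)" by (intro mult_le_mono Suc.IH order_refl)
  also have "\<dots> = ((m - r) * (m choose r)) * fact r" by simp
  also have "(m - r) * (m choose r) = Suc r * (m choose Suc r)"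
    by (simp only: binomial_absorb_comp binomial_absorption)
  also have "\<dots> * fact r = (m choose Suc r) * fact (Suc r)"
    by (simp only: fact_Suc of_nat_id mult_ac)
  finally show ?case .
qed simp

text \<open>Of the edges containing \<open>D\<close>, only those whose remainder meets
  \<open>set x\<close> are lost, at most \<open>n ^ (k - d - 1)\<close> for each of the at most
  \<open>l\<close> vertices.\<close>

lemma link_lower_bound:
  assumes H: "uniform_hypergraph k H" "card (verts H) = n" and dk: "d < k"
    and x: "set x \<subseteq> verts H" "length x = l" and D: "D \<subseteq> verts H" "card D = d"
  shows "real (min_degree d H) - real l * real n ^ (k - d - 1)
    \<le> real (card (link (edges H) D (verts H - set x) (k - d)))"
proof -
  define V where "V = verts H"
  define r where "r = k - d"
  have fin: "finite V" using H by (simp add: uniform_hypergraph_def V_def)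
  have finD: "finite D" using D fin finite_subset by (auto simp: V_def)
  have finlink: "finite (link (edges H) D A r)" if "A \<subseteq> V" for A
  proof (rule finite_subset)
    show "link (edges H) D A r \<subseteq> Pow V" using that by (auto simp: link_def)
  qed (use fin in simp)
  have "min_degree d H \<le> card {e \<in> edges H. D \<subseteq> e}"
    unfolding min_degree_def
  proof (rule Min_le)
    show "finite ((\<lambda>D. card {e \<in> edges H. D \<subseteq> e}) ` {D. D \<subseteq> verts H \<and> card D = d})"
      using fin by (simp add: V_def)
  qed (use D in auto)
  also have "\<dots> \<le> card (link (edges H) D V r)"
  proof (rule card_inj_on_le[where f = "\<lambda>e. e - D"])
    show "inj_on (\<lambda>e. e - D) {e \<in> edges H. D \<subseteq> e}" by (auto simp: inj_on_def)
    show "(\<lambda>e. e - D) ` {e \<in> edges H. D \<subseteq> e} \<subseteq> link (edges H) D V r"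
    proof (rule image_subsetI)
      fix e assume e: "e \<in> {e \<in> edges H. D \<subseteq> e}"
      then have "e \<subseteq> V" "card e = k" using H by (auto simp: uniform_hypergraph_def V_def)
      moreover have "card (e - D) = card e - card D" using e finD by (intro card_Diff_subset) auto
      moreover have "e - D \<union> D = e" using e by auto
      ultimately show "e - D \<in> link (edges H) D V r" using D e by (auto simp: link_def r_def)
    qed
  qed (use finlink in auto)
  also have "link (edges H) D V r \<subseteq> link (edges H) D (V - set x) r \<union> (\<Union>v\<in>set x. {R. R \<subseteq> V \<and> card R = r \<and> v \<in> R})"
    by (auto simp: link_def)
  then have "card (link (edges H) D V r) \<le>
      card (link (edges H) D (V - set x) r \<union> (\<Union>v\<in>set x. {R. R \<subseteq> V \<and> card R = r \<and> v \<in> R}))"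
    by (rule card_mono[rotated]) (use fin finlink in auto)
  also have "\<dots> \<le> card (link (edges H) D (V - set x) r) + card (\<Union>v\<in>set x. {R. R \<subseteq> V \<and> card R = r \<and> v \<in> R})"
    by (rule card_Un_le)
  also have "card (\<Union>v\<in>set x. {R. R \<subseteq> V \<and> card R = r \<and> v \<in> R}) \<le> (\<Sum>v\<in>set x. card {R. R \<subseteq> V \<and> card R = r \<and> v \<in> R})"
    by (rule card_UN_le) simp
  also have "\<dots> \<le> (\<Sum>v\<in>set x. n ^ (r - 1))"
  proof (rule sum_mono)
    fix v assume "v \<in> set x"
    then show "card {R. R \<subseteq> V \<and> card R = r \<and> v \<in> R} \<le> n ^ (r - 1)"
      using card_subsets_containing_le[of V v r] fin x H by (auto simp: V_def)
  qed
  also have "\<dots> = card (set x) * n ^ (r - 1)" by simp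
  also have "\<dots> \<le> l * n ^ (r - 1)" using x card_length[of x] by (intro mult_le_mono) auto
  finally have "min_degree d H \<le> card (link (edges H) D (V - set x) r) + l * n ^ (r - 1)" by simp
  then have "real (min_degree d H) \<le> real (card (link (edges H) D (V - set x) r) + l * n ^ (r - 1))"
    by (simp only: of_nat_le_iff)
  then show ?thesis by (simp add: V_def r_def)
qed

text \<open>Replaces the binomial coefficient by a power. The difference, and the completions lost
  to \<open>x\<close>, are of lower order and are absorbed by a quarter of \<alpha>.\<close>

lemma eventually_degree_at_least:
  fixes \<delta> \<alpha> :: real
  assumes dk: "d < k" and \<alpha>: "0 \<le> \<delta>" "0 < \<alpha>"
  shows "\<forall>\<^sub>F n in sequentially. \<forall>(H :: 'a hypergraph) x. uniform_hypergraph k H \<longrightarrow> card (verts H) = n \<longrightarrow>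
     (\<delta> + \<alpha>) * real ((n - d) choose (k - d)) \<le> real (min_degree d H) \<longrightarrow> set x \<subseteq> verts H \<longrightarrow> length x = l \<longrightarrow>
     degree_at_least (edges H) (verts H) (verts H - set x) d (k - d) ((\<delta> + 3 * \<alpha> / 4) / fact (k - d))"
proof -
  define r where "r = k - d"
  define c where "c = (\<delta> + 3 * \<alpha> / 4) / fact r"
  have r: "0 < r" using dk by (simp add: r_def)
  have "(\<lambda>n. 1 - real k / real n) \<longlonglongrightarrow> 1" by real_asymp
  then have 1: "(\<lambda>n. (\<delta> + \<alpha>) / fact r * (1 - real k / real n) ^ r) \<longlonglongrightarrow> (\<delta> + \<alpha>) / fact r * 1 ^ r"
    by (intro tendsto_intros)
  have 2: "(\<lambda>n. real l / real n) \<longlonglongrightarrow> 0" by real_asymp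
  have "c < (\<delta> + \<alpha>) / fact r * 1 ^ r - 0" using \<alpha> by (simp add: c_def divide_strict_right_mono)
  then have "\<forall>\<^sub>F n in sequentially. c < (\<delta> + \<alpha>) / fact r * (1 - real k / real n) ^ r - real l / real n"
    by (rule order_tendstoD(1)[OF tendsto_diff[OF 1 2]])
  then show ?thesis using eventually_ge_at_top[of "k + l + 1"]
  proof eventually_elim
    case (elim n)
    have n: "0 < n" "k \<le> n" using elim by auto
    have "c * real n ^ r \<le> ((\<delta> + \<alpha>) / fact r * (1 - real k / real n) ^ r - real l / real n) * real n ^ r"
      using elim by (intro mult_right_mono) auto
    also have "\<dots> = (\<delta> + \<alpha>) / fact r * ((1 - real k / real n) * real n) ^ r - real l * real n ^ (r - 1)"
    proof -
      have "real l / real n * real n ^ r = real l * real n ^ (r - 1)" using n r by (cases r) auto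
      then show ?thesis unfolding left_diff_distrib[of "(\<delta> + \<alpha>) / fact r * (1 - real k / real n) ^ r"]
        by (simp only: power_mult_distrib mult.assoc)
    qed
    also have "(1 - real k / real n) * real n = real (n - d - r)"
      using n dk by (simp add: r_def field_simps of_nat_diff)
    also have "(\<delta> + \<alpha>) / fact r * real (n - d - r) ^ r \<le> (\<delta> + \<alpha>) * real ((n - d) choose r)"
    proof -
      have "real ((n - d - r) ^ r) \<le> real ((n - d choose r) * fact r)"
        using power_le_binomial_fact[of "n - d" r] by (simp only: of_nat_le_iff)
      then have "real (n - d - r) ^ r / fact r \<le> real ((n - d) choose r)" by (simp add: field_simps)
      then have "(\<delta> + \<alpha>) * (real (n - d - r) ^ r / fact r) \<le> (\<delta> + \<alpha>) * real ((n - d) choose r)"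
        using \<alpha> by (intro mult_left_mono) auto
      then show ?thesis by simp
    qed
    finally have key: "c * real n ^ r \<le> (\<delta> + \<alpha>) * real ((n - d) choose r) - real l * real n ^ (r - 1)" by simp
    show ?case
    proof (intro allI impI)
      fix H :: "'a hypergraph" and x
      assume H: "uniform_hypergraph k H" "card (verts H) = n"
        and deg: "(\<delta> + \<alpha>) * real ((n - d) choose (k - d)) \<le> real (min_degree d H)"
        and x: "set x \<subseteq> verts H" "length x = l"
      show "degree_at_least (edges H) (verts H) (verts H - set x) d (k - d) ((\<delta> + 3 * \<alpha> / 4) / fact (k - d))"
        unfolding degree_at_least_def
      proof (intro allI impI)
        fix D assume D: "D \<subseteq> verts H" "card D = d"
        have "card (verts H - set x) \<le> n"
          using H card_mono[of "verts H" "verts H - set x"] by (auto simp: uniform_hypergraph_def)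
        then have "c * real (card (verts H - set x)) ^ r \<le> c * real n ^ r"
          using \<alpha> by (intro mult_left_mono power_mono) (auto simp: c_def)
        also have "\<dots> \<le> real (card (link (edges H) D (verts H - set x) r))"
          using link_lower_bound[OF H dk x D] key deg by (simp add: r_def)
        finally show "(\<delta> + 3 * \<alpha> / 4) / fact (k - d) * real (card (verts H - set x)) ^ (k - d)
            \<le> real (card (link (edges H) D (verts H - set x) (k - d)))" by (simp add: c_def r_def)
      qed
    qed
  qed
qed

context cyclic_windows
begin

text \<open>The last window starts at \<open>n - g\<close> and ends at \<open>n + l\<close>, so
  appending the first \<open>l\<close> entries turns all \<open>M\<close> cyclic windows into linear
  ones.\<close>

lemma window_closed:
  assumes w: "w \<in> perms V" and l: "g + l = k" and j: "j < M"
  shows "set (take k (drop (j * g) (w @ take l w))) = window w j"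
proof -
  have len: "length w = n" using perm[OF w] by simp
  have ln: "l \<le> n" using l n by simp
  have "(j + 1) * g \<le> M * g" using j by (intro mult_le_mono) auto
  then have le: "j * g + k \<le> n + l" using l n by simp
  then have "set (take k (drop (j * g) (w @ take l w))) = (!) (w @ take l w) ` {j * g..<j * g + k}"
    using len ln by (intro set_window) simp
  also have "{j * g..<j * g + k} = (+) (j * g) ` {0..<k}" by (simp add: add.commute)
  also have "(!) (w @ take l w) ` (+) (j * g) ` {0..<k} = window w j"
    unfolding window_def image_image atLeast0LessThan
  proof (rule image_cong[OF refl])
    fix t assume t: "t \<in> {..<k}"
    show "(w @ take l w) ! (j * g + t) = w ! ((j * g + t) mod n)"
    proof (cases "j * g + t < n")
      case True
      then show ?thesis using len by (simp add: nth_append)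
    next
      case False
      then have "(j * g + t) mod n = j * g + t - n" using t le ln n by (simp add: mod_if)
      then show ?thesis using False len t le by (simp add: nth_append)
    qed
  qed
  finally show ?thesis .
qed

lemma Hamilton_cycle_of_windows:
  assumes w: "w \<in> perms V" and l: "g + l = k"
    and E: "window w ` {..<M} \<subseteq> E"
  shows "has_Hamilton_ell_cycle k l \<lparr>verts = V, edges = E\<rparr>"
proof -
  note pw = perm[OF w]
  define f where "f i = w ! (i - 1)" for i
  define G where "G = \<lparr>verts = V, edges = window w ` {..<M}\<rparr>"
  have kl: "k - l = g" using l by simp
  have ndiv: "n div g = M" using n g by simp
  have "subhypergraph G \<lparr>verts = V, edges = E\<rparr>" using E by (simp add: subhypergraph_def G_def)
  moreover have "hypergraph_iso f (ell_cycle n k l) G"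
    unfolding hypergraph_iso_def
  proof
    have "bij_betw ((!) w) {..<n} V" using bij_betw_nth[of w] pw by simp
    moreover have "bij_betw (\<lambda>i. i - 1) {1..n} {..<n}"
      by (rule bij_betwI[where g = Suc]) auto
    ultimately have "bij_betw ((!) w \<circ> (\<lambda>i. i - 1)) {1..n} V" by (rule bij_betw_trans[rotated])
    then show "bij_betw f (verts (ell_cycle n k l)) (verts G)"
      by (simp add: ell_cycle_def G_def f_def[abs_def] comp_def)
    have win: "f ` (\<lambda>x. (x - 1) mod n + 1) ` {g * (Suc j - 1) + 1..g * (Suc j - 1) + k} = window w j" for j
    proof -
      have "{g * (Suc j - 1) + 1..g * (Suc j - 1) + k} = (\<lambda>t. j * g + t + 1) ` {..<k}"
      proof -
        have "(\<lambda>t. j * g + t + 1) ` {..<k} = (+) (j * g + 1) ` {0..<k}"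
          unfolding atLeast0LessThan by (intro image_cong) auto
        also have "\<dots> = {j * g + 1..<k + (j * g + 1)}"
          by (simp only: image_add_atLeastLessThan add_0)
        also have "\<dots> = {g * (Suc j - 1) + 1..g * (Suc j - 1) + k}" by (auto simp: mult.commute)
        finally show ?thesis ..
      qed
      then show ?thesis by (simp add: window_def image_image f_def)
    qed
    have "{1..M} = Suc ` {..<M}" by (simp add: image_Suc_lessThan)
    then have "(\<lambda>e. f ` e) ` edges (ell_cycle n k l) = window w ` {..<M}"
      unfolding ell_cycle_def kl ndiv by (simp only: hypergraph.simps image_image win[unfolded image_image])
    then show "edges G = (\<lambda>e. f ` e) ` edges (ell_cycle n k l)" by (simp add: G_def)
  qed
  ultimately show ?thesis
    unfolding has_Hamilton_ell_cycle_def contains_copy_def using V by auto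
qed

end

lemma exponential_beats_power: "(\<lambda>n. 2 ^ n * ((real n ^ g) ^ k * (1 / 4) ^ (n - k * k))) \<longlonglongrightarrow> 0"
proof -
  have "(\<lambda>n. 4 ^ (k * k) * (real n powr real (g * k) * (1 / 2) ^ n)) \<longlonglongrightarrow> 0" by real_asymp
  then show ?thesis
  proof (rule Lim_transform_eventually)
    show "\<forall>\<^sub>F n in sequentially. 4 ^ (k * k) * (real n powr real (g * k) * (1 / 2) ^ n) = 2 ^ n * ((real n ^ g) ^ k * (1 / 4) ^ (n - k * k))"
      using eventually_ge_at_top[of "k * k + 1"]
    proof eventually_elim
      case (elim n)
      have "(1 / 4 :: real) ^ (n - k * k) * (1 / 4) ^ (k * k) = (1 / 4) ^ n"
        using elim by (simp flip: power_add)
      then have q: "(1 / 4 :: real) ^ (n - k * k) = 4 ^ (k * k) * (1 / 4) ^ n"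
        by (simp add: power_one_over field_simps)
      have h: "(2 :: real) ^ n * (1 / 4) ^ n = (1 / 2) ^ n"
        by (simp flip: power_mult_distrib)
      have "real n powr real (g * k) = (real n ^ g) ^ k" 
        using elim by (subst powr_realpow) (auto simp: power_mult)
      then show ?case unfolding q h[symmetric] by simp
    qed
  qed
qed

theorem theorem1p9:
  fixes \<alpha> :: real and k d l :: nat
    and H :: "nat \<Rightarrow> 'a hypergraph" and p :: "nat \<Rightarrow> real"
  assumes "\<alpha> > 0"
    and "d \<in> {1..k - 1}"
    and "l \<in> {2..k - 1}"
    and "\<forall>\<^sub>F n in sequentially_multiples (k - l).
           uniform_hypergraph k (H n) \<and> card (verts (H n)) = n \<and>
           real (min_degree d (H n)) \<ge> (delta_CON k l d + \<alpha>) * real ((n - d) choose (k - d))"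
    and "\<And>n. 0 \<le> p n \<and> p n \<le> 1"
    and "filterlim (\<lambda>n. p n * real n ^ (k - l)) at_top (sequentially_multiples (k - l))"
  shows "((\<lambda>n. measure_pmf.prob (random_subhypergraph (H n) (p n))
                 {G. has_Hamilton_ell_cycle k l G}) \<longlongrightarrow> 1)
           (sequentially_multiples (k - l))"
proof -
  define F where "F = sequentially_multiples (k - l)"
  define g where "g = k - l"
  have dk: "d < k" and l: "0 < l" "l < k" "2 \<le> l" using assms(2,3) by auto
  have gl: "g + l = k" "0 < g" "g + 2 \<le> k" using l by (auto simp: g_def)
  have ev: "eventually P F" if "eventually P sequentially" for P
    unfolding F_def sequentially_multiples_def eventually_inf_principal using that by (rule eventually_mono) simp
  have ev_dvd: "\<forall>\<^sub>F n in F. g dvd n"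
    unfolding F_def sequentially_multiples_def eventually_inf_principal by (simp add: g_def)
  have le_seq: "F \<le> sequentially" unfolding F_def sequentially_multiples_def by simp
  define \<delta> where "\<delta> = delta_CON k l d"
  have least: "\<And>\<alpha>. \<alpha> > 0 \<Longrightarrow> Hamilton_connected_above k l d (\<delta> + \<alpha>)" and \<delta>0: "0 \<le> \<delta>"
    using delta_CON_is_least(1,3)[OF dk l(2)] by (auto simp: \<delta>_def)
  \<comment> \<open>Of the surplus \<alpha>, one quarter goes into
    \<open>eventually_degree_at_least\<close>, one quarter separates \<open>c\<close> from the
    connectivity constant and so feeds the halvings, and the remaining half keeps that constant
    strictly above the threshold.\<close>
  define c where "c = (\<delta> + 3 * \<alpha> / 4) / fact (k - d)"
  have "\<exists>L N0. 1 \<le> L \<and> 0 < N0 \<and> (\<forall>N\<ge>N0. spread_connection TYPE('a) k l d c L N \<and> decay N \<le> 1 / 2 \<and> 3 * k \<le> N \<and>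
     2 * real ((N + 2 * l) choose d) * ((real N + 1) * exp (- ((decay N)\<^sup>2 * N / 4))) \<le> decay N / 10)"
  proof (rule spread_connection_exists[OF l(1,2) dk])
    show "0 \<le> \<delta> + \<alpha> / 2" using \<delta>0 assms(1) by simp
    show "(\<delta> + \<alpha> / 2) / fact (k - d) < c"
      unfolding c_def using assms(1) by (intro divide_strict_right_mono) auto
    show "Hamilton_connected_above k l d (\<delta> + \<alpha> / 2)" using least[of "\<alpha> / 2"] assms(1) by simp
  qed
  then obtain L N0 where L: "1 \<le> L" "0 < N0" and conn: "\<And>N. N0 \<le> N \<Longrightarrow>
      spread_connection TYPE('a) k l d c L N \<and> decay N \<le> 1 / 2 \<and> 3 * k \<le> N \<and>
      2 * real ((N + 2 * l) choose d) * ((real N + 1) * exp (- ((decay N)\<^sup>2 * N / 4))) \<le> decay N / 10"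
    by blast
  \<comment> \<open>\<open>2 * L\<close> is the spread constant of closed sequences;
    \<open>exp 1\<close> comes from comparing \<open>fact (n - v) / fact n\<close> with powers of
    \<open>1 / n\<close>.\<close>
  define \<kappa> where "\<kappa> = 2 * L * exp 1"
  have \<kappa>1: "1 \<le> \<kappa>"
  proof -
    have "1 * 1 \<le> (2 * L) * exp (1 :: real)" using L by (intro mult_mono) auto
    then show ?thesis by (simp add: \<kappa>_def)
  qed
  \<comment> \<open>The numerator is constant, so the hypothesis on \<open>p\<close> makes this tend
    to 0.\<close>
  define \<beta> where "\<beta> n = real k ^ (k + 1) * \<kappa> ^ k / (p n * real n ^ g)" for n
  define err where "err n = 2 * \<beta> n + 2 ^ n * ((real n ^ g) ^ k * (1 / 4) ^ (n - k * k))" for n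
  have \<omega>: "filterlim (\<lambda>n. p n * real n ^ g) at_top F" using assms(6) by (simp add: F_def g_def)
  have \<beta>0: "(\<beta> \<longlongrightarrow> 0) F" unfolding \<beta>_def[abs_def]
    by (rule real_tendsto_divide_at_top[OF tendsto_const \<omega>])
  have "((\<lambda>n. 2 ^ n * ((real n ^ g) ^ k * (1 / 4) ^ (n - k * k)) :: real) \<longlongrightarrow> 0) F"
    using exponential_beats_power le_seq by (rule tendsto_mono[rotated])
  then have "((\<lambda>n. 2 * \<beta> n + 2 ^ n * ((real n ^ g) ^ k * (1 / 4) ^ (n - k * k))) \<longlongrightarrow> 2 * 0 + 0) F"
    by (intro tendsto_add tendsto_mult tendsto_const \<beta>0)
  then have err0: "(err \<longlongrightarrow> 0) F" by (simp add: err_def[abs_def])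
  have "\<forall>\<^sub>F n in F. \<beta> n < 1 / (2 * (real k + 1))" by (rule order_tendstoD(2)[OF \<beta>0]) simp
  moreover have "\<forall>\<^sub>F n in F. \<beta> n < (1 / 4) ^ k" by (rule order_tendstoD(2)[OF \<beta>0]) simp
  \<comment> \<open>Excludes \<open>p n = 0\<close> and gives the crude bound
    \<open>1 / p n \<le> n ^ g\<close> used for wrapping windows.\<close>
  moreover have "\<forall>\<^sub>F n in F. 1 \<le> p n * real n ^ g" using \<omega> by (simp add: filterlim_at_top)
  moreover note ev_dvd
  moreover have "\<forall>\<^sub>F n in F. 3 * N0 + l + k \<le> n" by (rule ev[OF eventually_ge_at_top])
  moreover note assms(4)[folded F_def \<delta>_def]
  moreover note ev[OF eventually_degree_at_least[OF dk \<delta>0 assms(1), of l, where 'a = 'a]]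
  ultimately have lower: "\<forall>\<^sub>F n in F. 1 - err n \<le> measure_pmf.prob (random_subhypergraph (H n) (p n))
                 {G. has_Hamilton_ell_cycle k l G}"
  proof eventually_elim
    case (elim n)
    define V where "V = verts (H n)"
    define E where "E = edges (H n)"
    have H: "uniform_hypergraph k (H n)" "card V = n" using elim by (auto simp: V_def)
    have finV: "finite V" using H by (simp add: uniform_hypergraph_def V_def)
    have finE: "finite E"
      by (rule finite_subset[of _ "Pow V"]) (use H finV in \<open>auto simp: uniform_hypergraph_def V_def E_def\<close>)
    have deg: "degree_at_least E V (V - set x) d (k - d) c" if "set x \<subseteq> V" "length x = l" for x
      using elim that by (auto simp: V_def E_def c_def)
    have pos: "0 < p n"
    proof (rule ccontr)
      assume "\<not> 0 < p n"
      then have "p n = 0" using assms(5)[of n] by simp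
      then show False using elim(3) by simp
    qed
    have nM: "n = (n div g) * g" using elim(4) by simp
    interpret window_bounds k g n "n div g" V \<kappa> "p n" "\<beta> n"
      by unfold_locales (use gl nM elim(5) finV H \<kappa>1 pos assms(5)[of n] in \<open>auto simp: \<beta>_def\<close>)
    have "has_spread V (2 * L) (\<lambda>w. ell_seq k (k - l) E (w @ take l w))"
      by (rule spread_closed_sequences[OF l(1,2) dk L conn finV H(2) _ _ deg])
        (use elim(4,5) in \<open>auto simp: g_def\<close>)
    then obtain m where m: "\<And>w. 0 \<le> m w" "\<And>w. m w \<noteq> 0 \<Longrightarrow> ell_seq k g E (w @ take l w)"
      "(\<Sum>w\<in>perms V. m w) = 1"
      "spread_bound V (2 * L) m"
      unfolding has_spread_def g_def by blast
    have sub: "window w ` {..<n div g} \<subseteq> E" if "w \<in> perms V" "m w \<noteq> 0" for w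
    proof (rule image_subsetI)
      fix j assume "j \<in> {..<n div g}"
      then have j: "j < n div g" by simp
      have "(j + 1) * g \<le> (n div g) * g" using j by (intro mult_le_mono) auto
      then have "j * g + k \<le> length (w @ take l w)"
        using perm[OF that(1)] gl nM elim(5) by simp
      then have "set (take k (drop (j * g) (w @ take l w))) \<in> E"
        using m(2)[OF that(2)] by (simp add: ell_seq_def)
      then show "window w j \<in> E" using window_closed[OF that(1) gl(1) j] by simp
    qed
    have "1 - err n \<le> measure_pmf.prob (Pi_pmf E False (\<lambda>_. bernoulli_pmf (p n)))
      {X. \<exists>w\<in>perms V. m w \<noteq> 0 \<and> (\<forall>e\<in>window w ` {..<n div g}. X e)}"
    proof (rule second_moment_existence[OF finE pos])
      fix u assume u: "u \<in> perms V"
      show "(\<Sum>w\<in>perms V. m w * (1 / p n) ^ card (window w ` {..<n div g} \<inter> window u ` {..<n div g})) \<le> 1 + err n"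
        unfolding err_def
      proof (rule correlation_bound[OF u m(1,3) _ _ m(4)])
        show "\<beta> n * (real k + 1) \<le> 1 / 2" using elim(1) by (simp add: field_simps)
        show "1 / p n \<le> real n ^ g" using elim(3) pos by (simp add: field_simps)
      qed (use elim(2) L in \<open>auto simp: \<kappa>_def\<close>)
    qed (use assms(5)[of n] finV m sub in auto)
    also have "\<dots> \<le> measure_pmf.prob (Pi_pmf E False (\<lambda>_. bernoulli_pmf (p n)))
      ((\<lambda>X. \<lparr>verts = V, edges = {e \<in> E. X e}\<rparr>) -` {G. has_Hamilton_ell_cycle k l G})"
    proof (rule measure_pmf.finite_measure_mono)
      show "{X. \<exists>w\<in>perms V. m w \<noteq> 0 \<and> (\<forall>e\<in>window w ` {..<n div g}. X e)}
        \<subseteq> (\<lambda>X. \<lparr>verts = V, edges = {e \<in> E. X e}\<rparr>) -` {G. has_Hamilton_ell_cycle k l G}"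
      proof
        fix X assume "X \<in> {X. \<exists>w\<in>perms V. m w \<noteq> 0 \<and> (\<forall>e\<in>window w ` {..<n div g}. X e)}"
        then obtain w where w: "w \<in> perms V" "m w \<noteq> 0" "\<forall>e\<in>window w ` {..<n div g}. X e" by blast
        then have "window w ` {..<n div g} \<subseteq> {e \<in> E. X e}" using sub by blast
        then show "X \<in> (\<lambda>X. \<lparr>verts = V, edges = {e \<in> E. X e}\<rparr>) -` {G. has_Hamilton_ell_cycle k l G}"
          using Hamilton_cycle_of_windows[OF w(1) gl(1)] by simp
      qed
    qed simp
    also have "\<dots> = measure_pmf.prob (random_subhypergraph (H n) (p n)) {G. has_Hamilton_ell_cycle k l G}"
      by (simp add: random_subhypergraph_def V_def E_def)
    finally show ?case .
  qed
  have "((\<lambda>n. measure_pmf.prob (random_subhypergraph (H n) (p n)) {G. has_Hamilton_ell_cycle k l G}) \<longlongrightarrow> 1) F"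
  proof (rule tendsto_sandwich[OF lower])
    show "\<forall>\<^sub>F n in F. measure_pmf.prob (random_subhypergraph (H n) (p n)) {G. has_Hamilton_ell_cycle k l G} \<le> 1"
      by simp
    show "((\<lambda>n. 1 - err n) \<longlongrightarrow> 1) F" using tendsto_diff[OF tendsto_const err0, of 1] by simp
  qed simp
  then show ?thesis by (simp add: F_def)
qed

end
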